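(* Let $X$ be a finite graph with vertices $\{1,\ldots,d\}$, and let $G=G(X,\{M_i\},\{R_{i,j}\})$ be a mixed Kac-Moody-Steinberg group in which each $M_i$ is a finitely generated abelian group. For each edge $(i,j)\in E(X)$ with $i<j$ let $m_{i,j}$ be the minimal index of a proper right ideal in $R_{i,j}$, let $m=\min\{m_{i,j}\}$, and assume that $m>(d-1)^2$. Then $$\kappa\Big(G,\bigcup_{i=1}^d G_i\Big)\ge\sqrt{\frac2d\left(1-\frac{d-1}{\sqrt m}\right)}.$$ In particular, if each $M_i$ is finite, then $G$ has property $(T)$.
   Context: Mixed Kac-Moody-Steinberg (KMS) group: let $X$ be a finite graph without loops or multiple edges with vertices $\{1,\ldots,d\}$ and (unoriented) edge set $E(X)$, let $M_1,\ldots,M_d$ be abelian groups, and suppose that for every edge $(i,j)\in E(X)$ with $i<j$ there is given an associative ring $R_{i,j}$ with $1$ such that $M_i$ is a right $R_{i,j}$-module and $M_j$ is a left $R_{i,j}$-module. For each $i$ let $G_i$ be the group with elements $\{x_i(a): a\in M_i\}$ and $x_i(a)x_i(a')=x_i(a+a')$, so $G_i\cong M_i$. Then $G(X,\{M_i\},\{R_{i,j}\})$ is the group generated by $G_1,\ldots,G_d$ subject to the relations: (1) if $(i,j)\notin E(X)$, then $G_i$ and $G_j$ commute; (2) if $i<j$ and $(i,j)\in E(X)$, then $[x_i(ar),x_j(b)]=[x_i(a),x_j(rb)]$ for all $a\in M_i$, $b\in M_j$, $r\in R_{i,j}$, and $[G_i,G_j]$ commutes with both $G_i$ and $G_j$.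 (An index is taken to be $\infty$, with $1/\sqrt\infty=0$, when no proper right ideal of finite index, or no edge, exists.) Kazhdan constant: for a discrete group $G$ and $S\subseteq G$, $\kappa(G,S)$ is the infimum, over all unitary representations $V$ of $G$ (on complex Hilbert spaces) without nonzero $G$-invariant vectors, of $\inf\{\varepsilon>0: \exists\,0\ne v\in V,\ \|sv-v\|\le\varepsilon\|v\|\ \forall s\in S\}$. $G$ has property $(T)$ if $\kappa(G,S)>0$ for some finite $S\subseteq G$. *)

theory Defs
  imports
    "HOL-Analysis.Abstract_Metric_Spaces"
    "HOL-Algebra.Algebra"
    "HOL-Library.Extended_Nat"
    "HOL-Library.Extended_Real"
begin

section \<open>One-sided modules and right ideals\<close>

text \<open>
  The locale \<^locale>\<open>Module.module\<close> requires a commutative ring of scalars, so modules over an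
  arbitrary ring are introduced here. All modules are unital, and the underlying abelian group is
  a \<^locale>\<open>comm_group\<close>, hence written multiplicatively.
\<close>

locale right_module = R?: ring R + M?: comm_group M
  for R :: "('r, 'x) ring_scheme" (structure) and M :: "('m, 'y) monoid_scheme" (structure) +
  fixes act :: "'m \<Rightarrow> 'r \<Rightarrow> 'm"
  assumes act_closed: "a \<in> carrier M \<Longrightarrow> r \<in> carrier R \<Longrightarrow> act a r \<in> carrier M"
    and act_mult: "a \<in> carrier M \<Longrightarrow> b \<in> carrier M \<Longrightarrow> r \<in> carrier R \<Longrightarrow>
      act (a \<otimes>\<^bsub>M\<^esub> b) r = act a r \<otimes>\<^bsub>M\<^esub> act b r"
    and act_add: "a \<in> carrier M \<Longrightarrow> r \<in> carrier R \<Longrightarrow> s \<in> carrier R \<Longrightarrow>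
      act a (r \<oplus>\<^bsub>R\<^esub> s) = act a r \<otimes>\<^bsub>M\<^esub> act a s"
    and act_assoc: "a \<in> carrier M \<Longrightarrow> r \<in> carrier R \<Longrightarrow> s \<in> carrier R \<Longrightarrow>
      act a (r \<otimes>\<^bsub>R\<^esub> s) = act (act a r) s"
    and act_one: "a \<in> carrier M \<Longrightarrow> act a \<one>\<^bsub>R\<^esub> = a"

locale left_module = R?: ring R + M?: comm_group M
  for R :: "('r, 'x) ring_scheme" (structure) and M :: "('m, 'y) monoid_scheme" (structure) +
  fixes act :: "'r \<Rightarrow> 'm \<Rightarrow> 'm"
  assumes act_closed: "r \<in> carrier R \<Longrightarrow> a \<in> carrier M \<Longrightarrow> act r a \<in> carrier M"
    and act_mult: "r \<in> carrier R \<Longrightarrow> a \<in> carrier M \<Longrightarrow> b \<in> carrier M \<Longrightarrow>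
      act r (a \<otimes>\<^bsub>M\<^esub> b) = act r a \<otimes>\<^bsub>M\<^esub> act r b"
    and act_add: "r \<in> carrier R \<Longrightarrow> s \<in> carrier R \<Longrightarrow> a \<in> carrier M \<Longrightarrow>
      act (r \<oplus>\<^bsub>R\<^esub> s) a = act r a \<otimes>\<^bsub>M\<^esub> act s a"
    and act_assoc: "r \<in> carrier R \<Longrightarrow> s \<in> carrier R \<Longrightarrow> a \<in> carrier M \<Longrightarrow>
      act (r \<otimes>\<^bsub>R\<^esub> s) a = act r (act s a)"
    and act_one: "a \<in> carrier M \<Longrightarrow> act \<one>\<^bsub>R\<^esub> a = a"

definition right_ideal :: "'r set \<Rightarrow> ('r, 'x) ring_scheme \<Rightarrow> bool" where
  "right_ideal I R \<longleftrightarrow>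
     additive_subgroup I R \<and> (\<forall>a\<in>I. \<forall>r\<in>carrier R. a \<otimes>\<^bsub>R\<^esub> r \<in> I)"

definition ideal_index :: "('r, 'x) ring_scheme \<Rightarrow> 'r set \<Rightarrow> enat" where
  "ideal_index R I =
     (if finite (a_rcosets\<^bsub>R\<^esub> I) then enat (card (a_rcosets\<^bsub>R\<^esub> I)) else \<infinity>)"

text \<open>In \<^typ>\<open>enat\<close> the infimum of the empty set is \<open>\<infinity>\<close>.\<close>

definition min_right_ideal_index :: "('r, 'x) ring_scheme \<Rightarrow> enat" where
  "min_right_ideal_index R = (INF I\<in>{I. right_ideal I R \<and> I \<noteq> carrier R}. ideal_index R I)"

definition inv_sqrt :: "enat \<Rightarrow> real" where
  "inv_sqrt m = (case m of enat n \<Rightarrow> 1 / sqrt (real n) | \<infinity> \<Rightarrow> 0)"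

definition fin_gen_group :: "('g, 'x) monoid_scheme \<Rightarrow> bool" where
  "fin_gen_group G \<longleftrightarrow> (\<exists>A. finite A \<and> A \<subseteq> carrier G \<and> generate G A = carrier G)"


section \<open>Groups given by generators and relations\<close>

text \<open>
  The letter \<open>(x, True)\<close> stands for the generator \<open>x\<close> and \<open>(x, False)\<close> for its formal inverse.
  A relation \<open>u = v\<close> is given as the pair \<open>(u, v)\<close> of words.
\<close>

type_synonym 'x word = "('x \<times> bool) list"

definition words :: "'x set \<Rightarrow> 'x word set" where
  "words Gen = lists (Gen \<times> UNIV)"

definition word_inv :: "'x word \<Rightarrow> 'x word" where
  "word_inv w = rev (map (\<lambda>(x, e). (x, \<not> e)) w)"

definition word_commutator :: "'x word \<Rightarrow> 'x word \<Rightarrow> 'x word" where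
  "word_commutator u v = u @ v @ word_inv u @ word_inv v"

inductive pres_eq :: "'x set \<Rightarrow> ('x word \<times> 'x word) set \<Rightarrow> 'x word \<Rightarrow> 'x word \<Rightarrow> bool"
  for Gen and Rel
where
  rel: "(u, v) \<in> Rel \<Longrightarrow> pres_eq Gen Rel u v"
| cancel: "x \<in> Gen \<Longrightarrow> pres_eq Gen Rel [(x, e), (x, \<not> e)] []"
| refl: "w \<in> words Gen \<Longrightarrow> pres_eq Gen Rel w w"
| sym: "pres_eq Gen Rel u v \<Longrightarrow> pres_eq Gen Rel v u"
| trans: "pres_eq Gen Rel u v \<Longrightarrow> pres_eq Gen Rel v w \<Longrightarrow> pres_eq Gen Rel u w"
| app: "pres_eq Gen Rel u u' \<Longrightarrow> pres_eq Gen Rel v v' \<Longrightarrow> pres_eq Gen Rel (u @ v) (u' @ v')"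

definition pres_class :: "'x set \<Rightarrow> ('x word \<times> 'x word) set \<Rightarrow> 'x word \<Rightarrow> 'x word set" where
  "pres_class Gen Rel w = {w'. pres_eq Gen Rel w w'}"

definition presented_group ::
  "'x set \<Rightarrow> ('x word \<times> 'x word) set \<Rightarrow> 'x word set monoid" where
  "presented_group Gen Rel =
     \<lparr>carrier = pres_class Gen Rel ` words Gen,
      monoid.mult = (\<lambda>A B. \<Union>u\<in>A. \<Union>v\<in>B. pres_class Gen Rel (u @ v)),
      one = pres_class Gen Rel []\<rparr>"

definition word_val :: "('h, 'z) monoid_scheme \<Rightarrow> ('x \<Rightarrow> 'h) \<Rightarrow> 'x word \<Rightarrow> 'h" where
  "word_val K f w =
     foldr (\<lambda>(x, e) y. (if e then f x else inv\<^bsub>K\<^esub> f x) \<otimes>\<^bsub>K\<^esub> y) w \<one>\<^bsub>K\<^esub>"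

lemma Nil_in_words [simp]: "[] \<in> words Gen"
  by (simp add: words_def)

lemma Cons_in_words [simp]: "(x, e) # w \<in> words Gen \<longleftrightarrow> x \<in> Gen \<and> w \<in> words Gen"
  by (auto simp: words_def)

lemma append_in_words [simp]: "u @ v \<in> words Gen \<longleftrightarrow> u \<in> words Gen \<and> v \<in> words Gen"
  by (simp add: words_def)

lemma word_inv_Nil [simp]: "word_inv [] = []"
  by (simp add: word_inv_def)

lemma word_inv_Cons [simp]: "word_inv ((x, e) # w) = word_inv w @ [(x, \<not> e)]"
  by (simp add: word_inv_def)

lemma word_inv_in_words [simp]: "w \<in> words Gen \<Longrightarrow> word_inv w \<in> words Gen"
  by (induction w) auto

lemma pres_eq_words:
  assumes "Rel \<subseteq> words Gen \<times> words Gen" "pres_eq Gen Rel u v"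
  shows "u \<in> words Gen \<and> v \<in> words Gen"
  using assms(2) by induction (use assms(1) in auto)

lemma pres_class_eq_iff:
  assumes "u \<in> words Gen"
  shows "pres_class Gen Rel u = pres_class Gen Rel v \<longleftrightarrow> pres_eq Gen Rel u v"
  unfolding pres_class_def
  using assms by (auto intro: pres_eq.intros dest: pres_eq.sym pres_eq.trans)

lemma pres_class_mult:
  assumes "u \<in> words Gen" "v \<in> words Gen"
  shows "pres_class Gen Rel u \<otimes>\<^bsub>presented_group Gen Rel\<^esub> pres_class Gen Rel v
    = pres_class Gen Rel (u @ v)"
proof -
  have eq: "pres_class Gen Rel (u' @ v') = pres_class Gen Rel (u @ v)"
    if "u' \<in> pres_class Gen Rel u" "v' \<in> pres_class Gen Rel v" for u' v'
  proof -
    have "pres_eq Gen Rel (u @ v) (u' @ v')"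
      using that by (intro pres_eq.app) (simp_all add: pres_class_def)
    then show ?thesis using pres_class_eq_iff[of "u @ v" Gen Rel "u' @ v'"] assms by simp
  qed
  have mem: "u \<in> pres_class Gen Rel u" "v \<in> pres_class Gen Rel v"
    using assms by (simp_all add: pres_class_def pres_eq.refl)
  have "pres_class Gen Rel u \<otimes>\<^bsub>presented_group Gen Rel\<^esub> pres_class Gen Rel v
    = (\<Union>u'\<in>pres_class Gen Rel u. \<Union>v'\<in>pres_class Gen Rel v. pres_class Gen Rel (u' @ v'))"
    by (simp add: presented_group_def)
  also have "\<dots> = (\<Union>u'\<in>pres_class Gen Rel u. \<Union>v'\<in>pres_class Gen Rel v. pres_class Gen Rel (u @ v))"
    by (intro SUP_cong HOL.refl eq)
  also have "\<dots> = pres_class Gen Rel (u @ v)"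
    using mem by blast
  finally show ?thesis .
qed

lemma pres_eq_left_inv:
  assumes "w \<in> words Gen"
  shows "pres_eq Gen Rel (word_inv w @ w) []"
  using assms
proof (induction w)
  case Nil
  then show ?case by (simp add: pres_eq.refl)
next
  case (Cons a w)
  obtain x e where a: "a = (x, e)" by force
  with Cons.prems have x: "x \<in> Gen" and w: "w \<in> words Gen" by auto
  have "pres_eq Gen Rel (word_inv w @ ([(x, \<not> e), (x, e)] @ w)) (word_inv w @ ([] @ w))"
    using pres_eq.cancel[OF x, of Rel "\<not> e"] w
    by (intro pres_eq.app pres_eq.refl) auto
  with Cons.IH[OF w] show ?case
    by (auto simp: a intro: pres_eq.trans)
qed

lemma group_presented_group: "group (presented_group Gen Rel)"
proof (rule groupI)
  fix A assume "A \<in> carrier (presented_group Gen Rel)"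
  then obtain w where w: "w \<in> words Gen" "A = pres_class Gen Rel w"
    by (auto simp: presented_group_def)
  have "pres_class Gen Rel (word_inv w) \<otimes>\<^bsub>presented_group Gen Rel\<^esub> A
      = \<one>\<^bsub>presented_group Gen Rel\<^esub>"
    using w pres_eq_left_inv[OF w(1), of Rel]
    by (simp add: pres_class_mult pres_class_eq_iff) (simp add: presented_group_def pres_class_eq_iff)
  moreover have "pres_class Gen Rel (word_inv w) \<in> carrier (presented_group Gen Rel)"
    using w by (auto simp: presented_group_def)
  ultimately show "\<exists>B\<in>carrier (presented_group Gen Rel).
      B \<otimes>\<^bsub>presented_group Gen Rel\<^esub> A = \<one>\<^bsub>presented_group Gen Rel\<^esub>"
    by blast
  have "\<one>\<^bsub>presented_group Gen Rel\<^esub> = pres_class Gen Rel []"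
    by (simp add: presented_group_def)
  then show "\<one>\<^bsub>presented_group Gen Rel\<^esub> \<otimes>\<^bsub>presented_group Gen Rel\<^esub> A = A"
    using w by (simp add: pres_class_mult)
next
  fix A B assume "A \<in> carrier (presented_group Gen Rel)" "B \<in> carrier (presented_group Gen Rel)"
  then obtain u v where "u \<in> words Gen" "A = pres_class Gen Rel u"
    "v \<in> words Gen" "B = pres_class Gen Rel v"
    by (auto simp: presented_group_def)
  then show "A \<otimes>\<^bsub>presented_group Gen Rel\<^esub> B \<in> carrier (presented_group Gen Rel)"
    by (simp add: pres_class_mult) (simp add: presented_group_def)
next
  fix A B C
  assume "A \<in> carrier (presented_group Gen Rel)" "B \<in> carrier (presented_group Gen Rel)"
    "C \<in> carrier (presented_group Gen Rel)"
  then obtain u v w where "u \<in> words Gen" "A = pres_class Gen Rel u"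
    "v \<in> words Gen" "B = pres_class Gen Rel v" "w \<in> words Gen" "C = pres_class Gen Rel w"
    by (auto simp: presented_group_def)
  then show "A \<otimes>\<^bsub>presented_group Gen Rel\<^esub> B \<otimes>\<^bsub>presented_group Gen Rel\<^esub> C
      = A \<otimes>\<^bsub>presented_group Gen Rel\<^esub> (B \<otimes>\<^bsub>presented_group Gen Rel\<^esub> C)"
    by (simp add: pres_class_mult)
next
  show "\<one>\<^bsub>presented_group Gen Rel\<^esub> \<in> carrier (presented_group Gen Rel)"
    unfolding presented_group_def monoid.simps partial_object.simps by (rule imageI) simp
qed

lemma word_val_Nil [simp]: "word_val K f [] = \<one>\<^bsub>K\<^esub>"
  by (simp add: word_val_def)

lemma word_val_Cons [simp]:
  "word_val K f ((x, e) # w) = (if e then f x else inv\<^bsub>K\<^esub> f x) \<otimes>\<^bsub>K\<^esub> word_val K f w"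
  by (simp add: word_val_def)

lemma word_val_closed:
  assumes "group K" "f \<in> Gen \<rightarrow> carrier K" "w \<in> words Gen"
  shows "word_val K f w \<in> carrier K"
  using assms(3)
proof (induction w)
  case Nil
  interpret K: group K by fact
  show ?case by simp
next
  case (Cons a w)
  interpret K: group K by fact
  obtain x e where a: "a = (x, e)" by force
  with Cons.prems have x: "f x \<in> carrier K" and w: "w \<in> words Gen" using assms(2) by auto
  show ?case unfolding a using x Cons.IH[OF w] by simp
qed

lemma word_val_append:
  assumes "group K" "f \<in> Gen \<rightarrow> carrier K" "u \<in> words Gen" "v \<in> words Gen"
  shows "word_val K f (u @ v) = word_val K f u \<otimes>\<^bsub>K\<^esub> word_val K f v"
  using assms(3)
proof (induction u)
  case Nil
  interpret K: group K by fact
  show ?case using word_val_closed[OF assms(1,2,4)] by simp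
next
  case (Cons a u)
  interpret K: group K by fact
  obtain x e where a: "a = (x, e)" by force
  with Cons.prems have x: "f x \<in> carrier K" and u: "u \<in> words Gen" using assms(2) by auto
  have y: "(if e then f x else inv\<^bsub>K\<^esub> f x) \<in> carrier K" using x by simp
  show ?case
    unfolding a append_Cons word_val_Cons Cons.IH[OF u]
    by (rule K.m_assoc[symmetric, OF y word_val_closed[OF assms(1,2) u]
          word_val_closed[OF assms(1,2,4)]])
qed

text \<open>The universal property of the presented group.\<close>

lemma presented_group_universal:
  assumes K: "group K" and f: "f \<in> Gen \<rightarrow> carrier K" and Rel: "Rel \<subseteq> words Gen \<times> words Gen"
    and rel: "\<And>u v. (u, v) \<in> Rel \<Longrightarrow> word_val K f u = word_val K f v"
  shows "\<exists>h\<in>hom (presented_group Gen Rel) K. \<forall>x\<in>Gen. h (pres_class Gen Rel [(x, True)]) = f x"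
proof -
  interpret K: group K by fact
  have inv: "word_val K f u = word_val K f v" if "pres_eq Gen Rel u v" for u v
    using that
  proof induction
    case (cancel x e)
    then have "f x \<in> carrier K" using f by auto
    then show ?case by simp
  next
    case (app u u' v v')
    then show ?case
      using word_val_append[OF K f] pres_eq_words[OF Rel] by metis
  qed (use rel in auto)
  define h where "h A = word_val K f (SOME w. w \<in> A)" for A
  have h: "h (pres_class Gen Rel w) = word_val K f w" if "w \<in> words Gen" for w
  proof -
    have "w \<in> pres_class Gen Rel w" using that by (simp add: pres_class_def pres_eq.refl)
    then have "(SOME w'. w' \<in> pres_class Gen Rel w) \<in> pres_class Gen Rel w" by (rule someI)
    then show ?thesis unfolding h_def pres_class_def using inv by auto
  qed
  have "h \<in> hom (presented_group Gen Rel) K"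
  proof (rule homI)
    fix A assume "A \<in> carrier (presented_group Gen Rel)"
    then show "h A \<in> carrier K"
      using h word_val_closed[OF K f] by (auto simp: presented_group_def)
  next
    fix A B assume "A \<in> carrier (presented_group Gen Rel)" "B \<in> carrier (presented_group Gen Rel)"
    then obtain u v where "u \<in> words Gen" "A = pres_class Gen Rel u"
      "v \<in> words Gen" "B = pres_class Gen Rel v"
      by (auto simp: presented_group_def)
    then show "h (A \<otimes>\<^bsub>presented_group Gen Rel\<^esub> B) = h A \<otimes>\<^bsub>K\<^esub> h B"
      using word_val_append[OF K f] by (simp add: pres_class_mult h)
  qed
  moreover have "h (pres_class Gen Rel [(x, True)]) = f x" if "x \<in> Gen" for x
    using that f h[of "[(x, True)]"] by (auto simp: Pi_iff group.is_monoid)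
  ultimately show ?thesis by blast
qed


section \<open>Mixed Kac-Moody-Steinberg groups\<close>

text \<open>
  The vertices of the graph are \<open>{1..d}\<close> and \<open>E\<close> is its set of unoriented edges. The groups \<open>M i\<close>
  have their elements in one type, and so do the rings \<open>R i j\<close>; as carriers are arbitrary subsets
  of these types, this is no restriction for a finite family. Only the values of \<open>R\<close>, \<open>ract\<close> and
  \<open>lact\<close> at \<open>i < j\<close> with \<open>{i, j} \<in> E\<close> matter: \<open>ract i j\<close> is the right action of \<open>R i j\<close> on \<open>M i\<close>
  and \<open>lact i j\<close> the left action of \<open>R i j\<close> on \<open>M j\<close>.
\<close>

locale kms_data =
  fixes d :: nat and E :: "nat set set" and M :: "nat \<Rightarrow> 'm monoid"
    and R :: "nat \<Rightarrow> nat \<Rightarrow> 'r ring"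
    and ract :: "nat \<Rightarrow> nat \<Rightarrow> 'm \<Rightarrow> 'r \<Rightarrow> 'm" and lact :: "nat \<Rightarrow> nat \<Rightarrow> 'r \<Rightarrow> 'm \<Rightarrow> 'm"
  assumes edges: "E \<subseteq> {{i, j} | i j. i \<in> {1..d} \<and> j \<in> {1..d} \<and> i \<noteq> j}"
    and vertex_groups: "i \<in> {1..d} \<Longrightarrow> comm_group (M i)"
    and edge_rings: "{i, j} \<in> E \<Longrightarrow> i < j \<Longrightarrow> ring (R i j)"
    and right_modules: "{i, j} \<in> E \<Longrightarrow> i < j \<Longrightarrow> right_module (R i j) (M i) (ract i j)"
    and left_modules: "{i, j} \<in> E \<Longrightarrow> i < j \<Longrightarrow> left_module (R i j) (M j) (lact i j)"

text \<open>The generator \<open>x\<^sub>i(a)\<close> is the letter \<open>(i, a)\<close>.\<close>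

definition kms_gens :: "nat \<Rightarrow> (nat \<Rightarrow> 'm monoid) \<Rightarrow> (nat \<times> 'm) set" where
  "kms_gens d M = (SIGMA i:{1..d}. carrier (M i))"

definition kms_letter :: "nat \<Rightarrow> 'm \<Rightarrow> (nat \<times> 'm) word" where
  "kms_letter i a = [((i, a), True)]"

text \<open>
  The subgroup \<open>[G\<^sub>i, G\<^sub>j]\<close> is generated by the commutators \<open>[x\<^sub>i(a), x\<^sub>j(b)]\<close>, so it commutes with
  \<open>G\<^sub>k\<close> as soon as these do; this is the last family of relations.
\<close>

definition kms_rels ::
  "nat \<Rightarrow> nat set set \<Rightarrow> (nat \<Rightarrow> 'm monoid) \<Rightarrow> (nat \<Rightarrow> nat \<Rightarrow> 'r ring) \<Rightarrow>
   (nat \<Rightarrow> nat \<Rightarrow> 'm \<Rightarrow> 'r \<Rightarrow> 'm) \<Rightarrow> (nat \<Rightarrow> nat \<Rightarrow> 'r \<Rightarrow> 'm \<Rightarrow> 'm) \<Rightarrow>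
   ((nat \<times> 'm) word \<times> (nat \<times> 'm) word) set" where
  "kms_rels d E M R ract lact =
     {(kms_letter i a @ kms_letter i a', kms_letter i (a \<otimes>\<^bsub>M i\<^esub> a')) | i a a'.
        i \<in> {1..d} \<and> a \<in> carrier (M i) \<and> a' \<in> carrier (M i)}
   \<union> {(word_commutator (kms_letter i a) (kms_letter j b), []) | i j a b.
        i \<in> {1..d} \<and> j \<in> {1..d} \<and> i \<noteq> j \<and> {i, j} \<notin> E \<and>
        a \<in> carrier (M i) \<and> b \<in> carrier (M j)}
   \<union> {(word_commutator (kms_letter i (ract i j a r)) (kms_letter j b),
       word_commutator (kms_letter i a) (kms_letter j (lact i j r b))) | i j a b r.
        i < j \<and> {i, j} \<in> E \<and>
        a \<in> carrier (M i) \<and> b \<in> carrier (M j) \<and> r \<in> carrier (R i j)}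
   \<union> {(word_commutator (word_commutator (kms_letter i a) (kms_letter j b)) (kms_letter k c), [])
        | i j k a b c.
        i < j \<and> {i, j} \<in> E \<and> k \<in> {i, j} \<and>
        a \<in> carrier (M i) \<and> b \<in> carrier (M j) \<and> c \<in> carrier (M k)}"

definition kms_group ::
  "nat \<Rightarrow> nat set set \<Rightarrow> (nat \<Rightarrow> 'm monoid) \<Rightarrow> (nat \<Rightarrow> nat \<Rightarrow> 'r ring) \<Rightarrow>
   (nat \<Rightarrow> nat \<Rightarrow> 'm \<Rightarrow> 'r \<Rightarrow> 'm) \<Rightarrow> (nat \<Rightarrow> nat \<Rightarrow> 'r \<Rightarrow> 'm \<Rightarrow> 'm) \<Rightarrow>
   (nat \<times> 'm) word set monoid" where
  "kms_group d E M R ract lact = presented_group (kms_gens d M) (kms_rels d E M R ract lact)"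

definition kms_vertex_subgroup ::
  "nat \<Rightarrow> nat set set \<Rightarrow> (nat \<Rightarrow> 'm monoid) \<Rightarrow> (nat \<Rightarrow> nat \<Rightarrow> 'r ring) \<Rightarrow>
   (nat \<Rightarrow> nat \<Rightarrow> 'm \<Rightarrow> 'r \<Rightarrow> 'm) \<Rightarrow> (nat \<Rightarrow> nat \<Rightarrow> 'r \<Rightarrow> 'm \<Rightarrow> 'm) \<Rightarrow>
   nat \<Rightarrow> (nat \<times> 'm) word set set" where
  "kms_vertex_subgroup d E M R ract lact i =
     (\<lambda>a. pres_class (kms_gens d M) (kms_rels d E M R ract lact) (kms_letter i a))
       ` carrier (M i)"

text \<open>The minimum over all edges of the minimal index of a proper right ideal.\<close>

definition kms_min_index :: "nat set set \<Rightarrow> (nat \<Rightarrow> nat \<Rightarrow> 'r ring) \<Rightarrow> enat" where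
  "kms_min_index E R = (INF (i, j)\<in>{(i, j). i < j \<and> {i, j} \<in> E}. min_right_ideal_index (R i j))"

lemma (in kms_data) kms_rels_subset:
  "kms_rels d E M R ract lact \<subseteq> words (kms_gens d M) \<times> words (kms_gens d M)"
proof -
  have E: "i \<in> {1..d} \<and> j \<in> {1..d}" if "{i, j} \<in> E" for i j
    using that edges by (fastforce simp: doubleton_eq_iff)
  have 1: "a \<otimes>\<^bsub>M i\<^esub> a' \<in> carrier (M i)"
    if "i \<in> {1..d}" "a \<in> carrier (M i)" "a' \<in> carrier (M i)" for i a a'
    using vertex_groups[OF that(1)] that by (meson comm_group.axioms(2) group.is_monoid monoid.m_closed)
  have 2: "ract i j a r \<in> carrier (M i)" "lact i j r b \<in> carrier (M j)"
    if "i < j" "{i, j} \<in> E" "a \<in> carrier (M i)" "b \<in> carrier (M j)" "r \<in> carrier (R i j)"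
    for i j a b r
    using right_modules[OF that(2,1)] left_modules[OF that(2,1)] that
    by (auto simp: right_module.act_closed left_module.act_closed)
  have [simp]: "word_commutator u v \<in> words Gen \<longleftrightarrow> u \<in> words Gen \<and> v \<in> words Gen" for u v Gen
    by (auto simp: word_commutator_def)
  show ?thesis
    unfolding kms_rels_def
    using E 1 2 by (auto simp: kms_letter_def kms_gens_def)
qed

section \<open>Complex Hilbert spaces and unitary representations\<close>

text \<open>
  A complex Hilbert space is carried by a subset of a type, so that subspaces and spaces of any
  dimension can be treated without changing the type. As everywhere in HOL-Algebra, the fields
  \<^const>\<open>monoid.mult\<close> and \<^const>\<open>one\<close> of the underlying module record are not used.
\<close>

definition complex_ring :: "complex ring" where
  "complex_ring = \<lparr>carrier = UNIV, monoid.mult = (*), one = 1, ring.zero = 0, add = (+)\<rparr>"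

lemma cring_complex_ring: "cring complex_ring"
proof -
  have "\<exists>y. x + y = 0" for x :: complex
    using add.right_inverse by blast
  then show ?thesis
    unfolding complex_ring_def
    by unfold_locales (auto simp: algebra_simps Units_def)
qed

record 'h inner_module = "(complex, 'h) module" +
  ip :: "'h \<Rightarrow> 'h \<Rightarrow> complex"

definition hnorm :: "'h inner_module \<Rightarrow> 'h \<Rightarrow> real" where
  "hnorm H x = sqrt (Re (ip H x x))"

text \<open>The value \<open>0\<close> outside the carrier is required by the locale \<^locale>\<open>Metric_space\<close>.\<close>

definition hdist :: "'h inner_module \<Rightarrow> 'h \<Rightarrow> 'h \<Rightarrow> real" where
  "hdist H x y = (if x \<in> carrier H \<and> y \<in> carrier H then hnorm H (x \<ominus>\<^bsub>H\<^esub> y) else 0)"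

locale complex_inner_space = Module.module complex_ring H
  for H :: "'h inner_module" (structure) +
  assumes ip_add: "x \<in> carrier H \<Longrightarrow> y \<in> carrier H \<Longrightarrow> z \<in> carrier H \<Longrightarrow>
      ip H (x \<oplus> y) z = ip H x z + ip H y z"
    and ip_smult: "x \<in> carrier H \<Longrightarrow> y \<in> carrier H \<Longrightarrow> ip H (c \<odot> x) y = c * ip H x y"
    and ip_cnj: "x \<in> carrier H \<Longrightarrow> y \<in> carrier H \<Longrightarrow> ip H y x = cnj (ip H x y)"
    and ip_pos: "x \<in> carrier H \<Longrightarrow> x \<noteq> \<zero> \<Longrightarrow> 0 < Re (ip H x x)"

locale complex_hilbert_space = complex_inner_space +
  assumes complete: "Metric_space.mcomplete (carrier H) (hdist H)"

locale unitary_rep = complex_hilbert_space H + group_action G "carrier H" \<rho>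
  for G :: "('g, 'x) monoid_scheme" and H :: "'h inner_module" (structure) and \<rho> +
  assumes rep_add: "g \<in> carrier G \<Longrightarrow> x \<in> carrier H \<Longrightarrow> y \<in> carrier H \<Longrightarrow>
      \<rho> g (x \<oplus> y) = \<rho> g x \<oplus> \<rho> g y"
    and rep_smult: "g \<in> carrier G \<Longrightarrow> x \<in> carrier H \<Longrightarrow> \<rho> g (c \<odot> x) = c \<odot> \<rho> g x"
    and rep_ip: "g \<in> carrier G \<Longrightarrow> x \<in> carrier H \<Longrightarrow> y \<in> carrier H \<Longrightarrow>
      ip H (\<rho> g x) (\<rho> g y) = ip H x y"

definition no_invariant_vectors ::
  "('g, 'x) monoid_scheme \<Rightarrow> 'h inner_module \<Rightarrow> ('g \<Rightarrow> 'h \<Rightarrow> 'h) \<Rightarrow> bool" where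
  "no_invariant_vectors G H \<rho> \<longleftrightarrow>
     (\<forall>v\<in>carrier H. (\<forall>g\<in>carrier G. \<rho> g v = v) \<longrightarrow> v = \<zero>\<^bsub>H\<^esub>)"

text \<open>The infima are taken in \<^typ>\<open>ereal\<close>; that of the empty set is \<open>\<infinity>\<close>.\<close>

definition rep_kazhdan :: "'g set \<Rightarrow> 'h inner_module \<Rightarrow> ('g \<Rightarrow> 'h \<Rightarrow> 'h) \<Rightarrow> ereal" where
  "rep_kazhdan S H \<rho> = Inf {ereal \<epsilon> | \<epsilon>. \<epsilon> > 0 \<and>
     (\<exists>v\<in>carrier H. v \<noteq> \<zero>\<^bsub>H\<^esub> \<and> (\<forall>s\<in>S. hnorm H (\<rho> s v \<ominus>\<^bsub>H\<^esub> v) \<le> \<epsilon> * hnorm H v))}"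

text \<open>
  A definition cannot range over the Hilbert spaces in all types at once, so the infimum over the
  representations is first taken over the Hilbert spaces carried by subsets of a given type.
\<close>

definition kazhdan_constant_in :: "'h itself \<Rightarrow> ('g, 'x) monoid_scheme \<Rightarrow> 'g set \<Rightarrow> ereal" where
  "kazhdan_constant_in T G S =
     (INF (H, \<rho>)\<in>{(H :: 'h inner_module, \<rho>). unitary_rep G H \<rho> \<and> no_invariant_vectors G H \<rho>}.
        rep_kazhdan S H \<rho>)"

text \<open>
  The following type is large enough to carry a copy of every cyclic unitary representation of a
  group with elements in \<^typ>\<open>'g\<close>. Hence the infimum over the representations carried by it is a
  lower bound of the one for any other type; this is shown in \<open>kazhdan_constant_le\<close> below.
\<close>

type_synonym 'g rep_universe = "nat \<Rightarrow> (complex \<times> 'g) list"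

definition kazhdan_constant :: "('g, 'x) monoid_scheme \<Rightarrow> 'g set \<Rightarrow> ereal" where
  "kazhdan_constant G S = kazhdan_constant_in TYPE('g rep_universe) G S"

definition property_T :: "('g, 'x) monoid_scheme \<Rightarrow> bool" where
  "property_T G \<longleftrightarrow> (\<exists>S. finite S \<and> S \<subseteq> carrier G \<and> kazhdan_constant G S > 0)"


subsection \<open>Inner product spaces as metric spaces\<close>

context complex_inner_space
begin

lemma smult_closed' [simp, intro]: "x \<in> carrier H \<Longrightarrow> c \<odot> x \<in> carrier H"
  using smult_closed[of c x] by (simp add: complex_ring_def)

lemma smult_minus_one:
  assumes "x \<in> carrier H" shows "(- 1) \<odot> x = \<ominus> x"
proof -
  have "(- 1) \<odot> x \<oplus> x = ((- 1) + 1) \<odot> x"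
    using smult_l_distr[of "- 1" 1 x] smult_one[of x] assms by (simp add: complex_ring_def)
  also have "\<dots> = \<zero>" using smult_l_null[of x] assms by (simp add: complex_ring_def)
  finally show ?thesis using assms by (simp add: M.minus_equality)
qed

lemma ip_add_right:
  assumes "x \<in> carrier H" "y \<in> carrier H" "z \<in> carrier H"
  shows "ip H z (x \<oplus> y) = ip H z x + ip H z y"
  using assms ip_cnj[of z "x \<oplus> y"] ip_cnj[of "x \<oplus> y" z] ip_cnj[of x z] ip_cnj[of y z]
  by (simp add: ip_add)

lemma ip_smult_right:
  assumes "x \<in> carrier H" "y \<in> carrier H"
  shows "ip H x (c \<odot> y) = cnj c * ip H x y"
  using assms ip_cnj[of "c \<odot> y" x] ip_cnj[of y x] by (simp add: ip_smult)

lemma ip_zero [simp]: "x \<in> carrier H \<Longrightarrow> ip H \<zero> x = 0"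
  using ip_add[of \<zero> \<zero> x] by simp

lemma ip_nonneg: "x \<in> carrier H \<Longrightarrow> 0 \<le> Re (ip H x x)"
  using ip_pos[of x] by (cases "x = \<zero>") auto

lemma hnorm_nonneg [simp]: "x \<in> carrier H \<Longrightarrow> 0 \<le> hnorm H x"
  by (simp add: hnorm_def ip_nonneg)

lemma hnorm_eq_0: "x \<in> carrier H \<Longrightarrow> hnorm H x = 0 \<longleftrightarrow> x = \<zero>"
  by (cases "x = \<zero>") (use ip_pos[of x] in \<open>simp_all add: hnorm_def\<close>)

lemma hnorm_sq: "x \<in> carrier H \<Longrightarrow> (hnorm H x)\<^sup>2 = Re (ip H x x)"
  by (simp add: hnorm_def ip_nonneg)

lemma hnorm_smult:
  assumes "x \<in> carrier H" shows "hnorm H (c \<odot> x) = cmod c * hnorm H x"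
proof -
  have "ip H (c \<odot> x) (c \<odot> x) = (c * cnj c) * ip H x x"
    using assms by (simp add: ip_smult ip_smult_right)
  also have "c * cnj c = of_real ((cmod c)\<^sup>2)"
    using complex_norm_square[of c] by simp
  finally have "Re (ip H (c \<odot> x) (c \<odot> x)) = (cmod c)\<^sup>2 * Re (ip H x x)"
    by simp
  then show ?thesis by (simp add: hnorm_def real_sqrt_mult)
qed

lemma hnorm_uminus: "x \<in> carrier H \<Longrightarrow> hnorm H (\<ominus> x) = hnorm H x"
  using hnorm_smult[of x "- 1"] by (simp add: smult_minus_one)

lemma minus_eq_iff:
  assumes "x \<in> carrier H" "y \<in> carrier H" "z \<in> carrier H"
  shows "x \<ominus> y = z \<longleftrightarrow> x = z \<oplus> y"
proof -
  have "x = (x \<ominus> y) \<oplus> y" using assms by (simp add: M.minus_eq M.a_assoc M.l_neg)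
  moreover have "z = (z \<oplus> y) \<ominus> y" using assms by (simp add: M.minus_eq M.a_assoc M.r_neg)
  ultimately show ?thesis by metis
qed

lemma hnorm_add_sq:
  assumes "x \<in> carrier H" "y \<in> carrier H"
  shows "(hnorm H (x \<oplus> y))\<^sup>2 = (hnorm H x)\<^sup>2 + 2 * Re (ip H x y) + (hnorm H y)\<^sup>2"
  using assms ip_cnj[of x y] by (simp add: hnorm_sq ip_add ip_add_right)

lemma Re_ip_le:
  assumes x: "x \<in> carrier H" and y: "y \<in> carrier H"
  shows "Re (ip H x y) \<le> hnorm H x * hnorm H y"
proof (cases "hnorm H x = 0 \<or> hnorm H y = 0")
  case True
  then have "ip H x y = 0"
    using x y hnorm_eq_0 ip_cnj[of \<zero> x] by auto
  then show ?thesis using x y by simp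
next
  case False
  let ?a = "hnorm H x" and ?b = "hnorm H y"
  have pos: "?a > 0" "?b > 0" using False x y hnorm_nonneg by (smt (verit))+
  let ?u = "complex_of_real ?b \<odot> x" and ?v = "complex_of_real (- ?a) \<odot> y"
  have "0 \<le> (hnorm H (?u \<oplus> ?v))\<^sup>2" by simp
  also have "\<dots> = (?b * ?a)\<^sup>2 + 2 * (- (?a * ?b) * Re (ip H x y)) + (?a * ?b)\<^sup>2"
    using pos x y by (simp add: hnorm_add_sq hnorm_smult ip_smult ip_smult_right)
  finally have "(?a * ?b) * Re (ip H x y) \<le> (?a * ?b) * (?a * ?b)"
    by (simp add: power2_eq_square algebra_simps)
  then show ?thesis using pos by (simp add: mult_le_cancel_left)
qed

lemma hnorm_triangle:
  assumes "x \<in> carrier H" "y \<in> carrier H"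
  shows "hnorm H (x \<oplus> y) \<le> hnorm H x + hnorm H y"
proof (rule power2_le_imp_le)
  show "(hnorm H (x \<oplus> y))\<^sup>2 \<le> (hnorm H x + hnorm H y)\<^sup>2"
    using Re_ip_le[OF assms] hnorm_add_sq[OF assms] by (simp add: power2_sum)
qed (use assms in simp)

lemma metric: "Metric_space (carrier H) (hdist H)"
proof
  show "0 \<le> hdist H x y" for x y by (simp add: hdist_def)
  show "hdist H x y = hdist H y x" for x y
  proof (cases "x \<in> carrier H \<and> y \<in> carrier H")
    case True
    then have "x \<ominus> y = \<ominus> (y \<ominus> x)"
      by (simp add: M.minus_eq M.minus_add M.add.m_comm)
    then show ?thesis using True hnorm_uminus[of "y \<ominus> x"] by (simp add: hdist_def)
  qed (auto simp: hdist_def)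
  show "hdist H x y = 0 \<longleftrightarrow> x = y" if "x \<in> carrier H" "y \<in> carrier H" for x y
    using that minus_eq_iff[of x y \<zero>] by (simp add: hdist_def hnorm_eq_0)
  show "hdist H x z \<le> hdist H x y + hdist H y z"
    if "x \<in> carrier H" "y \<in> carrier H" "z \<in> carrier H" for x y z
  proof -
    have "x \<ominus> z = (x \<ominus> y) \<oplus> (y \<ominus> z)"
      using that by (simp add: M.minus_eq M.a_assoc M.r_neg1)
    then show ?thesis using that hnorm_triangle[of "x \<ominus> y" "y \<ominus> z"] by (simp add: hdist_def)
  qed
qed

lemma hdist_add:
  assumes "x \<in> carrier H" "y \<in> carrier H" "x' \<in> carrier H" "y' \<in> carrier H"
  shows "hdist H (x \<oplus> y) (x' \<oplus> y') \<le> hdist H x x' + hdist H y y'"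
proof -
  have "(x \<oplus> y) \<ominus> (x' \<oplus> y') = (x \<ominus> x') \<oplus> (y \<ominus> y')"
    using assms by (simp add: M.minus_eq M.minus_add M.add.m_ac)
  then show ?thesis using assms hnorm_triangle[of "x \<ominus> x'" "y \<ominus> y'"] by (simp add: hdist_def)
qed

lemma hdist_smult:
  assumes "x \<in> carrier H" "y \<in> carrier H"
  shows "hdist H (c \<odot> x) (c \<odot> y) = cmod c * hdist H x y"
proof -
  have "c \<odot> (\<ominus> y) = \<ominus> (c \<odot> y)"
    using smult_r_minus[of c y] assms by (simp add: complex_ring_def)
  moreover have "c \<odot> (x \<oplus> \<ominus> y) = c \<odot> x \<oplus> c \<odot> (\<ominus> y)"
    using smult_r_distr[of c x "\<ominus> y"] assms by (simp add: complex_ring_def)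
  ultimately have "c \<odot> x \<ominus> c \<odot> y = c \<odot> (x \<ominus> y)"
    using assms by (simp add: M.minus_eq)
  then show ?thesis using assms by (simp add: hdist_def hnorm_smult)
qed

end


lemma (in complex_inner_space) mcomplete_iff:
  "Metric_space.mcomplete (carrier H) (hdist H) \<longleftrightarrow>
   (\<forall>xs. range xs \<subseteq> carrier H \<and> (\<forall>e>0. \<exists>N. \<forall>m n. N \<le> m \<longrightarrow> N \<le> n \<longrightarrow> hdist H (xs m) (xs n) < e)
      \<longrightarrow> (\<exists>x\<in>carrier H. (\<lambda>n. hdist H (xs n) x) \<longlonglongrightarrow> 0))"
proof -
  interpret Metric_space "carrier H" "hdist H" by (rule metric)
  have "limitin mtopology xs x sequentially \<longleftrightarrow>
      x \<in> carrier H \<and> (\<lambda>n. hdist H (xs n) x) \<longlonglongrightarrow> 0" if "range xs \<subseteq> carrier H" for xs x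
    using that by (auto simp: limit_metric_sequentially LIMSEQ_def image_subset_iff)
  then show ?thesis
    unfolding mcomplete_def MCauchy_def by (intro arg_cong[where f = All] ext imp_cong) auto
qed


subsection \<open>Passing to a subrepresentation in another type\<close>

text \<open>\<open>C\<close> is a closed invariant subspace, and \<open>f\<close> embeds it into another type.\<close>

locale rep_transport = unitary_rep G H \<rho>
  for G :: "('g, 'x) monoid_scheme" and H :: "'h inner_module" (structure) and \<rho> +
  fixes C :: "'h set" and f :: "'h \<Rightarrow> 'k"
  assumes C_sub: "C \<subseteq> carrier H"
    and C_zero: "\<zero> \<in> C"
    and C_add: "x \<in> C \<Longrightarrow> y \<in> C \<Longrightarrow> x \<oplus> y \<in> C"
    and C_smult: "x \<in> C \<Longrightarrow> c \<odot> x \<in> C"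
    and C_rep: "g \<in> carrier G \<Longrightarrow> x \<in> C \<Longrightarrow> \<rho> g x \<in> C"
    and C_lim: "range xs \<subseteq> C \<Longrightarrow> x \<in> carrier H \<Longrightarrow> (\<lambda>n. hdist H (xs n) x) \<longlonglongrightarrow> 0 \<Longrightarrow> x \<in> C"
    and inj: "inj_on f C"
begin

abbreviation "un \<equiv> inv_into C f"

definition K :: "'k inner_module" where
  "K = \<lparr>carrier = f ` C, monoid.mult = undefined, one = undefined, ring.zero = f \<zero>,
        add = (\<lambda>x y. f (un x \<oplus> un y)), smult = (\<lambda>c x. f (c \<odot> un x)),
        ip = (\<lambda>x y. ip H (un x) (un y))\<rparr>"

definition \<tau> :: "'g \<Rightarrow> 'k \<Rightarrow> 'k" where
  "\<tau> g = (\<lambda>x\<in>f ` C. f (\<rho> g (un x)))"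

lemma un [simp]: "x \<in> C \<Longrightarrow> un (f x) = x"
  using inj by (rule inv_into_f_f)

lemma CH [simp]: "x \<in> C \<Longrightarrow> x \<in> carrier H"
  using C_sub by auto

lemma f_eq [simp]: "x \<in> C \<Longrightarrow> y \<in> C \<Longrightarrow> f x = f y \<longleftrightarrow> x = y"
  using inj by (rule inj_on_eq_iff)

lemma C_uminus: "x \<in> C \<Longrightarrow> \<ominus> x \<in> C"
  using C_smult[of x "- 1"] by (simp add: smult_minus_one)

lemma C_minus: "x \<in> C \<Longrightarrow> y \<in> C \<Longrightarrow> x \<ominus> y \<in> C"
  by (simp add: M.minus_eq C_add C_uminus)

lemma carrier_K: "carrier K = f ` C"
  by (simp add: K_def)

lemma zero_K: "\<zero>\<^bsub>K\<^esub> = f \<zero>"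
  by (simp add: K_def)

lemma add_K: "x \<in> C \<Longrightarrow> y \<in> C \<Longrightarrow> f x \<oplus>\<^bsub>K\<^esub> f y = f (x \<oplus> y)"
  by (simp add: K_def)

lemma smult_K: "x \<in> C \<Longrightarrow> c \<odot>\<^bsub>K\<^esub> f x = f (c \<odot> x)"
  by (simp add: K_def)

lemma ip_K: "x \<in> C \<Longrightarrow> y \<in> C \<Longrightarrow> ip K (f x) (f y) = ip H x y"
  by (simp add: K_def)

lemma \<tau>_eq: "x \<in> C \<Longrightarrow> \<tau> g (f x) = f (\<rho> g x)"
  by (simp add: \<tau>_def)

lemmas K_simps = carrier_K zero_K add_K smult_K ip_K \<tau>_eq C_zero C_add C_smult C_rep

lemma abelian_group_K: "abelian_group K"
proof (rule abelian_groupI)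
  fix x assume "x \<in> carrier K"
  then obtain a where a: "a \<in> C" "x = f a" by (auto simp: carrier_K)
  then show "\<zero>\<^bsub>K\<^esub> \<oplus>\<^bsub>K\<^esub> x = x" by (simp add: K_simps)
  have "f (\<ominus> a) \<oplus>\<^bsub>K\<^esub> x = \<zero>\<^bsub>K\<^esub>" using a by (simp add: K_simps C_uminus M.l_neg)
  then show "\<exists>y\<in>carrier K. y \<oplus>\<^bsub>K\<^esub> x = \<zero>\<^bsub>K\<^esub>"
    using a C_uminus by (auto simp: carrier_K)
qed (auto simp: K_simps M.a_ac)

lemma inner_K: "complex_inner_space K"
proof -
  have "Module.module complex_ring K"
  proof (rule Module.moduleI[OF cring_complex_ring abelian_group_K])
    fix a b x assume "a \<in> carrier complex_ring" "b \<in> carrier complex_ring" "x \<in> carrier K"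
    then show "(a \<oplus>\<^bsub>complex_ring\<^esub> b) \<odot>\<^bsub>K\<^esub> x = (a \<odot>\<^bsub>K\<^esub> x) \<oplus>\<^bsub>K\<^esub> (b \<odot>\<^bsub>K\<^esub> x)"
      and "(a \<otimes>\<^bsub>complex_ring\<^esub> b) \<odot>\<^bsub>K\<^esub> x = a \<odot>\<^bsub>K\<^esub> (b \<odot>\<^bsub>K\<^esub> x)"
      by (auto simp: K_simps smult_l_distr smult_assoc1)
  next
    fix a x y assume "a \<in> carrier complex_ring" "x \<in> carrier K" "y \<in> carrier K"
    then show "a \<odot>\<^bsub>K\<^esub> (x \<oplus>\<^bsub>K\<^esub> y) = (a \<odot>\<^bsub>K\<^esub> x) \<oplus>\<^bsub>K\<^esub> (a \<odot>\<^bsub>K\<^esub> y)"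
      by (auto simp: K_simps smult_r_distr)
  qed (auto simp: K_simps)
  moreover have "complex_inner_space_axioms K"
  proof
    show "ip K x y = cnj (ip K y x)" if xy: "y \<in> carrier K" "x \<in> carrier K" for x y
    proof -
      obtain a b where "a \<in> C" "b \<in> C" "x = f a" "y = f b" using xy by (auto simp: carrier_K)
      then show ?thesis using ip_cnj[of b a] by (simp add: K_simps)
    qed
  qed (auto simp: K_simps ip_add ip_smult ip_pos)
  ultimately show ?thesis by (rule complex_inner_space.intro)
qed

lemma minus_K:
  assumes "x \<in> C" "y \<in> C" shows "f x \<ominus>\<^bsub>K\<^esub> f y = f (x \<ominus> y)"
proof -
  have "x = (x \<ominus> y) \<oplus> y" using assms minus_eq_iff[of x y "x \<ominus> y"] by simp
  then show ?thesis
    using assms C_minus[OF assms] complex_inner_space.minus_eq_iff[OF inner_K, of "f x" "f y" "f (x \<ominus> y)"]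
    by (simp add: K_simps)
qed

lemma hnorm_K: "x \<in> C \<Longrightarrow> hnorm K (f x) = hnorm H x"
  by (simp add: hnorm_def ip_K)

lemma hdist_K: "x \<in> C \<Longrightarrow> y \<in> C \<Longrightarrow> hdist K (f x) (f y) = hdist H x y"
  by (simp add: hdist_def minus_K hnorm_K C_minus carrier_K)

lemma hilbert_K: "complex_hilbert_space K"
proof -
  interpret K: complex_inner_space K by (rule inner_K)
  have "Metric_space.mcomplete (carrier K) (hdist K)"
    unfolding K.mcomplete_iff
  proof (intro allI impI, elim conjE)
    fix xs :: "nat \<Rightarrow> 'k"
    assume ran: "range xs \<subseteq> carrier K"
      and cauchy: "\<forall>e>0. \<exists>N. \<forall>m n. N \<le> m \<longrightarrow> N \<le> n \<longrightarrow> hdist K (xs m) (xs n) < e"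
    define s where "s n = un (xs n)" for n
    have s: "s n \<in> C" "f (s n) = xs n" for n
      using ran by (auto simp: s_def carrier_K image_subset_iff inv_into_into f_inv_into_f)
    have "hdist K (xs m) (xs n) = hdist H (s m) (s n)" for m n
      using hdist_K[of "s m" "s n"] s by simp
    then have "\<forall>e>0. \<exists>N. \<forall>m n. N \<le> m \<longrightarrow> N \<le> n \<longrightarrow> hdist H (s m) (s n) < e"
      using cauchy by simp
    moreover have "range s \<subseteq> carrier H" using s by auto
    ultimately obtain x where x: "x \<in> carrier H" "(\<lambda>n. hdist H (s n) x) \<longlonglongrightarrow> 0"
      using complete unfolding mcomplete_iff by blast
    have xC: "x \<in> C" by (rule C_lim[OF _ x]) (use s in auto)
    have "hdist K (xs n) (f x) = hdist H (s n) x" for n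
      using hdist_K[of "s n" x] s xC by simp
    then have "(\<lambda>n. hdist K (xs n) (f x)) \<longlonglongrightarrow> 0" using x by simp
    then show "\<exists>x\<in>carrier K. (\<lambda>n. hdist K (xs n) x) \<longlonglongrightarrow> 0"
      using xC unfolding carrier_K by blast
  qed
  then show ?thesis
    by (intro complex_hilbert_space.intro inner_K complex_hilbert_space_axioms.intro)
qed

lemma group_G: "group G"
  using group_hom by (rule group_hom.axioms(1))

lemma \<tau>_Bij: assumes g: "g \<in> carrier G" shows "\<tau> g \<in> Bij (f ` C)"
proof -
  interpret G: group G by (rule group_G)
  have inv: "\<rho> g (\<rho> (inv\<^bsub>G\<^esub> g) x) = x" "\<rho> (inv\<^bsub>G\<^esub> g) (\<rho> g x) = x" if "x \<in> C" for x
    using that g orbit_sym_aux[OF g, of x "\<rho> g x"] orbit_sym_aux[of "inv\<^bsub>G\<^esub> g" x "\<rho> (inv\<^bsub>G\<^esub> g) x"]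
    by auto
  have "bij_betw (\<tau> g) (f ` C) (f ` C)"
    by (rule bij_betw_byWitness[where f' = "\<tau> (inv\<^bsub>G\<^esub> g)"]) (use g inv in \<open>auto simp: K_simps\<close>)
  then show ?thesis by (simp add: Bij_def \<tau>_def)
qed

lemma unitary_rep_K: "unitary_rep G K \<tau>"
proof -
  interpret G: group G by (rule group_G)
  have "\<tau> \<in> hom G (BijGroup (f ` C))"
  proof (rule homI)
    show "\<tau> g \<in> carrier (BijGroup (f ` C))" if "g \<in> carrier G" for g
      using \<tau>_Bij[OF that] by (simp add: BijGroup_def)
    show "\<tau> (g \<otimes>\<^bsub>G\<^esub> h) = \<tau> g \<otimes>\<^bsub>BijGroup (f ` C)\<^esub> \<tau> h"
      if "g \<in> carrier G" "h \<in> carrier G" for g h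
    proof -
      have "\<tau> (g \<otimes>\<^bsub>G\<^esub> h) = compose (f ` C) (\<tau> g) (\<tau> h)"
      proof (rule extensionalityI[of _ "f ` C"])
        show "\<tau> (g \<otimes>\<^bsub>G\<^esub> h) x = compose (f ` C) (\<tau> g) (\<tau> h) x" if "x \<in> f ` C" for x
          using that \<open>g \<in> carrier G\<close> \<open>h \<in> carrier G\<close>
          by (auto simp: compose_def K_simps composition_rule)
      qed (simp_all add: \<tau>_def)
      then show ?thesis using \<tau>_Bij that by (simp add: BijGroup_def)
    qed
  qed
  then have "group_action G (carrier K) \<tau>"
    by (simp add: carrier_K group_action_def group_hom_def group_hom_axioms_def group_G
        group_BijGroup)
  moreover have "unitary_rep_axioms G K \<tau>"
    by unfold_locales (auto simp: K_simps rep_add rep_smult rep_ip)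
  ultimately show ?thesis
    by (intro unitary_rep.intro hilbert_K)
qed

lemma no_inv_K:
  assumes "no_invariant_vectors G H \<rho>" shows "no_invariant_vectors G K \<tau>"
  using assms C_rep by (auto simp: no_invariant_vectors_def K_simps)

end


subsection \<open>Representations in an arbitrary type\<close>

context unitary_rep
begin

lemma rep_closed [simp]: "g \<in> carrier G \<Longrightarrow> x \<in> carrier H \<Longrightarrow> \<rho> g x \<in> carrier H"
  using element_image by blast

lemma hdist_rep:
  assumes "g \<in> carrier G" "x \<in> carrier H" "y \<in> carrier H"
  shows "hdist H (\<rho> g x) (\<rho> g y) = hdist H x y"
proof -
  have "x = (x \<ominus> y) \<oplus> y" using assms minus_eq_iff[of x y "x \<ominus> y"] by simp
  then have "\<rho> g x = \<rho> g (x \<ominus> y) \<oplus> \<rho> g y"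
    using assms rep_add[of g "x \<ominus> y" y] by simp
  then have "\<rho> g x \<ominus> \<rho> g y = \<rho> g (x \<ominus> y)"
    using assms by (simp add: minus_eq_iff)
  then show ?thesis using assms by (simp add: hdist_def hnorm_def rep_ip)
qed

lemma smult_add: "x \<in> carrier H \<Longrightarrow> y \<in> carrier H \<Longrightarrow> c \<odot> (x \<oplus> y) = c \<odot> x \<oplus> c \<odot> y"
  using smult_r_distr[of c x y] by (simp add: complex_ring_def)

lemma smult_smult: "x \<in> carrier H \<Longrightarrow> c \<odot> (b \<odot> x) = (c * b) \<odot> x"
  using smult_assoc1[of c b x] by (simp add: complex_ring_def)

lemma smult_zero: "c \<odot> \<zero> = \<zero>"
  using smult_r_null[of c] by (simp add: complex_ring_def)

lemma one_smult: "x \<in> carrier H \<Longrightarrow> 1 \<odot> x = x"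
  using smult_one[of x] by (simp add: complex_ring_def)

lemma zero_smult: "x \<in> carrier H \<Longrightarrow> 0 \<odot> x = \<zero>"
  using smult_l_null[of x] by (simp add: complex_ring_def)

lemma rep_zero: "g \<in> carrier G \<Longrightarrow> \<rho> g \<zero> = \<zero>"
  using rep_smult[of g \<zero> 0] by (simp add: zero_smult)

text \<open>Finite linear combinations of translates of a vector \<open>v\<close>.\<close>

fun comb :: "'h \<Rightarrow> (complex \<times> 'g) list \<Rightarrow> 'h" where
  "comb v [] = \<zero>"
| "comb v ((c, g) # w) = c \<odot> \<rho> g v \<oplus> comb v w"

abbreviation "W \<equiv> lists (UNIV \<times> carrier G)"

lemma comb_closed [simp]: "v \<in> carrier H \<Longrightarrow> w \<in> W \<Longrightarrow> comb v w \<in> carrier H"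
  by (induction v w rule: comb.induct) auto

lemma comb_append:
  "v \<in> carrier H \<Longrightarrow> w \<in> W \<Longrightarrow> w' \<in> W \<Longrightarrow> comb v (w @ w') = comb v w \<oplus> comb v w'"
  by (induction v w rule: comb.induct) (auto simp: M.a_assoc)

lemma comb_smult:
  "v \<in> carrier H \<Longrightarrow> w \<in> W \<Longrightarrow> comb v (map (\<lambda>(b, g). (c * b, g)) w) = c \<odot> comb v w"
  by (induction v w rule: comb.induct) (auto simp: smult_add smult_smult smult_zero)

lemma comb_rep:
  "v \<in> carrier H \<Longrightarrow> h \<in> carrier G \<Longrightarrow> w \<in> W \<Longrightarrow>
   comb v (map (\<lambda>(b, g). (b, h \<otimes>\<^bsub>G\<^esub> g)) w) = \<rho> h (comb v w)"
  by (induction v w rule: comb.induct) (auto simp: rep_zero rep_add rep_smult composition_rule)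

definition approx :: "'h \<Rightarrow> 'h \<Rightarrow> (nat \<Rightarrow> (complex \<times> 'g) list) \<Rightarrow> bool" where
  "approx v x w \<longleftrightarrow> (\<forall>n. w n \<in> W) \<and> (\<lambda>n. hdist H (comb v (w n)) x) \<longlonglongrightarrow> 0"

definition cyclic :: "'h \<Rightarrow> 'h set" where
  "cyclic v = {x \<in> carrier H. \<exists>w. approx v x w}"

lemma hdist_nonneg: "0 \<le> hdist H x y"
  by (rule Metric_space.nonneg[OF metric])

lemma tendsto_zero_le:
  assumes "a \<longlonglongrightarrow> 0" "\<And>n. hdist H (xs n) x \<le> a n"
  shows "(\<lambda>n. hdist H (xs n) x) \<longlonglongrightarrow> 0"
  by (rule tendsto_sandwich[of "\<lambda>_. 0", OF _ _ tendsto_const assms(1)])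
     (auto simp: assms(2) hdist_nonneg)

lemma cyclic_transport:
  assumes v: "v \<in> carrier H"
  shows "rep_transport G H \<rho> (cyclic v) (\<lambda>x. SOME w. approx v x w)"
proof unfold_locales
  show "cyclic v \<subseteq> carrier H" by (auto simp: cyclic_def)
  show "\<zero> \<in> cyclic v"
    using Metric_space.zero[OF metric, of \<zero> \<zero>]
    by (auto simp: cyclic_def approx_def intro!: exI[of _ "\<lambda>_. []"])
next
  fix x y assume "x \<in> cyclic v" "y \<in> cyclic v"
  then obtain w w' where x: "x \<in> carrier H" "approx v x w" and y: "y \<in> carrier H" "approx v y w'"
    by (auto simp: cyclic_def)
  have "(\<lambda>n. hdist H (comb v (w n @ w' n)) (x \<oplus> y)) \<longlonglongrightarrow> 0"
  proof (rule tendsto_zero_le)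
    show "(\<lambda>n. hdist H (comb v (w n)) x + hdist H (comb v (w' n)) y) \<longlonglongrightarrow> 0"
      using x y by (auto simp: approx_def intro: tendsto_add_zero)
    show "hdist H (comb v (w n @ w' n)) (x \<oplus> y)
        \<le> hdist H (comb v (w n)) x + hdist H (comb v (w' n)) y" for n
      using x y v hdist_add[of "comb v (w n)" "comb v (w' n)" x y]
      by (simp add: approx_def comb_append)
  qed
  then have "approx v (x \<oplus> y) (\<lambda>n. w n @ w' n)"
    using x y by (simp add: approx_def)
  then show "x \<oplus> y \<in> cyclic v" using x y by (auto simp: cyclic_def)
next
  fix x c assume "x \<in> cyclic v"
  then obtain w where x: "x \<in> carrier H" "approx v x w" by (auto simp: cyclic_def)
  have W: "map (\<lambda>(b, g). (c * b, g)) (w n) \<in> W" for n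
    using x by (fastforce simp: approx_def)
  have "hdist H (comb v (map (\<lambda>(b, g). (c * b, g)) (w n))) (c \<odot> x)
      = cmod c * hdist H (comb v (w n)) x" for n
    using x v by (simp add: approx_def comb_smult hdist_smult)
  then have "approx v (c \<odot> x) (\<lambda>n. map (\<lambda>(b, g). (c * b, g)) (w n))"
    using x W by (simp add: approx_def tendsto_mult_right_zero)
  then show "c \<odot> x \<in> cyclic v" using x by (auto simp: cyclic_def)
next
  fix h x assume h: "h \<in> carrier G" and "x \<in> cyclic v"
  then obtain w where x: "x \<in> carrier H" "approx v x w" by (auto simp: cyclic_def)
  interpret G: group G using group_hom by (rule group_hom.axioms(1))
  have W: "map (\<lambda>(b, g). (b, h \<otimes>\<^bsub>G\<^esub> g)) (w n) \<in> W" for n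
    using x h by (fastforce simp: approx_def)
  have "hdist H (comb v (map (\<lambda>(b, g). (b, h \<otimes>\<^bsub>G\<^esub> g)) (w n))) (\<rho> h x)
      = hdist H (comb v (w n)) x" for n
    using x v h by (simp add: approx_def comb_rep hdist_rep)
  then have "approx v (\<rho> h x) (\<lambda>n. map (\<lambda>(b, g). (b, h \<otimes>\<^bsub>G\<^esub> g)) (w n))"
    using x W by (simp add: approx_def)
  then show "\<rho> h x \<in> cyclic v" using x h by (auto simp: cyclic_def)
next
  fix xs x assume xs: "range xs \<subseteq> cyclic v" and x: "x \<in> carrier H"
    and lim: "(\<lambda>n. hdist H (xs n) x) \<longlonglongrightarrow> 0"
  have xsH: "xs n \<in> carrier H" for n using xs by (auto simp: cyclic_def)
  have "\<exists>w\<in>W. hdist H (comb v w) (xs n) < inverse (real (Suc n))" for n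
  proof -
    obtain w where w: "approx v (xs n) w" using xs by (auto simp: cyclic_def)
    then have "\<forall>\<^sub>F k in sequentially. hdist H (comb v (w k)) (xs n) < inverse (real (Suc n))"
      unfolding approx_def by (intro order_tendstoD(2)[where y = 0]) auto
    then obtain k where "hdist H (comb v (w k)) (xs n) < inverse (real (Suc n))"
      by (auto simp: eventually_sequentially)
    then show ?thesis using w by (auto simp: approx_def)
  qed
  then obtain w where w: "\<And>n. w n \<in> W"
      "\<And>n. hdist H (comb v (w n)) (xs n) < inverse (real (Suc n))"
    by metis
  have "(\<lambda>n. hdist H (comb v (w n)) x) \<longlonglongrightarrow> 0"
  proof (rule tendsto_zero_le)
    show "(\<lambda>n. inverse (real (Suc n)) + hdist H (xs n) x) \<longlonglongrightarrow> 0"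
      using LIMSEQ_inverse_real_of_nat lim by (rule tendsto_add_zero)
    show "hdist H (comb v (w n)) x \<le> inverse (real (Suc n)) + hdist H (xs n) x" for n
      using Metric_space.triangle[OF metric comb_closed[OF v w(1)] xsH x, of n n] w(2)[of n]
      by linarith
  qed
  then show "x \<in> cyclic v" using x w by (auto simp: cyclic_def approx_def)
next
  show "inj_on (\<lambda>x. SOME w. approx v x w) (cyclic v)"
  proof (rule inj_onI)
    fix x y assume xy: "x \<in> cyclic v" "y \<in> cyclic v"
      and eq: "(SOME w. approx v x w) = (SOME w. approx v y w)"
    define w where "w = (SOME w. approx v x w)"
    have "approx v x w" unfolding w_def
      using xy(1) by (auto simp: cyclic_def intro!: someI_ex[where P = "approx v _"])
    moreover have "approx v y w" unfolding w_def eq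
      using xy(2) by (auto simp: cyclic_def intro!: someI_ex[where P = "approx v _"])
    ultimately have "(\<lambda>n. hdist H (comb v (w n)) x + hdist H (comb v (w n)) y) \<longlonglongrightarrow> 0"
      and w: "\<And>n. w n \<in> W"
      by (auto simp: approx_def intro: tendsto_add_zero)
    moreover have "hdist H x y \<le> hdist H (comb v (w n)) x + hdist H (comb v (w n)) y" for n
      using Metric_space.triangle[OF metric _ comb_closed[OF v w], of x y n] xy
        Metric_space.commute[OF metric, of x "comb v (w n)"]
      by (auto simp: cyclic_def)
    ultimately have "hdist H x y \<le> 0"
      by (intro LIMSEQ_le_const) auto
    then show "x = y"
      using hdist_nonneg[of x y] Metric_space.zero[OF metric, of x y] xy
      by (auto simp: cyclic_def)
  qed
qed

lemma cyclic_self: assumes "v \<in> carrier H" shows "v \<in> cyclic v"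
proof -
  interpret G: group G using group_hom by (rule group_hom.axioms(1))
  have "\<rho> \<one>\<^bsub>G\<^esub> v = v" using id_eq_one assms by (metis restrict_apply')
  then have "comb v [(1, \<one>\<^bsub>G\<^esub>)] = v" using assms by (simp add: one_smult)
  moreover have "hdist H v v = 0" using Metric_space.zero[OF metric assms assms] by simp
  ultimately have "approx v v (\<lambda>_. [(1, \<one>\<^bsub>G\<^esub>)])" by (simp add: approx_def)
  then show ?thesis using assms by (auto simp: cyclic_def)
qed

end

theorem kazhdan_constant_le:
  fixes G :: "('g, 'x) monoid_scheme"
  assumes S: "S \<subseteq> carrier G"
  shows "kazhdan_constant G S \<le> kazhdan_constant_in TYPE('h) G S"
  unfolding kazhdan_constant_in_def[of "TYPE('h)"]
proof (rule INF_greatest, clarify)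
  fix H :: "'h inner_module" and \<rho>
  assume rep: "unitary_rep G H \<rho>" and no_inv: "no_invariant_vectors G H \<rho>"
  interpret unitary_rep G H \<rho> by (rule rep)
  show "kazhdan_constant G S \<le> rep_kazhdan S H \<rho>"
    unfolding rep_kazhdan_def
  proof (rule Inf_greatest, clarify)
    fix e :: real and v
    assume e: "e > 0" and v: "v \<in> carrier H" "v \<noteq> \<zero>\<^bsub>H\<^esub>"
      and le: "\<forall>s\<in>S. hnorm H (\<rho> s v \<ominus>\<^bsub>H\<^esub> v) \<le> e * hnorm H v"
    define f where "f x = (SOME w. approx v x w)" for x
    interpret C: rep_transport G H \<rho> "cyclic v" f
      using cyclic_transport[OF v(1)] unfolding f_def .
    have vC: "v \<in> cyclic v" using v by (intro cyclic_self)
    have "hnorm C.K (C.\<tau> s (f v) \<ominus>\<^bsub>C.K\<^esub> f v) \<le> e * hnorm C.K (f v)" if "s \<in> S" for s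
      using that le vC S by (auto simp: C.\<tau>_eq C.minus_K C.C_rep C.C_minus C.hnorm_K)
    moreover have "f v \<in> carrier C.K" "f v \<noteq> \<zero>\<^bsub>C.K\<^esub>"
      using vC v(2) C.C_zero by (auto simp: C.carrier_K C.zero_K)
    ultimately have "rep_kazhdan S C.K C.\<tau> \<le> ereal e"
      unfolding rep_kazhdan_def by (intro Inf_lower) (use e in auto)
    moreover have "kazhdan_constant G S \<le> rep_kazhdan S C.K C.\<tau>"
      unfolding kazhdan_constant_def kazhdan_constant_in_def
      by (rule INF_lower2[of "(C.K, C.\<tau>)"])
         (use C.unitary_rep_K C.no_inv_K[OF no_inv] in auto)
    ultimately show "kazhdan_constant G S \<le> ereal e" by (rule order_trans[rotated])
  qed
qed

end

theory Submission
  imports Defs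
begin

text \<open>
  Let \<open>V\<close> be a unitary representation of the group without invariant vectors, and let
  \<open>V\<^sub>i\<close> be the space of vectors fixed by the vertex group \<open>G\<^sub>i\<close>. A vector that every element
  of \<open>G\<^sub>i\<close> moves by at most \<open>\<epsilon>\<close> is at squared distance at most \<open>\<epsilon>\<^sup>2/2\<close> from \<open>V\<^sub>i\<close>
  (\<open>hnorm_sub_proj_le\<close>), because the projection onto \<open>V\<^sub>i\<close> is a limit of convex combinations of
  the orbit. As the vertex groups generate, the \<open>V\<^sub>i\<close> meet only in \<open>0\<close>. It remains to bound the
  norm of a vector by its distances to the \<open>V\<^sub>i\<close>, and this is possible as soon as the
  angles between the \<open>V\<^sub>i\<close> are pairwise large.

  The angles come from the edges. If \<open>i\<close> and \<open>j\<close> are not adjacent, the projections onto \<open>V\<^sub>i\<close> and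
  \<open>V\<^sub>j\<close> commute. If they are adjacent, the group generated by \<open>G\<^sub>i\<close> and \<open>G\<^sub>j\<close> is nilpotent of class
  two. Suppose that its centre acts by a character \<open>\<chi>\<close>. The elements \<open>a\<close> with
  \<open>\<chi>([x\<^sub>i(a), x\<^sub>j(b)]) = 1\<close> for all \<open>b\<close> form a submodule \<open>K\<close> of \<open>M\<^sub>i\<close>. When \<open>K = M\<^sub>i\<close> the two groups
  commute in the representation. Otherwise \<open>K\<close> has index at least \<open>m\<close>, since the annihilator of
  a nonzero element of \<open>M\<^sub>i/K\<close> is a proper right ideal, and translates of a vector of \<open>V\<^sub>j\<close> by
  elements \<open>x\<^sub>i(a)\<close> from different cosets of \<open>K\<close> are orthogonal. Averaging over \<open>m\<close> of them shows
  that the cosine of the angle between \<open>V\<^sub>i\<close> and \<open>V\<^sub>j\<close> is at most \<open>1/\<surd>m\<close>.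

  The central characters are not accessible directly when the centre is infinite. They are
  replaced by the commuting projections onto the vectors fixed by the groups
  \<open>[x\<^sub>i(a), G\<^sub>j]\<close>, one for each \<open>a\<close>. Finite generation of \<open>M\<^sub>i\<close> gives the ascending chain condition
  for its subgroups, so a hypothetical pair of vectors that violates the bound can be
  chosen with maximal \<open>K\<close>; splitting off finitely many of these projections then leaves a
  violating pair with the required orthogonality (\<open>not_bad\<close>, \<open>friedrichs_edge\<close>).

  Finally let \<open>c < 1/(d - 1)\<close> bound all the cosines. Start from any vector and project it again and
  again onto the \<open>V\<^sub>i\<close> that is farthest away. A projection onto \<open>V\<^sub>i\<close> increases the distance to any
  other \<open>V\<^sub>j\<close> by at most \<open>c\<close> times the distance to \<open>V\<^sub>i\<close> (\<open>hnorm_sub_proj_after_proj\<close>). A quadratic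
  form in the distances, \<open>potential\<close>, therefore drops by at least the square of each step, which is
  also the loss in squared norm. The process converges geometrically to a
  vector in all \<open>V\<^sub>i\<close>, that is to \<open>0\<close>, so the initial potential bounds the initial squared norm
  (\<open>hnorm_le_sum_distances\<close>).
\<close>

section \<open>The real inner product of a complex Hilbert space\<close>

context complex_inner_space
begin

text \<open>
  Fixed spaces are complex subspaces, so orthogonality to them may be tested on real
  parts. The real part is a symmetric bilinear form with the same norm.
\<close>

definition rip :: "'h \<Rightarrow> 'h \<Rightarrow> real" where
  "rip x y = Re (ip H x y)"

lemma rip_sym: "x \<in> carrier H \<Longrightarrow> y \<in> carrier H \<Longrightarrow> rip x y = rip y x"
  using ip_cnj[of x y] by (simp add: rip_def)

lemma rip_add_left:
  "x \<in> carrier H \<Longrightarrow> y \<in> carrier H \<Longrightarrow> z \<in> carrier H \<Longrightarrow> rip (x \<oplus> y) z = rip x z + rip y z"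
  by (simp add: rip_def ip_add)

lemma rip_add_right:
  "x \<in> carrier H \<Longrightarrow> y \<in> carrier H \<Longrightarrow> z \<in> carrier H \<Longrightarrow> rip z (x \<oplus> y) = rip z x + rip z y"
  by (simp add: rip_def ip_add_right)

lemma minus_add_cancel: "x \<in> carrier H \<Longrightarrow> y \<in> carrier H \<Longrightarrow> (x \<ominus> y) \<oplus> y = x"
  using minus_eq_iff[of x y "x \<ominus> y"] by simp

lemma rip_diff_left:
  assumes "x \<in> carrier H" "y \<in> carrier H" "z \<in> carrier H"
  shows "rip (x \<ominus> y) z = rip x z - rip y z"
  using rip_add_left[of "x \<ominus> y" y z] assms by (simp add: minus_add_cancel)

lemma rip_diff_right:
  assumes "x \<in> carrier H" "y \<in> carrier H" "z \<in> carrier H"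
  shows "rip z (x \<ominus> y) = rip z x - rip z y"
  using rip_diff_left[OF assms] assms by (simp add: rip_sym[of z])

lemma rip_scale_left:
  "x \<in> carrier H \<Longrightarrow> y \<in> carrier H \<Longrightarrow> rip (complex_of_real c \<odot> x) y = c * rip x y"
  by (simp add: rip_def ip_smult)

lemma rip_zero_left [simp]: "x \<in> carrier H \<Longrightarrow> rip \<zero> x = 0"
  by (simp add: rip_def)

lemma rip_zero_right [simp]: "x \<in> carrier H \<Longrightarrow> rip x \<zero> = 0"
  by (simp add: rip_sym[of x])

lemma rip_self: "x \<in> carrier H \<Longrightarrow> rip x x = (hnorm H x)\<^sup>2"
  by (simp add: rip_def hnorm_sq)

lemma rip_self_nonneg [simp]: "x \<in> carrier H \<Longrightarrow> 0 \<le> rip x x"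
  by (simp add: rip_self)

lemma rip_self_eq_0: "x \<in> carrier H \<Longrightarrow> rip x x = 0 \<longleftrightarrow> x = \<zero>"
  by (simp add: rip_self hnorm_eq_0)

lemma hnorm_zero [simp]: "hnorm H \<zero> = 0"
  by (simp add: hnorm_eq_0)

lemma rip_le: "x \<in> carrier H \<Longrightarrow> y \<in> carrier H \<Longrightarrow> rip x y \<le> hnorm H x * hnorm H y"
  by (simp add: rip_def Re_ip_le)

lemma abs_rip_le:
  assumes "x \<in> carrier H" "y \<in> carrier H"
  shows "\<bar>rip x y\<bar> \<le> hnorm H x * hnorm H y"
proof -
  have "- rip x y = rip (complex_of_real (- 1) \<odot> x) y"
    using assms rip_scale_left[of x y "- 1"] by simp
  also have "\<dots> \<le> hnorm H x * hnorm H y"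
    using assms rip_le[of "complex_of_real (- 1) \<odot> x" y] by (simp add: hnorm_smult)
  finally show ?thesis using rip_le[OF assms] by linarith
qed

lemma hnorm_diff_sq:
  assumes "x \<in> carrier H" "y \<in> carrier H"
  shows "(hnorm H (x \<ominus> y))\<^sup>2 = (hnorm H x)\<^sup>2 - 2 * rip x y + (hnorm H y)\<^sup>2"
  using assms rip_sym[of x y]
  by (simp add: rip_self[symmetric] rip_diff_left rip_diff_right)

lemma eq_if_rip_eq:
  assumes "x \<in> carrier H" "y \<in> carrier H" "\<And>z. z \<in> carrier H \<Longrightarrow> rip x z = rip y z"
  shows "x = y"
proof -
  have "rip (x \<ominus> y) (x \<ominus> y) = 0" using assms by (simp add: rip_diff_left)
  then have "x \<ominus> y = \<zero>" using assms by (simp add: rip_self_eq_0)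
  then show ?thesis using assms by (simp add: minus_eq_iff)
qed

definition tends :: "(nat \<Rightarrow> 'h) \<Rightarrow> 'h \<Rightarrow> bool" where
  "tends xs x \<longleftrightarrow> range xs \<subseteq> carrier H \<and> x \<in> carrier H \<and> (\<lambda>n. hnorm H (xs n \<ominus> x)) \<longlonglongrightarrow> 0"

lemma tends_carrier: "tends xs x \<Longrightarrow> xs n \<in> carrier H" "tends xs x \<Longrightarrow> x \<in> carrier H"
  by (auto simp: tends_def)

lemma tends_rip:
  assumes "tends xs x" and z: "z \<in> carrier H"
  shows "(\<lambda>n. rip (xs n) z) \<longlonglongrightarrow> rip x z"
proof -
  have c: "xs n \<in> carrier H" "x \<in> carrier H" for n using assms tends_carrier by auto
  have "(\<lambda>n. hnorm H (xs n \<ominus> x) * hnorm H z) \<longlonglongrightarrow> 0"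
    using assms unfolding tends_def by (auto intro: tendsto_mult_left_zero)
  then have "(\<lambda>n. rip (xs n) z - rip x z) \<longlonglongrightarrow> 0"
  proof (rule Lim_null_comparison[rotated])
    show "\<forall>\<^sub>F n in sequentially. norm (rip (xs n) z - rip x z) \<le> hnorm H (xs n \<ominus> x) * hnorm H z"
      using c z abs_rip_le[of "xs _ \<ominus> x" z] by (simp add: rip_diff_left)
  qed
  then show ?thesis by (simp add: LIM_zero_iff)
qed

lemma tends_hnorm:
  assumes "tends xs x"
  shows "(\<lambda>n. hnorm H (xs n)) \<longlonglongrightarrow> hnorm H x"
proof -
  have c: "xs n \<in> carrier H" "x \<in> carrier H" for n using assms tends_carrier by auto
  have "(\<lambda>n. hnorm H (xs n) - hnorm H x) \<longlonglongrightarrow> 0"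
  proof (rule Lim_null_comparison)
    have "\<bar>hnorm H (xs n) - hnorm H x\<bar> \<le> hnorm H (xs n \<ominus> x)" for n
    proof -
      have "(hnorm H (xs n) - hnorm H x)\<^sup>2 \<le> (hnorm H (xs n \<ominus> x))\<^sup>2"
        using rip_le[of "xs n" x] c by (simp add: hnorm_diff_sq power2_diff)
      then show ?thesis using c by (simp add: abs_le_square_iff[symmetric])
    qed
    then show "\<forall>\<^sub>F n in sequentially. norm (hnorm H (xs n) - hnorm H x) \<le> hnorm H (xs n \<ominus> x)"
      by simp
    show "(\<lambda>n. hnorm H (xs n \<ominus> x)) \<longlonglongrightarrow> 0" using assms by (simp add: tends_def)
  qed
  then show ?thesis by (simp add: LIM_zero_iff)
qed

lemma tends_unique:
  assumes "tends xs x" "tends xs y" shows "x = y"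
proof (rule eq_if_rip_eq)
  show "rip x z = rip y z" if "z \<in> carrier H" for z
    using tends_rip[OF assms(1) that] tends_rip[OF assms(2) that] by (rule LIMSEQ_unique)
qed (use assms tends_carrier in auto)

lemma tends_if_close:
  assumes "tends xs x" "range ys \<subseteq> carrier H" "(\<lambda>n. hnorm H (xs n \<ominus> ys n)) \<longlonglongrightarrow> 0"
  shows "tends ys x"
proof -
  have c: "xs n \<in> carrier H" "x \<in> carrier H" "ys n \<in> carrier H" for n
    using assms tends_carrier by auto
  have "(\<lambda>n. hnorm H (ys n \<ominus> x)) \<longlonglongrightarrow> 0"
  proof (rule Lim_null_comparison)
    show "(\<lambda>n. hnorm H (xs n \<ominus> ys n) + hnorm H (xs n \<ominus> x)) \<longlonglongrightarrow> 0"
      using assms by (auto simp: tends_def intro: tendsto_add_zero)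
    have "hnorm H (ys n \<ominus> x) \<le> hnorm H (xs n \<ominus> ys n) + hnorm H (xs n \<ominus> x)" for n
      using Metric_space.triangle[OF metric, of "ys n" "xs n" x]
        Metric_space.commute[OF metric, of "xs n" "ys n"] c
      by (simp add: hdist_def)
    then show "\<forall>\<^sub>F n in sequentially. norm (hnorm H (ys n \<ominus> x))
        \<le> hnorm H (xs n \<ominus> ys n) + hnorm H (xs n \<ominus> x)"
      using c by simp
  qed
  then show ?thesis using c by (auto simp: tends_def)
qed

definition mid :: "'h \<Rightarrow> 'h \<Rightarrow> 'h" where
  "mid a b = complex_of_real (1/2) \<odot> (a \<oplus> b)"

lemma mid_closed [simp]: "a \<in> carrier H \<Longrightarrow> b \<in> carrier H \<Longrightarrow> mid a b \<in> carrier H"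
  unfolding mid_def by blast

lemma rip_mid:
  "a \<in> carrier H \<Longrightarrow> b \<in> carrier H \<Longrightarrow> z \<in> carrier H \<Longrightarrow> rip (mid a b) z = (rip a z + rip b z) / 2"
  unfolding mid_def by (subst rip_scale_left) (auto simp: rip_add_left)

lemma hnorm_mid:
  assumes "a \<in> carrier H" "b \<in> carrier H"
  shows "(hnorm H (a \<ominus> b))\<^sup>2 = 2 * (hnorm H a)\<^sup>2 + 2 * (hnorm H b)\<^sup>2 - 4 * (hnorm H (mid a b))\<^sup>2"
proof -
  have "rip (mid a b) (mid a b) = (rip a a + 2 * rip a b + rip b b) / 4"
    using assms rip_sym[of a "mid a b"] rip_sym[of b "mid a b"] rip_sym[of b a]
    by (simp add: rip_mid)
  then show ?thesis using assms by (simp add: hnorm_diff_sq rip_self)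
qed

end

context complex_hilbert_space
begin

lemma cauchy_tends:
  assumes "range xs \<subseteq> carrier H"
    and "\<And>e. e > 0 \<Longrightarrow> \<exists>N. \<forall>m\<ge>N. \<forall>n\<ge>N. hnorm H (xs m \<ominus> xs n) < e"
  obtains x where "tends xs x"
proof -
  have c: "xs n \<in> carrier H" for n using assms(1) by auto
  have "\<forall>e>0. \<exists>N. \<forall>m n. N \<le> m \<longrightarrow> N \<le> n \<longrightarrow> hdist H (xs m) (xs n) < e"
    using assms(2) c by (simp add: hdist_def)
  then obtain x where "x \<in> carrier H" "(\<lambda>n. hdist H (xs n) x) \<longlonglongrightarrow> 0"
    using complete assms(1) unfolding mcomplete_iff by blast
  then have "tends xs x" using c by (auto simp: tends_def hdist_def)
  then show thesis by (rule that)
qed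

text \<open>
  By the parallelogram law, any two vectors of \<open>C\<close> whose norms are close to the infimum are close to
  each other. This argument only involves midpoints, so \<open>C\<close> may be much thinner than convex.
  The last clause is the uniqueness of the minimal vector in the form needed for isometries
  that preserve \<open>C\<close>.
\<close>

lemma minimal_vector:
  assumes sub: "C \<subseteq> carrier H" and ne: "C \<noteq> {}"
    and C_mid: "\<And>a b. a \<in> C \<Longrightarrow> b \<in> C \<Longrightarrow> mid a b \<in> C"
  obtains c xs where "range xs \<subseteq> C" "tends xs c"
    "\<And>ys. range ys \<subseteq> C \<Longrightarrow> (\<And>n. hnorm H (ys n) = hnorm H (xs n)) \<Longrightarrow> tends ys c"
proof -
  define \<delta> where "\<delta> = Inf (hnorm H ` C)"
  have bdd: "bdd_below (hnorm H ` C)" using sub by (intro bdd_belowI[of _ 0]) auto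
  have \<delta>_le: "\<delta> \<le> hnorm H a" if "a \<in> C" for a
    unfolding \<delta>_def using that bdd by (auto intro: cInf_lower)
  have "\<delta> \<ge> 0" unfolding \<delta>_def using sub ne by (intro cInf_greatest) auto
  have close: "(hnorm H (a \<ominus> b))\<^sup>2 \<le> 2 * ((hnorm H a)\<^sup>2 - \<delta>\<^sup>2) + 2 * ((hnorm H b)\<^sup>2 - \<delta>\<^sup>2)"
    if "a \<in> C" "b \<in> C" for a b
    using hnorm_mid[of a b] power_mono[OF \<delta>_le[OF C_mid[OF that]] \<open>\<delta> \<ge> 0\<close>, of 2] that sub
    by (auto simp: subset_iff)
  have "\<exists>a\<in>C. hnorm H a < \<delta> + inverse (real (Suc n))" for n
  proof -
    have "\<delta> < \<delta> + inverse (real (Suc n))" by simp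
    then show ?thesis unfolding \<delta>_def using cInf_lessD[of "hnorm H ` C"] ne by blast
  qed
  then obtain xs where xs: "\<And>n. xs n \<in> C" "\<And>n. hnorm H (xs n) < \<delta> + inverse (real (Suc n))"
    by metis
  have lim: "(\<lambda>n. hnorm H (xs n)) \<longlonglongrightarrow> \<delta>"
  proof (rule tendsto_sandwich[OF _ _ tendsto_const])
    show "(\<lambda>n. \<delta> + inverse (real (Suc n))) \<longlonglongrightarrow> \<delta>"
      using tendsto_add[OF tendsto_const LIMSEQ_inverse_real_of_nat, of \<delta>] by simp
  qed (use xs \<delta>_le in \<open>auto intro!: always_eventually less_imp_le\<close>)
  have lim2: "(\<lambda>n. 2 * ((hnorm H (xs n))\<^sup>2 - \<delta>\<^sup>2)) \<longlonglongrightarrow> 0"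
    using tendsto_mult_left[OF LIM_zero[OF tendsto_power[OF lim, of 2]], of 2] by simp
  have cau: "\<exists>N. \<forall>m\<ge>N. \<forall>n\<ge>N. hnorm H (xs m \<ominus> xs n) < e" if "e > 0" for e
  proof -
    have "\<forall>\<^sub>F n in sequentially. 2 * ((hnorm H (xs n))\<^sup>2 - \<delta>\<^sup>2) < e\<^sup>2 / 2"
      using lim2 \<open>e > 0\<close> by (intro order_tendstoD(2)[OF lim2]) simp
    then obtain N where N: "\<And>n. n \<ge> N \<Longrightarrow> 2 * ((hnorm H (xs n))\<^sup>2 - \<delta>\<^sup>2) < e\<^sup>2 / 2"
      by (auto simp: eventually_sequentially)
    have "hnorm H (xs m \<ominus> xs n) < e" if "m \<ge> N" "n \<ge> N" for m n
    proof -
      have "(hnorm H (xs m \<ominus> xs n))\<^sup>2 < e\<^sup>2"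
        using close[OF xs(1) xs(1), of m n] N[OF that(1)] N[OF that(2)] by linarith
      then show ?thesis using \<open>e > 0\<close> by (simp add: power2_less_imp_less)
    qed
    then show ?thesis by blast
  qed
  obtain c where c: "tends xs c"
    by (rule cauchy_tends[of xs, OF _ cau]) (use xs sub in auto)
  have "tends ys c" if ys: "range ys \<subseteq> C" "\<And>n. hnorm H (ys n) = hnorm H (xs n)" for ys
  proof (rule tends_if_close[OF c])
    show "range ys \<subseteq> carrier H" using ys sub by auto
    have "(\<lambda>n. (hnorm H (xs n \<ominus> ys n))\<^sup>2) \<longlonglongrightarrow> 0"
    proof (rule tendsto_sandwich[OF _ _ tendsto_const tendsto_add_zero[OF lim2 lim2]])
      show "\<forall>\<^sub>F n in sequentially. (hnorm H (xs n \<ominus> ys n))\<^sup>2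
          \<le> 2 * ((hnorm H (xs n))\<^sup>2 - \<delta>\<^sup>2) + 2 * ((hnorm H (xs n))\<^sup>2 - \<delta>\<^sup>2)"
        using close[OF xs(1), of "ys _"] ys by (intro always_eventually allI) (metis range_subsetD)
    qed simp
    then have "(\<lambda>n. sqrt ((hnorm H (xs n \<ominus> ys n))\<^sup>2)) \<longlonglongrightarrow> sqrt 0"
      by (rule tendsto_real_sqrt)
    moreover have "sqrt ((hnorm H (xs n \<ominus> ys n))\<^sup>2) = hnorm H (xs n \<ominus> ys n)" for n
      using xs(1) ys(1) sub by (simp add: subset_iff image_subset_iff)
    ultimately show "(\<lambda>n. hnorm H (xs n \<ominus> ys n)) \<longlonglongrightarrow> 0" by simp
  qed
  with c xs show thesis by (intro that[of xs c]) auto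
qed

end

section \<open>Projections onto fixed vectors\<close>

context unitary_rep
begin

lemma rip_rep:
  "g \<in> carrier G \<Longrightarrow> x \<in> carrier H \<Longrightarrow> y \<in> carrier H \<Longrightarrow> rip (\<rho> g x) (\<rho> g y) = rip x y"
  by (simp add: rip_def rep_ip)

lemma hnorm_rep: "g \<in> carrier G \<Longrightarrow> x \<in> carrier H \<Longrightarrow> hnorm H (\<rho> g x) = hnorm H x"
  by (simp add: hnorm_def rep_ip)

lemma group_G: "group G"
  using group_hom by (rule group_hom.axioms(1))

lemma rep_one: "x \<in> carrier H \<Longrightarrow> \<rho> \<one>\<^bsub>G\<^esub> x = x"
  using id_eq_one by (metis restrict_apply')

lemma rep_inv_cancel: "g \<in> carrier G \<Longrightarrow> x \<in> carrier H \<Longrightarrow> \<rho> g (\<rho> (inv\<^bsub>G\<^esub> g) x) = x"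
  "g \<in> carrier G \<Longrightarrow> x \<in> carrier H \<Longrightarrow> \<rho> (inv\<^bsub>G\<^esub> g) (\<rho> g x) = x"
  using group_G
  by (simp_all add: composition_rule[symmetric] rep_one group.inv_closed group.r_inv group.l_inv)

lemma rep_diff:
  assumes "g \<in> carrier G" "x \<in> carrier H" "y \<in> carrier H"
  shows "\<rho> g (x \<ominus> y) = \<rho> g x \<ominus> \<rho> g y"
proof -
  have "\<rho> g x = \<rho> g (x \<ominus> y) \<oplus> \<rho> g y"
    using assms rep_add[of g "x \<ominus> y" y] by (simp add: minus_add_cancel)
  then show ?thesis using assms minus_eq_iff[of "\<rho> g x" "\<rho> g y" "\<rho> g (x \<ominus> y)"] by simp
qed

lemma rep_mid:
  "g \<in> carrier G \<Longrightarrow> x \<in> carrier H \<Longrightarrow> y \<in> carrier H \<Longrightarrow> \<rho> g (mid x y) = mid (\<rho> g x) (\<rho> g y)"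
  by (simp add: mid_def rep_smult rep_add del: of_real_divide)

lemma tends_rep:
  assumes "g \<in> carrier G" "tends xs x" shows "tends (\<lambda>n. \<rho> g (xs n)) (\<rho> g x)"
  using assms
  by (auto simp: tends_def rep_diff[symmetric] hnorm_rep image_subset_iff)

definition fixed :: "'g set \<Rightarrow> 'h set" where
  "fixed S = {v \<in> carrier H. \<forall>s\<in>S. \<rho> s v = v}"

lemma fixed_carrier: "v \<in> fixed S \<Longrightarrow> v \<in> carrier H"
  by (simp add: fixed_def)

lemma fixed_zero: "S \<subseteq> carrier G \<Longrightarrow> \<zero> \<in> fixed S"
  by (auto simp: fixed_def rep_zero)

lemma fixed_diff: "S \<subseteq> carrier G \<Longrightarrow> x \<in> fixed S \<Longrightarrow> y \<in> fixed S \<Longrightarrow> x \<ominus> y \<in> fixed S"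
  by (auto simp: fixed_def rep_diff)

lemma fixed_mid: "S \<subseteq> carrier G \<Longrightarrow> x \<in> fixed S \<Longrightarrow> y \<in> fixed S \<Longrightarrow> mid x y \<in> fixed S"
  by (auto simp: fixed_def rep_mid)

lemma fixed_scale: "S \<subseteq> carrier G \<Longrightarrow> x \<in> fixed S \<Longrightarrow> c \<odot> x \<in> fixed S"
  by (auto simp: fixed_def rep_smult)

lemma fixed_lim:
  assumes "S \<subseteq> carrier G" "range xs \<subseteq> fixed S" "tends xs x"
  shows "x \<in> fixed S"
proof -
  have "\<rho> s x = x" if "s \<in> S" for s
  proof -
    have "(\<lambda>n. \<rho> s (xs n)) = xs" using assms(2) that by (auto simp: fixed_def)
    then show ?thesis using tends_rep[of s xs x] that assms by (auto intro: tends_unique)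
  qed
  then show ?thesis using assms tends_carrier by (auto simp: fixed_def)
qed

lemma fixed_generate:
  assumes S: "S \<subseteq> carrier G" shows "fixed (generate G S) = fixed S"
proof (intro equalityI subsetI)
  fix v assume "v \<in> fixed (generate G S)"
  then show "v \<in> fixed S" by (auto simp: fixed_def intro: generate.incl)
next
  fix v assume v: "v \<in> fixed S"
  have "\<rho> s v = v" if "s \<in> generate G S" for s
    using that
  proof induction
    case (inv h)
    then have "\<rho> (inv\<^bsub>G\<^esub> h) (\<rho> h v) = v" "\<rho> h v = v"
      using v S rep_inv_cancel(2)[of h v] by (auto simp: fixed_def)
    then show ?case by simp
  next
    case (eng h1 h2)
    then show ?case using v S group.generate_in_carrier[OF group_G S]
      by (simp add: fixed_def composition_rule)
  qed (use v in \<open>auto simp: fixed_def rep_one\<close>)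
  then show "v \<in> fixed (generate G S)" using v by (auto simp: fixed_def)
qed

text \<open>
  The combinations of orbit points with dyadic weights. Midpoints are all that
  \<open>minimal_vector\<close> asks for, and they give an induction principle without finite sums.
\<close>

inductive_set orbit_hull :: "'g set \<Rightarrow> 'h \<Rightarrow> 'h set" for S v where
  orbit: "s \<in> S \<Longrightarrow> \<rho> s v \<in> orbit_hull S v"
| mid: "a \<in> orbit_hull S v \<Longrightarrow> b \<in> orbit_hull S v \<Longrightarrow> mid a b \<in> orbit_hull S v"

lemma hull_carrier:
  "S \<subseteq> carrier G \<Longrightarrow> v \<in> carrier H \<Longrightarrow> a \<in> orbit_hull S v \<Longrightarrow> a \<in> carrier H"
  by (rotate_tac -1, induction rule: orbit_hull.induct) auto

lemma hull_rep:
  assumes S: "subgroup S G" "v \<in> carrier H" and "s \<in> S" "a \<in> orbit_hull S v"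
  shows "\<rho> s a \<in> orbit_hull S v"
  using assms(4)
proof induction
  case (orbit t)
  then have "\<rho> s (\<rho> t v) = \<rho> (s \<otimes>\<^bsub>G\<^esub> t) v"
    using assms subgroup.subset[OF S(1)] by (subst composition_rule) auto
  then show ?case using orbit assms by (auto intro: orbit_hull.orbit subgroup.m_closed)
next
  case (mid a b)
  have sub: "S \<subseteq> carrier G" by (rule subgroup.subset[OF S(1)])
  then have "\<rho> s (local.mid a b) = local.mid (\<rho> s a) (\<rho> s b)"
    using mid assms hull_carrier[OF sub S(2)] by (intro rep_mid) auto
  then show ?case using mid by (auto intro: orbit_hull.mid)
qed

text \<open>
  The orthogonal projection onto the vectors fixed by \<open>S\<close>, described as a limit of points of the
  orbit hull. In this form it inherits from the orbit every property that is stable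
  under midpoints and limits (\<open>proj_closed_induct\<close>).
\<close>

definition is_proj :: "'g set \<Rightarrow> 'h \<Rightarrow> 'h \<Rightarrow> bool" where
  "is_proj S v p \<longleftrightarrow> p \<in> fixed S \<and> (\<exists>xs. range xs \<subseteq> orbit_hull S v \<and> tends xs p)"

definition proj :: "'g set \<Rightarrow> 'h \<Rightarrow> 'h" where
  "proj S v = (SOME p. is_proj S v p)"

text \<open>
  The group \<open>S\<close> acts on the orbit hull by isometries, hence fixes its vector of minimal norm.
\<close>

lemma is_proj_proj:
  assumes S: "subgroup S G" and v: "v \<in> carrier H"
  shows "is_proj S v (proj S v)"
proof -
  have sub: "S \<subseteq> carrier G" by (rule subgroup.subset[OF S])
  obtain p xs where xs: "range xs \<subseteq> orbit_hull S v" "tends xs p"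
    and inv: "\<And>ys. range ys \<subseteq> orbit_hull S v \<Longrightarrow> (\<And>n. hnorm H (ys n) = hnorm H (xs n)) \<Longrightarrow> tends ys p"
  proof (rule minimal_vector)
    show "orbit_hull S v \<subseteq> carrier H" using hull_carrier[OF sub v] by auto
    show "orbit_hull S v \<noteq> {}" using orbit_hull.orbit[OF subgroup.one_closed[OF S]] by auto
  qed (auto intro: orbit_hull.mid)
  have "\<rho> s p = p" if "s \<in> S" for s
  proof -
    have "tends (\<lambda>n. \<rho> s (xs n)) p"
      using xs(1) that sub hull_rep[OF S v that] hull_carrier[OF sub v]
      by (intro inv) (auto simp: image_subset_iff intro!: hnorm_rep)
    moreover have "tends (\<lambda>n. \<rho> s (xs n)) (\<rho> s p)"
      using xs(2) that sub by (intro tends_rep) auto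
    ultimately show ?thesis using tends_unique by blast
  qed
  then have "is_proj S v p" using xs tends_carrier(2)[OF xs(2)] by (auto simp: is_proj_def fixed_def)
  then show ?thesis unfolding proj_def by (rule someI)
qed

lemma proj_fixed: "subgroup S G \<Longrightarrow> v \<in> carrier H \<Longrightarrow> proj S v \<in> fixed S"
  using is_proj_proj by (simp add: is_proj_def)

lemma proj_carrier [simp]: "subgroup S G \<Longrightarrow> v \<in> carrier H \<Longrightarrow> proj S v \<in> carrier H"
  using proj_fixed fixed_carrier by blast

lemma proj_closed_induct:
  assumes S: "subgroup S G" and v: "v \<in> carrier H"
    and orbit: "\<And>s. s \<in> S \<Longrightarrow> \<Phi> (\<rho> s v)"
    and mid: "\<And>a b. a \<in> carrier H \<Longrightarrow> b \<in> carrier H \<Longrightarrow> \<Phi> a \<Longrightarrow> \<Phi> b \<Longrightarrow> \<Phi> (mid a b)"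
    and lim: "\<And>xs x. tends xs x \<Longrightarrow> (\<And>n. \<Phi> (xs n)) \<Longrightarrow> \<Phi> x"
  shows "\<Phi> (proj S v)"
proof -
  have sub: "S \<subseteq> carrier G" by (rule subgroup.subset[OF S])
  have hull: "\<Phi> a" if "a \<in> orbit_hull S v" for a
    using that by induction (use orbit mid hull_carrier[OF sub v] in auto)
  obtain xs where "range xs \<subseteq> orbit_hull S v" "tends xs (proj S v)"
    using is_proj_proj[OF S v] by (auto simp: is_proj_def)
  then show ?thesis using lim hull by blast
qed

lemma rip_proj_const:
  assumes "subgroup S G" "v \<in> carrier H" "z \<in> carrier H"
    and "\<And>s. s \<in> S \<Longrightarrow> rip (\<rho> s v) z = c"
  shows "rip (proj S v) z = c"
  using assms(1,2)
proof (rule proj_closed_induct)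
  show "rip x z = c" if "tends xs x" "\<And>n. rip (xs n) z = c" for xs x
    using tends_rip[OF that(1) assms(3)] that(2) by (simp add: LIMSEQ_const_iff)
qed (use assms in \<open>auto simp: rip_mid\<close>)

lemma rip_proj:
  assumes S: "subgroup S G" and v: "v \<in> carrier H" and f: "f \<in> fixed S"
  shows "rip (proj S v) f = rip v f"
proof (rule rip_proj_const[OF S v fixed_carrier[OF f]])
  fix s assume s: "s \<in> S"
  then have "s \<in> carrier G" using subgroup.subset[OF S] by auto
  then show "rip (\<rho> s v) f = rip v f"
    using rip_rep[of s v f] v f s by (simp add: fixed_def)
qed

lemma proj_mem_fixed:
  assumes S: "subgroup S G" and T: "T \<subseteq> carrier G" and v: "v \<in> fixed T"
    and inv: "\<And>s. s \<in> S \<Longrightarrow> \<rho> s v \<in> fixed T"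
  shows "proj S v \<in> fixed T"
proof (rule proj_closed_induct[OF S fixed_carrier[OF v]])
  show "x \<in> fixed T" if "tends xs x" "\<And>n. xs n \<in> fixed T" for xs x
    using fixed_lim[OF T _ that(1)] that(2) by blast
qed (use inv fixed_mid[OF T] in blast)+

lemma proj_mem_fixed_commuting:
  assumes S: "subgroup S G" and T: "T \<subseteq> carrier G" and v: "v \<in> fixed T"
    and comm: "\<And>s t. s \<in> S \<Longrightarrow> t \<in> T \<Longrightarrow> s \<otimes>\<^bsub>G\<^esub> t = t \<otimes>\<^bsub>G\<^esub> s"
  shows "proj S v \<in> fixed T"
proof (rule proj_mem_fixed[OF S T v])
  fix s assume s: "s \<in> S"
  then have sG: "s \<in> carrier G" using subgroup.subset[OF S] by auto
  have "\<rho> t (\<rho> s v) = \<rho> s v" if "t \<in> T" for t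
  proof -
    have "\<rho> t (\<rho> s v) = \<rho> s (\<rho> t v)"
      using comm[OF s that] sG T that v
      by (simp add: composition_rule[symmetric] fixed_carrier subset_iff)
    then show ?thesis using v that by (simp add: fixed_def)
  qed
  then show "\<rho> s v \<in> fixed T" using sG v by (simp add: fixed_def)
qed

lemma rip_proj_proj:
  assumes S: "subgroup S G" and v: "v \<in> carrier H" "w \<in> carrier H"
  shows "rip (proj S v) (proj S w) = rip (proj S v) w" "rip (proj S v) (proj S w) = rip v (proj S w)"
  using rip_proj[OF S v(1) proj_fixed[OF S v(2)]] rip_proj[OF S v(2) proj_fixed[OF S v(1)]]
    rip_sym[of "proj S v" w] rip_sym[of "proj S v" "proj S w"] assms by auto

lemma proj_orth:
  assumes "subgroup S G" "v \<in> carrier H" "f \<in> fixed S"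
  shows "rip (v \<ominus> proj S v) f = 0"
  using assms rip_proj[OF assms] by (simp add: rip_diff_left fixed_carrier)

lemma hnorm_proj_sq:
  assumes "subgroup S G" "v \<in> carrier H"
  shows "(hnorm H (v \<ominus> proj S v))\<^sup>2 = (hnorm H v)\<^sup>2 - (hnorm H (proj S v))\<^sup>2"
  using assms rip_proj_proj(2)[OF assms(1) assms(2) assms(2)]
    rip_self[OF proj_carrier[OF assms]]
  by (simp add: hnorm_diff_sq)

lemma proj_unique:
  assumes S: "subgroup S G" and v: "v \<in> carrier H" and p: "p \<in> fixed S"
    and orth: "\<And>f. f \<in> fixed S \<Longrightarrow> rip p f = rip v f"
  shows "proj S v = p"
proof -
  have c: "p \<in> carrier H" using p by (rule fixed_carrier)
  let ?d = "proj S v \<ominus> p"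
  have d: "?d \<in> fixed S" using proj_fixed[OF S v] p subgroup.subset[OF S] by (intro fixed_diff) auto
  have "rip ?d ?d = rip (proj S v) ?d - rip p ?d"
    using S v c by (intro rip_diff_left) auto
  also have "\<dots> = 0" using rip_proj[OF S v d] orth[OF d] by simp
  finally have "?d = \<zero>" using S v c by (simp add: rip_self_eq_0)
  then show ?thesis using S v c by (simp add: minus_eq_iff)
qed

lemma proj_id: "subgroup S G \<Longrightarrow> v \<in> fixed S \<Longrightarrow> proj S v = v"
  by (rule proj_unique) (auto simp: fixed_carrier)

lemma proj_diff:
  assumes S: "subgroup S G" and v: "v \<in> carrier H" "w \<in> carrier H"
  shows "proj S (v \<ominus> w) = proj S v \<ominus> proj S w"
  using assms subgroup.subset[OF S]
  by (intro proj_unique)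
    (auto simp: fixed_diff proj_fixed rip_diff_left fixed_carrier rip_proj)

text \<open>
  A displacement of at most \<open>e\<close> means that the inner product with \<open>v\<close> is at least
  \<open>\<parallel>v\<parallel>\<^sup>2 - e\<^sup>2/2\<close> on the orbit, a bound that passes to the projection \<open>p\<close>; and
  \<open>\<parallel>v - p\<parallel>\<^sup>2\<close> is \<open>\<parallel>v\<parallel>\<^sup>2\<close> minus the inner product of \<open>p\<close> and \<open>v\<close>. This is where the factor 2 under
  the root of the final bound originates.
\<close>

lemma hnorm_sub_proj_le:
  assumes S: "subgroup S G" and v: "v \<in> carrier H"
    and e: "\<And>s. s \<in> S \<Longrightarrow> hnorm H (\<rho> s v \<ominus> v) \<le> e"
  shows "(hnorm H (v \<ominus> proj S v))\<^sup>2 \<le> e\<^sup>2 / 2"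
proof -
  have "(hnorm H v)\<^sup>2 - e\<^sup>2 / 2 \<le> rip (proj S v) v"
  proof (rule proj_closed_induct[OF S v])
    fix s assume s: "s \<in> S"
    then have sG: "s \<in> carrier G" using subgroup.subset[OF S] by auto
    have "(hnorm H (\<rho> s v \<ominus> v))\<^sup>2 \<le> e\<^sup>2" using e[OF s] sG v by (intro power_mono) auto
    then show "(hnorm H v)\<^sup>2 - e\<^sup>2 / 2 \<le> rip (\<rho> s v) v"
      using sG v by (simp add: hnorm_diff_sq hnorm_rep)
  next
    fix xs x assume "tends xs x" and "\<And>n. (hnorm H v)\<^sup>2 - e\<^sup>2 / 2 \<le> rip (xs n) v"
    then show "(hnorm H v)\<^sup>2 - e\<^sup>2 / 2 \<le> rip x v"
      using LIMSEQ_le_const[OF tends_rip[OF _ v]] by blast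
  qed (use v in \<open>auto simp: rip_mid\<close>)
  then show ?thesis
    using S v rip_proj_proj(1)[OF S v v] rip_self[OF proj_carrier[OF S v]]
    by (simp add: hnorm_proj_sq)
qed

end

section \<open>Chains of subgroups of finitely generated abelian groups\<close>

context comm_group
begin

lemma generate_insert_decomp:
  assumes A: "A \<subseteq> carrier G" and a: "a \<in> carrier G" and x: "x \<in> generate G (insert a A)"
  obtains k :: int and h where "h \<in> generate G A" "x = a [^] k \<otimes> h"
proof -
  have gen: "h \<in> carrier G" if "h \<in> generate G A" for h
    using generate_in_carrier[OF A that] .
  have "\<exists>k::int. \<exists>h\<in>generate G A. x = a [^] k \<otimes> h"
    using x
  proof induction
    case one
    show ?case by (intro exI[of _ 0] bexI[of _ \<one>]) (auto intro: generate.one)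
  next
    case (incl h)
    show ?case
    proof (cases "h = a")
      case True
      then show ?thesis using a by (intro exI[of _ 1] bexI[of _ \<one>]) (auto intro: generate.one)
    next
      case False
      then show ?thesis using incl A by (intro exI[of _ 0] bexI[of _ h]) (auto intro: generate.incl)
    qed
  next
    case (inv h)
    show ?case
    proof (cases "h = a")
      case True
      then show ?thesis using a
        by (intro exI[of _ "-1"] bexI[of _ \<one>]) (auto intro: generate.one simp: int_pow_neg)
    next
      case False
      then show ?thesis using inv A
        by (intro exI[of _ 0] bexI[of _ "inv h"]) (auto intro: generate.inv)
    qed
  next
    case (eng h1 h2)
    then obtain k1 k2 :: int and g1 g2 where
      g: "g1 \<in> generate G A" "g2 \<in> generate G A" "h1 = a [^] k1 \<otimes> g1" "h2 = a [^] k2 \<otimes> g2"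
      by blast
    then have "h1 \<otimes> h2 = a [^] (k1 + k2) \<otimes> (g1 \<otimes> g2)"
      using a gen by (simp add: int_pow_mult m_ac)
    then show ?case using g by (blast intro: generate.eng)
  qed
  then show thesis using that by blast
qed

text \<open>
  Induction on the number of generators. Modulo the subgroup generated by the old
  generators, an element is determined by its exponent at the new generator. The exponents
  that occur in the chain are the multiples of the least positive one, so the chain is stationary
  once this exponent has appeared and the traces on the old subgroup have become stationary.
\<close>

lemma ascending_subgroups_stabilize:
  assumes "finite A" "A \<subseteq> carrier G"
    and "\<And>n. subgroup (K n) G" "\<And>n. K n \<subseteq> K (Suc n)" "\<And>n. K n \<subseteq> generate G A"
  shows "\<exists>N::nat. \<forall>n\<ge>N. K n \<subseteq> K N"
  using assms
proof (induction A arbitrary: K rule: finite_induct)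
  case empty
  then have "K n \<subseteq> K 0" for n
    using subgroup.one_closed[OF empty.prems(2)] by (fastforce simp: generate_empty)
  then show ?case by blast
next
  case (insert a A)
  have A: "A \<subseteq> carrier G" and a: "a \<in> carrier G" using insert.prems by auto
  have gen: "h \<in> carrier G" if "h \<in> generate G A" for h
    using generate_in_carrier[OF A that] .
  have sgA: "subgroup (generate G A) G" by (rule generate_is_subgroup[OF A])
  have mono: "K m \<subseteq> K n" if "m \<le> n" for m n
    using insert.prems(3) that by (rule lift_Suc_mono_le)
  have KG: "x \<in> carrier G" if "x \<in> K n" for x n
    using that subgroup.mem_carrier[OF insert.prems(2)] by blast
  have "\<exists>N. \<forall>n\<ge>N. K n \<inter> generate G A \<subseteq> K N \<inter> generate G A"
  proof (rule insert.IH[OF A])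
    show "subgroup (K n \<inter> generate G A) G" for n
      using insert.prems(2) sgA by (rule subgroups_Inter_pair)
    show "K n \<inter> generate G A \<subseteq> K (Suc n) \<inter> generate G A" for n
      by (intro Int_mono insert.prems(3) order_refl)
  qed simp
  then obtain N1 where N1: "\<And>n. n \<ge> N1 \<Longrightarrow> K n \<inter> generate G A \<subseteq> K N1" by blast
  define J where "J = {k::nat. k > 0 \<and> (\<exists>n. \<exists>h\<in>generate G A. a [^] int k \<otimes> h \<in> K n)}"
  have J: "k = 0" if "a [^] k \<otimes> h \<in> K n" "h \<in> generate G A" "nat \<bar>k\<bar> \<notin> J" for k :: int and h n
  proof (rule ccontr)
    assume "k \<noteq> 0"
    have "inv (a [^] k \<otimes> h) \<in> K n"
      by (rule subgroup.m_inv_closed[OF insert.prems(2) that(1)])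
    then have "a [^] (- k) \<otimes> inv h \<in> K n"
      using a gen[OF that(2)] by (simp add: int_pow_neg inv_mult_group m_comm)
    moreover have "inv h \<in> generate G A" 
      by (rule subgroup.m_inv_closed[OF sgA that(2)])
    ultimately show False
      using that \<open>k \<noteq> 0\<close> by (cases "k > 0") (auto simp: J_def)
  qed
  show ?case
  proof (cases "J = {}")
    case True
    have "K n \<subseteq> K N1" if "n \<ge> N1" for n
    proof
      fix x assume x: "x \<in> K n"
      then have "x \<in> generate G (insert a A)" using insert.prems(4) by blast
      then obtain k :: int and h where h: "h \<in> generate G A" "x = a [^] k \<otimes> h"
        by (rule generate_insert_decomp[OF A a])
      then have "k = 0" using J[of k h n] x True by auto
      then show "x \<in> K N1" using h x gen N1[OF that] by auto
    qed
    then show ?thesis by blast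
  next
    case False
    define g where "g = (LEAST k. k \<in> J)"
    have "g \<in> J" unfolding g_def using False by (meson LeastI ex_in_conv)
    then obtain N2 h0 where g: "g > 0" "h0 \<in> generate G A" "a [^] int g \<otimes> h0 \<in> K N2"
      by (auto simp: J_def)
    have least: "r \<notin> J" if "r < g" for r using that not_less_Least unfolding g_def by blast
    define b where "b = a [^] int g \<otimes> h0"
    have b: "b \<in> carrier G" using a gen g by (simp add: b_def)
    define N where "N = max N1 N2"
    have "K n \<subseteq> K N" if n: "n \<ge> N" for n
    proof
      fix x assume x: "x \<in> K n"
      then have "x \<in> generate G (insert a A)" using insert.prems(4) by blast
      then obtain k :: int and h where h: "h \<in> generate G A" "x = a [^] k \<otimes> h"
        by (rule generate_insert_decomp[OF A a])
      \<comment> \<open>Division with remainder by the least exponent; the remainder is an exponent again.\<close>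
      define q r where "q = k div int g" and "r = k mod int g"
      have k: "k = int g * q + r" by (simp add: q_def r_def)
      define h' where "h' = h \<otimes> h0 [^] (- q)"
      have h': "h' \<in> generate G A" unfolding h'_def
        by (intro subgroup.m_closed[OF sgA] subgroup_int_pow_closed[OF sgA] h g)
      have bK: "b [^] (z::int) \<in> K l" if "l \<ge> N" for z l
        using g(3) mono[of N2 l] that unfolding b_def N_def
        by (intro subgroup_int_pow_closed insert.prems(2)) auto
      have eq: "x \<otimes> b [^] (- q) = a [^] r \<otimes> h'"
      proof -
        have "b [^] (- q) = a [^] (int g * (- q)) \<otimes> h0 [^] (- q)"
          using a gen[OF g(2)] by (simp add: b_def int_pow_distrib int_pow_pow del: mult_minus_right)
        then have "x \<otimes> b [^] (- q) = (a [^] k \<otimes> a [^] (int g * (- q))) \<otimes> h'"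
          using a gen[OF g(2)] gen[OF h(1)] by (simp add: h h'_def m_ac del: mult_minus_right)
        also have "a [^] k \<otimes> a [^] (int g * (- q)) = a [^] r"
          using a by (simp add: int_pow_mult[symmetric] k)
        finally show ?thesis .
      qed
      have "a [^] r \<otimes> h' \<in> K n"
        using subgroup.m_closed[OF insert.prems(2) x bK[OF n, of "- q"]] eq by simp
      moreover have "nat \<bar>r\<bar> \<notin> J"
        using g(1) unfolding r_def by (intro least) (simp add: nat_less_iff)
      ultimately have "r = 0" and "a [^] r \<otimes> h' \<in> K n" using J h' by blast+
      then have "h' \<in> K n" using gen[OF h'] by simp
      then have "h' \<in> K N" using h' N1[of n] n mono[of N1 N] by (auto simp: N_def)
      moreover have "x = h' \<otimes> b [^] q"
      proof -
        have "x = x \<otimes> b [^] (- q) \<otimes> b [^] q"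
          using KG[OF x] b by (simp add: int_pow_neg m_assoc)
        then show ?thesis using eq \<open>r = 0\<close> gen[OF h'] by simp
      qed
      ultimately show "x \<in> K N" 
        using subgroup.m_closed[OF insert.prems(2) _ bK[of N q]] by blast
    qed
    then show ?thesis by blast
  qed
qed

lemma fin_gen_maximal_subgroup:
  assumes fg: "fin_gen_group G" and ne: "\<F> \<noteq> {}" and sg: "\<And>K. K \<in> \<F> \<Longrightarrow> subgroup K G"
  obtains K where "K \<in> \<F>" "\<And>L. L \<in> \<F> \<Longrightarrow> K \<subseteq> L \<Longrightarrow> L = K"
proof (rule ccontr)
  assume no: "\<not> thesis"
  note result = that
  have "\<exists>L. L \<in> \<F> \<and> K \<subset> L" if K: "K \<in> \<F>" for K
  proof (rule ccontr)
    assume "\<nexists>L. L \<in> \<F> \<and> K \<subset> L"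
    then have thesis using K by (intro result) auto
    then show False using no by simp
  qed
  then have "\<exists>K. \<forall>n::nat. K n \<in> \<F> \<and> K n \<subset> K (Suc n)"
    using ne by (intro dependent_nat_choice) auto
  then obtain K where K': "\<forall>n::nat. K n \<in> \<F> \<and> K n \<subset> K (Suc n)" ..
  have K: "K n \<in> \<F>" "K n \<subset> K (Suc n)" for n using spec[OF K', of n] by blast+
  obtain A where A: "finite A" "A \<subseteq> carrier G" "generate G A = carrier G"
    using fg by (auto simp: fin_gen_group_def)
  have "\<exists>N. \<forall>n\<ge>N. K n \<subseteq> K N"
  proof (rule ascending_subgroups_stabilize[OF A(1,2)])
    show "subgroup (K n) G" for n using K sg by blast
    then show "K n \<subseteq> generate G A" for n using A subgroup.subset by blast
  qed (use K in blast)
  then obtain N where "K (Suc N) \<subseteq> K N" by (meson le_Suc_eq order_refl)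
  then show False using K(2)[of N] by blast
qed

end

section \<open>Submodules of large index\<close>

context right_module
begin

lemma act_inv:
  assumes "a \<in> carrier M" "r \<in> carrier R"
  shows "act a (\<ominus>\<^bsub>R\<^esub> r) = inv\<^bsub>M\<^esub> act a r"
proof -
  have zero: "act a \<zero>\<^bsub>R\<^esub> = \<one>\<^bsub>M\<^esub>"
    using act_add[OF assms(1), of "\<zero>\<^bsub>R\<^esub>" "\<zero>\<^bsub>R\<^esub>"] act_closed[OF assms(1), of "\<zero>\<^bsub>R\<^esub>"]
    by (simp add: M.l_cancel_one)
  have "act a (\<ominus>\<^bsub>R\<^esub> r) \<otimes>\<^bsub>M\<^esub> act a r = \<one>\<^bsub>M\<^esub>"
    using act_add[OF assms(1), of "\<ominus>\<^bsub>R\<^esub> r" r] assms zero by (simp add: R.l_neg)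
  then show ?thesis using assms act_closed by (metis M.inv_equality R.a_inv_closed)
qed

text \<open>
  For \<open>a\<^sub>0\<close> outside \<open>K\<close>, the annihilator of the class of \<open>a\<^sub>0\<close> modulo \<open>K\<close> is a proper right ideal, and
  multiplying \<open>a\<^sub>0\<close> by representatives of its cosets gives elements that differ modulo \<open>K\<close>.
\<close>

lemma many_cosets:
  assumes K: "subgroup K M" and K_act: "\<And>a r. a \<in> K \<Longrightarrow> r \<in> carrier R \<Longrightarrow> act a r \<in> K"
    and ne: "K \<noteq> carrier M" and N: "enat N \<le> min_right_ideal_index R"
  obtains a :: "nat \<Rightarrow> 'm" where "\<And>k. k < N \<Longrightarrow> a k \<in> carrier M"
    "\<And>k l. k < N \<Longrightarrow> l < N \<Longrightarrow> k \<noteq> l \<Longrightarrow> a k \<otimes>\<^bsub>M\<^esub> inv\<^bsub>M\<^esub> a l \<notin> K"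
proof -
  obtain a0 where a0: "a0 \<in> carrier M" "a0 \<notin> K"
    using ne subgroup.subset[OF K] by blast
  define I where "I = {r \<in> carrier R. act a0 r \<in> K}"
  have sub: "r \<ominus>\<^bsub>R\<^esub> s \<in> I" if "r \<in> carrier R" "s \<in> carrier R"
      "act a0 r \<otimes>\<^bsub>M\<^esub> inv\<^bsub>M\<^esub> act a0 s \<in> K" for r s
    using that a0 by (simp add: I_def R.minus_eq act_add act_inv)
  have one: "\<one>\<^bsub>R\<^esub> \<notin> I" using a0 by (simp add: I_def act_one)
  have "subgroup I (add_monoid R)"
  proof (rule R.add.subgroupI)
    show "I \<noteq> {}"
      using sub[of "\<one>\<^bsub>R\<^esub>" "\<one>\<^bsub>R\<^esub>"] a0 subgroup.one_closed[OF K] by (auto simp: act_one)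
    show "\<ominus>\<^bsub>R\<^esub> r \<in> I" if "r \<in> I" for r
      using that a0 subgroup.m_inv_closed[OF K] by (auto simp: I_def act_inv)
    show "r \<oplus>\<^bsub>R\<^esub> s \<in> I" if "r \<in> I" "s \<in> I" for r s
      using that a0 subgroup.m_closed[OF K] by (auto simp: I_def act_add)
  qed (auto simp: I_def)
  then have addsub: "additive_subgroup I R" by (rule additive_subgroup.intro)
  have "right_ideal I R"
    unfolding right_ideal_def using addsub a0 K_act by (auto simp: I_def act_assoc)
  moreover have "I \<noteq> carrier R" using one by auto
  ultimately have "min_right_ideal_index R \<le> ideal_index R I"
    unfolding min_right_ideal_index_def by (intro INF_lower) auto
  then have NI: "enat N \<le> ideal_index R I" using N by (rule order_trans[rotated])
  obtain T where T: "finite T" "card T = N" "T \<subseteq> a_rcosets\<^bsub>R\<^esub> I"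
  proof (cases "finite (a_rcosets\<^bsub>R\<^esub> I)")
    case True
    then have "N \<le> card (a_rcosets\<^bsub>R\<^esub> I)" using NI by (simp add: ideal_index_def)
    then show thesis by (rule obtain_subset_with_card_n) (use that in blast)
  next
    case False
    then show thesis using infinite_arbitrarily_large that by blast
  qed
  obtain e where e: "bij_betw e {0..<N} T"
    using ex_bij_betw_nat_finite[OF T(1)] T(2) by blast
  have "\<exists>r\<in>carrier R. e k = I +>\<^bsub>R\<^esub> r" if "k < N" for k
  proof -
    have "e k \<in> a_rcosets\<^bsub>R\<^esub> I" using bij_betw_apply[OF e] that T(3) by fastforce
    then show ?thesis by (auto simp: A_RCOSETS_def' a_r_coset_def')
  qed
  then obtain r where r: "\<And>k. k < N \<Longrightarrow> r k \<in> carrier R" "\<And>k. k < N \<Longrightarrow> e k = I +>\<^bsub>R\<^esub> r k"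
    by metis
  show thesis
  proof (rule that[of "\<lambda>k. act a0 (r k)"])
    show "act a0 (r k) \<in> carrier M" if "k < N" for k using r that a0 by (simp add: act_closed)
    show "act a0 (r k) \<otimes>\<^bsub>M\<^esub> inv\<^bsub>M\<^esub> act a0 (r l) \<notin> K" if kl: "k < N" "l < N" "k \<noteq> l" for k l
    proof
      assume "act a0 (r k) \<otimes>\<^bsub>M\<^esub> inv\<^bsub>M\<^esub> act a0 (r l) \<in> K"
      then have "r k \<ominus>\<^bsub>R\<^esub> r l \<in> I" using r kl by (intro sub) auto
      moreover have "r k = (r k \<ominus>\<^bsub>R\<^esub> r l) \<oplus>\<^bsub>R\<^esub> r l"
        using r kl by (simp add: R.minus_eq R.a_assoc R.l_neg)
      ultimately have "r k \<in> I +>\<^bsub>R\<^esub> r l" unfolding a_r_coset_def' by blast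
      then have "I +>\<^bsub>R\<^esub> r l = I +>\<^bsub>R\<^esub> r k"
        using r kl additive_subgroup.a_subgroup[OF addsub] by (intro R.a_repr_independence) auto
      then have "e k = e l" using r kl by simp
      then show False using bij_betw_imp_inj_on[OF e] kl by (auto dest: inj_onD)
    qed
  qed
qed

end

section \<open>Two subgroups with central commutators\<close>

text \<open>
  The relations between two adjacent vertex groups, imposed on arbitrary homomorphisms
  \<open>x\<close> and \<open>y\<close> into a group.
\<close>

locale kms_edge = A?: right_module R A ract + B?: comm_group B + group G
  for R :: "('r, 'x) ring_scheme" and A :: "('m, 'y) monoid_scheme" and ract
    and B :: "('n, 'z) monoid_scheme" and G :: "('g, 'w) monoid_scheme" (structure) +
  fixes lact :: "'r \<Rightarrow> 'n \<Rightarrow> 'n" and x :: "'m \<Rightarrow> 'g" and y :: "'n \<Rightarrow> 'g"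
    and comm :: "'m \<Rightarrow> 'n \<Rightarrow> 'g"
  defines "comm a b \<equiv> x a \<otimes> y b \<otimes> inv (x a) \<otimes> inv (y b)"
  assumes x_hom: "x \<in> hom A G" and y_hom: "y \<in> hom B G"
    and lact_closed: "r \<in> carrier R \<Longrightarrow> b \<in> carrier B \<Longrightarrow> lact r b \<in> carrier B"
    and comm_x: "a \<in> carrier A \<Longrightarrow> b \<in> carrier B \<Longrightarrow> a' \<in> carrier A \<Longrightarrow>
      comm a b \<otimes> x a' = x a' \<otimes> comm a b"
    and comm_y: "a \<in> carrier A \<Longrightarrow> b \<in> carrier B \<Longrightarrow> b' \<in> carrier B \<Longrightarrow>
      comm a b \<otimes> y b' = y b' \<otimes> comm a b"
    and balanced: "a \<in> carrier A \<Longrightarrow> b \<in> carrier B \<Longrightarrow> r \<in> carrier R \<Longrightarrow>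
      comm (ract a r) b = comm a (lact r b)"
begin

lemma x_closed [simp]: "a \<in> carrier A \<Longrightarrow> x a \<in> carrier G"
  using x_hom by (auto simp: hom_def)

lemma y_closed [simp]: "b \<in> carrier B \<Longrightarrow> y b \<in> carrier G"
  using y_hom by (auto simp: hom_def)

lemma comm_closed [simp]: "a \<in> carrier A \<Longrightarrow> b \<in> carrier B \<Longrightarrow> comm a b \<in> carrier G"
  by (simp add: comm_def)

lemma x_y: "a \<in> carrier A \<Longrightarrow> b \<in> carrier B \<Longrightarrow> x a \<otimes> y b = comm a b \<otimes> (y b \<otimes> x a)"
proof -
  assume ab: "a \<in> carrier A" "b \<in> carrier B"
  have "comm a b \<otimes> (y b \<otimes> x a) = x a \<otimes> y b \<otimes> inv (x a) \<otimes> (inv (y b) \<otimes> y b) \<otimes> x a"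
    unfolding comm_def using ab by (simp only: m_assoc m_closed inv_closed x_closed y_closed)
  also have "\<dots> = x a \<otimes> y b" using ab by (simp add: m_assoc)
  finally show ?thesis ..
qed

text \<open>
  With \<open>x_y\<close>, this characterises the commutator without inverses; its multiplicativity in both
  arguments is then a matter of moving central factors.
\<close>

lemma comm_unique:
  assumes "a \<in> carrier A" "b \<in> carrier B" "g \<in> carrier G" "x a \<otimes> y b = g \<otimes> (y b \<otimes> x a)"
  shows "comm a b = g"
  using assms x_y[of a b] right_cancel[of "y b \<otimes> x a" "comm a b" g] by simp

lemma comm_comm:
  assumes "a \<in> carrier A" "b \<in> carrier B" "a' \<in> carrier A" "b' \<in> carrier B"
  shows "comm a b \<otimes> comm a' b' = comm a' b' \<otimes> comm a b"
proof -
  have sg: "subgroup {g \<in> carrier G. comm a b \<otimes> g = g \<otimes> comm a b} G" (is "subgroup ?C G")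
  proof (rule subgroupI)
    fix g assume "g \<in> ?C"
    then show "inv g \<in> ?C" using assms
      by simp (metis comm_closed inv_closed inv_solve_left inv_solve_right m_assoc m_closed)
  next
    fix g h assume "g \<in> ?C" "h \<in> ?C"
    then show "g \<otimes> h \<in> ?C" using assms by simp (metis comm_closed m_assoc)
  qed (use assms in \<open>auto intro: exI[of _ \<one>]\<close>)
  have xy: "x a' \<in> ?C" "y b' \<in> ?C" using assms comm_x comm_y by auto
  then have "comm a' b' \<in> ?C"
    unfolding comm_def[of a' b'] by (intro subgroup.m_closed[OF sg] subgroup.m_inv_closed[OF sg] xy)
  then show ?thesis by simp
qed

lemma comm_mult_left:
  assumes "a \<in> carrier A" "a' \<in> carrier A" "b \<in> carrier B"
  shows "comm (a \<otimes>\<^bsub>A\<^esub> a') b = comm a b \<otimes> comm a' b"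
proof (rule comm_unique)
  have "x (a \<otimes>\<^bsub>A\<^esub> a') \<otimes> y b = x a \<otimes> (x a' \<otimes> y b)"
    using assms hom_mult[OF x_hom] by (simp add: m_assoc)
  also have "\<dots> = x a \<otimes> comm a' b \<otimes> (y b \<otimes> x a')"
    using assms by (simp add: x_y m_assoc)
  also have "x a \<otimes> comm a' b = comm a' b \<otimes> x a" using assms comm_x by simp
  also have "comm a' b \<otimes> x a \<otimes> (y b \<otimes> x a') = comm a' b \<otimes> (x a \<otimes> y b) \<otimes> x a'"
    using assms by (simp add: m_assoc)
  also have "\<dots> = comm a' b \<otimes> comm a b \<otimes> (y b \<otimes> (x a \<otimes> x a'))"
    using assms by (simp add: x_y m_assoc)
  also have "\<dots> = comm a b \<otimes> comm a' b \<otimes> (y b \<otimes> x (a \<otimes>\<^bsub>A\<^esub> a'))"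
    using assms hom_mult[OF x_hom] comm_comm by simp
  finally show "x (a \<otimes>\<^bsub>A\<^esub> a') \<otimes> y b = comm a b \<otimes> comm a' b \<otimes> (y b \<otimes> x (a \<otimes>\<^bsub>A\<^esub> a'))" .
qed (use assms in auto)

lemma comm_mult_right:
  assumes "a \<in> carrier A" "b \<in> carrier B" "b' \<in> carrier B"
  shows "comm a (b \<otimes>\<^bsub>B\<^esub> b') = comm a b \<otimes> comm a b'"
proof (rule comm_unique)
  have "x a \<otimes> y (b \<otimes>\<^bsub>B\<^esub> b') = (x a \<otimes> y b) \<otimes> y b'"
    using assms hom_mult[OF y_hom] by (simp add: m_assoc)
  also have "\<dots> = comm a b \<otimes> (y b \<otimes> (x a \<otimes> y b'))"
    using assms by (simp add: x_y[of a b] m_assoc)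
  also have "\<dots> = comm a b \<otimes> ((y b \<otimes> comm a b') \<otimes> (y b' \<otimes> x a))"
    using assms by (simp add: x_y m_assoc)
  also have "y b \<otimes> comm a b' = comm a b' \<otimes> y b" using assms comm_y by simp
  also have "comm a b \<otimes> ((comm a b' \<otimes> y b) \<otimes> (y b' \<otimes> x a))
      = comm a b \<otimes> comm a b' \<otimes> (y (b \<otimes>\<^bsub>B\<^esub> b') \<otimes> x a)"
    using assms hom_mult[OF y_hom] by (simp add: m_assoc)
  finally show "x a \<otimes> y (b \<otimes>\<^bsub>B\<^esub> b') = comm a b \<otimes> comm a b' \<otimes> (y (b \<otimes>\<^bsub>B\<^esub> b') \<otimes> x a)" .
qed (use assms in auto)

lemma comm_inv_left:
  assumes "a \<in> carrier A" "b \<in> carrier B"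
  shows "comm (inv\<^bsub>A\<^esub> a) b = inv (comm a b)"
proof -
  have "group_hom A G (\<lambda>a. comm a b)"
    using assms by (intro group_hom.intro M.is_group is_group group_hom_axioms.intro homI)
      (auto simp: comm_mult_left)
  then show ?thesis using group_hom.hom_inv assms by fastforce
qed

definition Z :: "'m \<Rightarrow> 'g set" where
  "Z a = comm a ` carrier B"

abbreviation "xA \<equiv> x ` carrier A"
abbreviation "yB \<equiv> y ` carrier B"

lemma subgroup_Z: assumes "a \<in> carrier A" shows "subgroup (Z a) G"
proof -
  have "group_hom B G (comm a)"
    using assms by (intro group_hom.intro B.is_group is_group group_hom_axioms.intro homI)
      (auto simp: comm_mult_right)
  then show ?thesis unfolding Z_def by (rule group_hom.img_is_subgroup)
qed

lemma subgroup_xA: "subgroup xA G"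
  using group_hom.img_is_subgroup[of A G x] x_hom
  by (simp add: group_hom_def group_hom_axioms_def M.is_group is_group)

lemma subgroup_yB: "subgroup yB G"
  using group_hom.img_is_subgroup[of B G y] y_hom
  by (simp add: group_hom_def group_hom_axioms_def B.is_group is_group)

lemma Z_commutes:
  assumes "a \<in> carrier A" "s \<in> Z a"
  shows "t \<in> xA \<Longrightarrow> s \<otimes> t = t \<otimes> s" "t \<in> yB \<Longrightarrow> s \<otimes> t = t \<otimes> s"
    "a' \<in> carrier A \<Longrightarrow> t \<in> Z a' \<Longrightarrow> s \<otimes> t = t \<otimes> s"
  using assms comm_x comm_y comm_comm by (auto simp: Z_def)

lemma Z_ract: "a \<in> carrier A \<Longrightarrow> r \<in> carrier R \<Longrightarrow> Z (ract a r) \<subseteq> Z a"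
  using balanced lact_closed by (auto simp: Z_def)

end

section \<open>The angle between two fixed spaces\<close>

context unitary_rep
begin

definition orth_fixed :: "'g set \<Rightarrow> 'h set" where
  "orth_fixed S = {v \<in> carrier H. \<forall>f\<in>fixed S. rip v f = 0}"

lemma orth_fixed_diff:
  "u \<in> orth_fixed S \<Longrightarrow> v \<in> orth_fixed S \<Longrightarrow> u \<ominus> v \<in> orth_fixed S"
  by (auto simp: orth_fixed_def rip_diff_left fixed_carrier)

lemma orth_fixed_scale:
  "u \<in> orth_fixed S \<Longrightarrow> complex_of_real c \<odot> u \<in> orth_fixed S"
  by (auto simp: orth_fixed_def rip_scale_left fixed_carrier)

lemma orth_fixed_proj:
  assumes S: "subgroup S G" and v: "v \<in> orth_fixed T"
    and inv: "\<And>f. f \<in> fixed T \<Longrightarrow> proj S f \<in> fixed T"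
  shows "proj S v \<in> orth_fixed T"
proof -
  have c: "v \<in> carrier H" using v by (simp add: orth_fixed_def)
  have "rip (proj S v) f = 0" if f: "f \<in> fixed T" for f
    using rip_proj_proj[OF S c fixed_carrier[OF f]] v inv[OF f] by (simp add: orth_fixed_def)
  then show ?thesis using S c by (simp add: orth_fixed_def)
qed

lemma sub_proj_orth:
  "subgroup S G \<Longrightarrow> v \<in> carrier H \<Longrightarrow> v \<ominus> proj S v \<in> orth_fixed S"
  by (simp add: orth_fixed_def proj_orth)

lemma proj_orth_eq_zero:
  assumes "subgroup S G" "v \<in> orth_fixed S"
  shows "proj S v = \<zero>"
  using assms subgroup.subset[OF assms(1)]
  by (intro proj_unique) (auto simp: orth_fixed_def fixed_carrier fixed_zero)

text \<open>
  The cosine of the Friedrichs angle between the two fixed spaces is at most \<open>c\<close>: the common part of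
  the two spaces, \<open>fixed (S \<union> T)\<close>, is split off before vectors are compared.
\<close>

definition friedrichs :: "real \<Rightarrow> 'g set \<Rightarrow> 'g set \<Rightarrow> bool" where
  "friedrichs c S T \<longleftrightarrow>
     (\<forall>u\<in>fixed S \<inter> orth_fixed (S \<union> T). \<forall>w\<in>fixed T \<inter> orth_fixed (S \<union> T).
        rip u w \<le> c * hnorm H u * hnorm H w)"

lemma friedrichs_sym: "friedrichs c S T \<Longrightarrow> friedrichs c T S"
proof -
  assume f: "friedrichs c S T"
  have "rip u w \<le> c * hnorm H u * hnorm H w"
    if "u \<in> fixed T \<inter> orth_fixed (T \<union> S)" "w \<in> fixed S \<inter> orth_fixed (T \<union> S)" for u w
    using f that rip_sym[of u w] fixed_carrier
    by (fastforce simp: friedrichs_def Un_commute mult_ac)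
  then show ?thesis by (simp add: friedrichs_def)
qed

text \<open>
  The orbit of \<open>u\<close> under \<open>T\<close> stays in \<open>fixed S\<close>, hence so does its projection onto \<open>fixed T\<close>. The
  projection thus lies in the common part, to which \<open>u\<close> is orthogonal, and so it vanishes.
\<close>

lemma rip_eq_zero_if_invariant:
  assumes S: "S \<subseteq> carrier G" and T: "subgroup T G"
    and u: "u \<in> fixed S" "u \<in> orth_fixed (S \<union> T)" and w: "w \<in> fixed T"
    and inv: "\<And>t. t \<in> T \<Longrightarrow> \<rho> t u \<in> fixed S"
  shows "rip u w = 0"
proof -
  have uc: "u \<in> carrier H" using u(1) by (rule fixed_carrier)
  have "proj T u \<in> fixed S" by (rule proj_mem_fixed[OF T S u(1) inv])
  then have p: "proj T u \<in> fixed (S \<union> T)"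
    using proj_fixed[OF T uc] by (auto simp: fixed_def)
  have "rip (proj T u) (proj T u) = 0"
    using p u(2) rip_proj_proj(2)[OF T uc uc] by (simp add: orth_fixed_def)
  then have "proj T u = \<zero>" using T uc by (simp add: rip_self_eq_0)
  then show ?thesis using rip_proj[OF T uc w] fixed_carrier[OF w] by simp
qed

lemma friedrichs_commuting:
  assumes S: "S \<subseteq> carrier G" and T: "subgroup T G"
    and comm: "\<And>s t. s \<in> S \<Longrightarrow> t \<in> T \<Longrightarrow> s \<otimes>\<^bsub>G\<^esub> t = t \<otimes>\<^bsub>G\<^esub> s" and c: "c \<ge> 0"
  shows "friedrichs c S T"
  unfolding friedrichs_def
proof (intro ballI)
  fix u w assume u: "u \<in> fixed S \<inter> orth_fixed (S \<union> T)" and w: "w \<in> fixed T \<inter> orth_fixed (S \<union> T)"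
  have uc: "u \<in> carrier H" using u fixed_carrier by auto
  have "\<rho> s (\<rho> t u) = \<rho> t u" if "s \<in> S" "t \<in> T" for s t
  proof -
    have "s \<in> carrier G" "t \<in> carrier G" using that S subgroup.subset[OF T] by auto
    then have "\<rho> s (\<rho> t u) = \<rho> t (\<rho> s u)"
      using uc comm[OF that] by (simp add: composition_rule[symmetric])
    then show ?thesis using u that by (simp add: fixed_def)
  qed
  then have "rip u w = 0"
    using u w uc S subgroup.subset[OF T]
    by (intro rip_eq_zero_if_invariant[OF S T]) (auto simp: fixed_def)
  moreover have "w \<in> carrier H" using w fixed_carrier by auto
  ultimately show "rip u w \<le> c * hnorm H u * hnorm H w" using uc c by simp
qed

lemma friedrichs_zero:
  assumes "\<And>n. n > 0 \<Longrightarrow> friedrichs (1 / sqrt (real n)) S T"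
  shows "friedrichs 0 S T"
  unfolding friedrichs_def
proof (intro ballI)
  fix u w assume uw: "u \<in> fixed S \<inter> orth_fixed (S \<union> T)" "w \<in> fixed T \<inter> orth_fixed (S \<union> T)"
  have "(\<lambda>n. sqrt (inverse (real (Suc n))) * (hnorm H u * hnorm H w)) \<longlonglongrightarrow> sqrt 0 * (hnorm H u * hnorm H w)"
    by (intro tendsto_mult_right tendsto_real_sqrt LIMSEQ_inverse_real_of_nat)
  moreover have "rip u w \<le> sqrt (inverse (real (Suc n))) * (hnorm H u * hnorm H w)" for n
    using assms[of "Suc n"] uw by (simp add: friedrichs_def inverse_eq_divide real_sqrt_divide mult.assoc)
  ultimately have "rip u w \<le> sqrt 0 * (hnorm H u * hnorm H w)"
    by (intro LIMSEQ_le_const) auto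
  then show "rip u w \<le> 0 * hnorm H u * hnorm H w" by simp
qed

lemma finite_sum_vector:
  fixes n :: nat
  assumes "\<And>k. k < n \<Longrightarrow> e k \<in> carrier H"
  shows "\<exists>s\<in>carrier H. \<forall>z\<in>carrier H. rip z s = (\<Sum>k<n. rip z (e k))"
  using assms
proof (induction n)
  case 0
  then show ?case by (intro bexI[of _ \<zero>]) auto
next
  case (Suc n)
  then obtain s where s: "s \<in> carrier H" "\<forall>z\<in>carrier H. rip z s = (\<Sum>k<n. rip z (e k))"
    by auto
  then show ?case using Suc.prems by (intro bexI[of _ "s \<oplus> e n"]) (auto simp: rip_add_right)
qed

text \<open>
  The vector \<open>u\<close> has the same inner product with each of the \<open>n\<close> orthogonal translates of \<open>w\<close>, while
  their sum has norm only \<open>\<surd>n \<parallel>w\<parallel>\<close>.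
\<close>

lemma rip_le_orthogonal_translates:
  assumes n: "n > 0" and u: "u \<in> carrier H" and w: "w \<in> carrier H"
    and g: "\<And>k. k < n \<Longrightarrow> g k \<in> carrier G" "\<And>k. k < n \<Longrightarrow> \<rho> (g k) u = u"
    and orth: "\<And>k l. k < n \<Longrightarrow> l < n \<Longrightarrow> k \<noteq> l \<Longrightarrow> rip (\<rho> (g k) w) (\<rho> (g l) w) = 0"
  shows "sqrt (real n) * rip u w \<le> hnorm H u * hnorm H w"
proof -
  obtain s where s: "s \<in> carrier H" "\<forall>z\<in>carrier H. rip z s = (\<Sum>k<n. rip z (\<rho> (g k) w))"
    using finite_sum_vector[of n "\<lambda>k. \<rho> (g k) w"] g w by auto
  have "rip (\<rho> (g k) w) s = (hnorm H w)\<^sup>2" if k: "k < n" for k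
  proof -
    have "rip (\<rho> (g k) w) s = (\<Sum>l<n. rip (\<rho> (g k) w) (\<rho> (g l) w))"
      using s g w k by auto
    also have "\<dots> = (\<Sum>l<n. if l = k then (hnorm H w)\<^sup>2 else 0)"
      using orth k g w by (intro sum.cong) (auto simp: rip_self hnorm_rep)
    finally show ?thesis using k by simp
  qed
  then have "rip s s = real n * (hnorm H w)\<^sup>2"
    using s g w rip_sym[OF s(1)] by simp
  then have "(hnorm H s)\<^sup>2 = (sqrt (real n) * hnorm H w)\<^sup>2"
    using s by (simp add: rip_self power_mult_distrib)
  then have ns: "hnorm H s = sqrt (real n) * hnorm H w"
    using s w by (simp add: power2_eq_iff_nonneg)
  have "rip u (\<rho> (g k) w) = rip u w" if "k < n" for k
    using rip_rep[of "g k" u w] g that u w by simp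
  then have "rip u s = real n * rip u w" using s u by simp
  then have "real n * rip u w \<le> hnorm H u * (sqrt (real n) * hnorm H w)"
    using rip_le[OF u s(1)] ns by simp
  then have "sqrt (real n) * (sqrt (real n) * rip u w) \<le> sqrt (real n) * (hnorm H u * hnorm H w)"
    by (simp add: mult.assoc[symmetric] mult.commute[of "sqrt (real n)" "hnorm H u * hnorm H w"])
      (simp add: mult_ac)
  then show ?thesis using n by simp
qed

end

locale kms_edge_rep = e: kms_edge R A ract B G lact x y comm + unitary_rep G H \<rho>
  for R :: "('r, 'x) ring_scheme" and A :: "('m, 'y) monoid_scheme" and ract
    and B :: "('n, 'z) monoid_scheme" and G :: "('g, 'w) monoid_scheme"
    and lact :: "'r \<Rightarrow> 'n \<Rightarrow> 'n" and x :: "'m \<Rightarrow> 'g" and y :: "'n \<Rightarrow> 'g" and comm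
    and H :: "'h inner_module" (structure) and \<rho>
begin

abbreviation "xA \<equiv> x ` carrier A"
abbreviation "yB \<equiv> y ` carrier B"

lemma xA_sub: "xA \<subseteq> carrier G" and yB_sub: "yB \<subseteq> carrier G"
  and Z_sub: "a \<in> carrier A \<Longrightarrow> e.Z a \<subseteq> carrier G"
  using subgroup.subset e.subgroup_xA e.subgroup_yB e.subgroup_Z by blast+

lemma Z_proj_fixed:
  assumes "a \<in> carrier A"
  shows "v \<in> fixed xA \<Longrightarrow> proj (e.Z a) v \<in> fixed xA"
    and "v \<in> fixed yB \<Longrightarrow> proj (e.Z a) v \<in> fixed yB"
    and "a' \<in> carrier A \<Longrightarrow> v \<in> fixed (e.Z a') \<Longrightarrow> proj (e.Z a) v \<in> fixed (e.Z a')"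
    and "v \<in> fixed (xA \<union> yB) \<Longrightarrow> proj (e.Z a) v \<in> fixed (xA \<union> yB)"
proof -
  note commuting = proj_mem_fixed_commuting[OF e.subgroup_Z[OF assms]]
  show "v \<in> fixed xA \<Longrightarrow> proj (e.Z a) v \<in> fixed xA"
    by (rule commuting[OF xA_sub _ e.Z_commutes(1)[OF assms]])
  show "v \<in> fixed yB \<Longrightarrow> proj (e.Z a) v \<in> fixed yB"
    by (rule commuting[OF yB_sub _ e.Z_commutes(2)[OF assms]])
  show "a' \<in> carrier A \<Longrightarrow> v \<in> fixed (e.Z a') \<Longrightarrow> proj (e.Z a) v \<in> fixed (e.Z a')"
    by (rule commuting[OF Z_sub _ e.Z_commutes(3)[OF assms]])
  show "v \<in> fixed (xA \<union> yB) \<Longrightarrow> proj (e.Z a) v \<in> fixed (xA \<union> yB)"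
    using xA_sub yB_sub e.Z_commutes(1,2)[OF assms] by (intro commuting) blast+
qed

lemma Z_proj_orth:
  "a \<in> carrier A \<Longrightarrow> a' \<in> carrier A \<Longrightarrow> v \<in> orth_fixed (e.Z a') \<Longrightarrow>
     proj (e.Z a) v \<in> orth_fixed (e.Z a')"
  "a \<in> carrier A \<Longrightarrow> v \<in> orth_fixed (xA \<union> yB) \<Longrightarrow> proj (e.Z a) v \<in> orth_fixed (xA \<union> yB)"
  by (auto intro!: orth_fixed_proj e.subgroup_Z Z_proj_fixed)

text \<open>
  If the centre acts on \<open>v\<close> by a character, this is the left kernel of the pairing which that character
  induces through the commutator.
\<close>

definition trivial_at :: "'h \<Rightarrow> 'm set" where
  "trivial_at v = {a \<in> carrier A. v \<in> fixed (e.Z a)}"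

lemma subgroup_trivial_at:
  assumes v: "v \<in> carrier H" shows "subgroup (trivial_at v) A"
proof -
  have iff: "a \<in> trivial_at v \<longleftrightarrow> a \<in> carrier A \<and> (\<forall>b\<in>carrier B. \<rho> (comm a b) v = v)" for a
    using v by (auto simp: trivial_at_def fixed_def e.Z_def)
  show ?thesis
  proof (rule group.subgroupI[OF e.M.is_group])
    have "comm \<one>\<^bsub>A\<^esub> b = \<one>\<^bsub>G\<^esub>" if "b \<in> carrier B" for b
      using e.comm_mult_left[of "\<one>\<^bsub>A\<^esub>" "\<one>\<^bsub>A\<^esub>" b] e.comm_closed[of "\<one>\<^bsub>A\<^esub>" b] that
      by simp
    then show "trivial_at v \<noteq> {}" using iff[of "\<one>\<^bsub>A\<^esub>"] v by (auto simp: rep_one)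
    show "inv\<^bsub>A\<^esub> a \<in> trivial_at v" if "a \<in> trivial_at v" for a
    proof -
      have "\<rho> (inv\<^bsub>G\<^esub> (comm a b)) v = v" if "b \<in> carrier B" for b
        using rep_inv_cancel(2)[of "comm a b" v] \<open>a \<in> trivial_at v\<close> that v by (simp add: iff)
      then show ?thesis using that by (simp add: iff e.comm_inv_left)
    qed
    show "a \<otimes>\<^bsub>A\<^esub> a' \<in> trivial_at v" if "a \<in> trivial_at v" "a' \<in> trivial_at v" for a a'
      using that v by (simp add: iff e.comm_mult_left composition_rule)
  qed (auto simp: trivial_at_def)
qed

text \<open>
  By the balancing relation, the commutators of \<open>x (ract a r)\<close> are among those of \<open>x a\<close>.
\<close>

lemma trivial_at_ract:
  assumes "a \<in> trivial_at v" "r \<in> carrier R"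
  shows "ract a r \<in> trivial_at v"
  using assms e.Z_ract[of a r] e.act_closed[of a r] by (auto simp: trivial_at_def fixed_def)

text \<open>
  As \<open>w\<close> is fixed by \<open>y b\<close>, the inner product of \<open>x a w\<close> with \<open>w\<close> does not change when \<open>w\<close> is replaced
  by its image under a commutator of \<open>x a\<close> and \<open>y b\<close>. Averaging over these commutators replaces \<open>w\<close>
  by its projection onto \<open>fixed (Z a)\<close>, which is zero.
\<close>

lemma rip_translate_eq_zero:
  assumes a: "a \<in> carrier A" and w: "w \<in> fixed yB" "w \<in> orth_fixed (e.Z a)"
  shows "rip (\<rho> (x a) w) w = 0"
proof -
  have wc: "w \<in> carrier H" using w(1) by (rule fixed_carrier)
  have "rip (\<rho> s w) (\<rho> (x a) w) = rip (\<rho> (x a) w) w" if "s \<in> e.Z a" for s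
  proof -
    obtain b where b: "b \<in> carrier B" "s = comm a b" using \<open>s \<in> e.Z a\<close> by (auto simp: e.Z_def)
    have sG: "s \<in> carrier G" using a b by simp
    have yw: "\<rho> (y b) w = w" using w(1) b by (simp add: fixed_def)
    have "\<rho> (x a) w = \<rho> (x a \<otimes>\<^bsub>G\<^esub> y b) w" using a b wc yw by (simp add: composition_rule)
    also have "\<dots> = \<rho> s (\<rho> (y b) (\<rho> (x a) w))"
      using a b sG wc e.x_y[OF a b(1)] by (simp add: composition_rule)
    finally have "rip (\<rho> s w) (\<rho> (x a) w) = rip w (\<rho> (y b) (\<rho> (x a) w))"
      using rip_rep[OF sG wc, of "\<rho> (y b) (\<rho> (x a) w)"] a b wc by simp
    also have "\<dots> = rip (\<rho> (y b) w) (\<rho> (y b) (\<rho> (x a) w))" using yw by simp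
    also have "\<dots> = rip w (\<rho> (x a) w)" using a b wc by (simp add: rip_rep)
    finally show ?thesis using rip_sym[of w] a wc by simp
  qed
  then have "rip (proj (e.Z a) w) (\<rho> (x a) w) = rip (\<rho> (x a) w) w"
    using a wc by (intro rip_proj_const e.subgroup_Z) auto
  then show ?thesis using proj_orth_eq_zero[OF e.subgroup_Z[OF a] w(2)] a wc by simp
qed

text \<open>
  A violation of \<open>\<surd>n \<langle>u, w\<rangle> \<le> (\<parallel>u\<parallel>\<^sup>2 + \<parallel>w\<parallel>\<^sup>2)/2\<close>. Up to scaling this is the desired
  \<open>\<surd>n \<langle>u, w\<rangle> \<le> \<parallel>u\<parallel> \<parallel>w\<parallel>\<close>, but both sides are additive for orthogonal splittings, so
  that a violation survives in one of the parts (\<open>bad_split\<close>).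
\<close>

definition bad :: "nat \<Rightarrow> 'h \<Rightarrow> 'h \<Rightarrow> bool" where
  "bad n u w \<longleftrightarrow> u \<in> fixed xA \<inter> orth_fixed (xA \<union> yB) \<and> w \<in> fixed yB \<inter> orth_fixed (xA \<union> yB)
     \<and> (hnorm H u)\<^sup>2 + (hnorm H w)\<^sup>2 < 2 * sqrt (real n) * rip u w"

lemma bad_carrier: "bad n u w \<Longrightarrow> u \<in> carrier H \<and> w \<in> carrier H"
  by (auto simp: bad_def fixed_carrier)

lemma bad_split:
  assumes bad: "bad n u w" and a: "a \<in> carrier A"
  defines "E \<equiv> proj (e.Z a)"
  shows "bad n (E u) (E w) \<or> bad n (u \<ominus> E u) (w \<ominus> E w)"
proof -
  note sg = e.subgroup_Z[OF a]
  have c: "u \<in> carrier H" "w \<in> carrier H" using bad_carrier[OF bad] by auto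
  have E: "E u \<in> fixed xA \<inter> orth_fixed (xA \<union> yB)" "E w \<in> fixed yB \<inter> orth_fixed (xA \<union> yB)"
    unfolding E_def using bad a by (auto simp: bad_def intro: Z_proj_fixed Z_proj_orth)
  moreover have "u \<ominus> E u \<in> fixed xA \<inter> orth_fixed (xA \<union> yB)"
    "w \<ominus> E w \<in> fixed yB \<inter> orth_fixed (xA \<union> yB)"
    using bad E xA_sub yB_sub by (auto simp: bad_def intro: fixed_diff orth_fixed_diff)
  moreover have "rip (u \<ominus> E u) (w \<ominus> E w) = rip u w - rip (E u) (E w)"
    using c sg rip_proj_proj[OF sg c] unfolding E_def
    by (simp add: rip_diff_left rip_diff_right)
  moreover have "(hnorm H (u \<ominus> E u))\<^sup>2 = (hnorm H u)\<^sup>2 - (hnorm H (E u))\<^sup>2"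
    "(hnorm H (w \<ominus> E w))\<^sup>2 = (hnorm H w)\<^sup>2 - (hnorm H (E w))\<^sup>2"
    unfolding E_def using c sg by (simp_all add: hnorm_proj_sq)
  moreover have "(hnorm H u)\<^sup>2 + (hnorm H w)\<^sup>2 < 2 * sqrt (real n) * rip u w"
    using bad by (simp add: bad_def)
  moreover have "2 * sqrt (real n) * rip u w
      = 2 * sqrt (real n) * rip (E u) (E w) + 2 * sqrt (real n) * (rip u w - rip (E u) (E w))"
    by (simp add: algebra_simps)
  ultimately show ?thesis unfolding bad_def by auto
qed

text \<open>
  Among all violating pairs choose one for which the subgroup \<open>K\<close> of those \<open>a\<close> whose commutators fix
  both vectors is maximal. For \<open>a\<close> outside \<open>K\<close>, the parts of the pair that are fixed by \<open>Z a\<close> have a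
  larger such subgroup, so they do not violate the bound and may be split off; the rest
  is a violating pair with the same \<open>K\<close>. If \<open>K\<close> is the whole module, \<open>x\<close> and \<open>y\<close>
  commute on \<open>u\<close> and the inner product is zero. Otherwise \<open>K\<close> is a proper submodule, and splitting off
  the finitely many \<open>Z a\<close> with \<open>a\<close> a difference of \<open>n\<close> coset representatives makes the \<open>n\<close> translates
  of \<open>w\<close> orthogonal.
\<close>

lemma not_bad:
  assumes fg: "fin_gen_group A" and n: "n > 0" "enat n \<le> min_right_ideal_index R"
  shows "\<not> bad n u w"
proof
  assume "bad n u w"
  define T where "T u w = trivial_at u \<inter> trivial_at w" for u w
  have sgT: "subgroup (T u w) A" if "bad n u w" for u w
    using bad_carrier[OF that] subgroup_trivial_at unfolding T_def
    by (intro e.M.subgroups_Inter_pair) auto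
  define \<F> where "\<F> = {K. \<exists>u w. bad n u w \<and> K = T u w}"
  obtain K where KF: "K \<in> \<F>" and max: "\<And>L. L \<in> \<F> \<Longrightarrow> K \<subseteq> L \<Longrightarrow> L = K"
  proof (rule e.M.fin_gen_maximal_subgroup[OF fg])
    show "\<F> \<noteq> {}" using \<open>bad n u w\<close> by (auto simp: \<F>_def)
    show "subgroup K A" if "K \<in> \<F>" for K using that sgT by (auto simp: \<F>_def)
  qed (rule that)
  have sgK: "subgroup K A" using KF sgT by (auto simp: \<F>_def)
  have maxT: "T u w = K" if "bad n u w" "K \<subseteq> T u w" for u w
    using that by (intro max) (auto simp: \<F>_def)
  \<comment> \<open>Splitting off one \<open>Z a\<close> after another keeps the earlier orthogonality, as the projections commute.\<close>
  have orth: "\<exists>u w. bad n u w \<and> T u w = K \<and> (\<forall>a\<in>D. w \<in> orth_fixed (e.Z a))"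
    if "finite D" "D \<subseteq> carrier A - K" for D
    using that
  proof (induction D rule: finite_induct)
    case empty
    then show ?case using KF by (auto simp: \<F>_def)
  next
    case (insert a D)
    then obtain u w where uw: "bad n u w" "T u w = K" "\<forall>a\<in>D. w \<in> orth_fixed (e.Z a)" by auto
    have a: "a \<in> carrier A" "a \<notin> K" using insert.prems by auto
    note sg = e.subgroup_Z[OF a(1)]
    have c: "u \<in> carrier H" "w \<in> carrier H" using bad_carrier[OF uw(1)] by auto
    define E where "E = proj (e.Z a)"
    have fixE: "E u \<in> fixed (e.Z a')" "E w \<in> fixed (e.Z a')" "u \<in> fixed (e.Z a')" "w \<in> fixed (e.Z a')"
        "a' \<in> carrier A" if "a' \<in> K" for a'
      using that a uw(2) Z_proj_fixed(3)[OF a(1)]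
      by (auto simp: T_def trivial_at_def E_def)
    have "\<not> bad n (E u) (E w)"
    proof
      assume b: "bad n (E u) (E w)"
      have "K \<subseteq> T (E u) (E w)" using fixE by (auto simp: T_def trivial_at_def)
      then have "T (E u) (E w) = K" by (rule maxT[OF b])
      moreover have "a \<in> T (E u) (E w)"
        using a c proj_fixed[OF sg] by (simp add: T_def trivial_at_def E_def)
      ultimately show False using a by simp
    qed
    then have b: "bad n (u \<ominus> E u) (w \<ominus> E w)"
      using bad_split[OF uw(1) a(1)] by (simp add: E_def)
    have "K \<subseteq> T (u \<ominus> E u) (w \<ominus> E w)"
      using fixE fixed_diff Z_sub by (auto simp: T_def trivial_at_def)
    then have "T (u \<ominus> E u) (w \<ominus> E w) = K" by (rule maxT[OF b])
    moreover have "w \<ominus> E w \<in> orth_fixed (e.Z a')" if "a' \<in> insert a D" for a'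
    proof (cases "a' = a")
      case True
      then show ?thesis unfolding E_def using sub_proj_orth[OF sg c(2)] by simp
    next
      case False
      then show ?thesis unfolding E_def using that uw(3) insert.prems a
        by (intro orth_fixed_diff Z_proj_orth) auto
    qed
    ultimately show ?case using b by blast
  qed
  show False
  proof (cases "K = carrier A")
    case True
    obtain u w where uw: "bad n u w" "T u w = K" using orth[of "{}"] by auto
    then have u: "u \<in> fixed xA" "u \<in> orth_fixed (xA \<union> yB)" and w: "w \<in> fixed yB"
      and c: "u \<in> carrier H" "w \<in> carrier H"
      using bad_carrier by (auto simp: bad_def)
    have "\<rho> (y b) u \<in> fixed xA" if b: "b \<in> carrier B" for b
    proof -
      have "\<rho> (x a) (\<rho> (y b) u) = \<rho> (y b) u" if a: "a \<in> carrier A" for a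
      proof -
        have cG: "comm a b \<in> carrier G" using a b by simp
        have "u \<in> fixed (e.Z a)" using uw(2) True a by (auto simp: T_def trivial_at_def)
        then have cu: "\<rho> (comm a b) u = u" using b by (auto simp: fixed_def e.Z_def)
        have xu: "\<rho> (x a) u = u" using u(1) a by (simp add: fixed_def)
        have "\<rho> (x a) (\<rho> (y b) u) = \<rho> (x a \<otimes>\<^bsub>G\<^esub> y b) u"
          using a b c by (simp add: composition_rule)
        also have "\<dots> = \<rho> (comm a b \<otimes>\<^bsub>G\<^esub> y b) (\<rho> (x a) u)"
          using a b c e.x_y[OF a b] by (simp add: composition_rule)
        also have "\<dots> = \<rho> (y b \<otimes>\<^bsub>G\<^esub> comm a b) u"
          using xu e.comm_y[OF a b b] by simp
        also have "\<dots> = \<rho> (y b) u" using a b c cu by (simp add: composition_rule)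
        finally show ?thesis .
      qed
      then show ?thesis using b c by (auto simp: fixed_def)
    qed
    then have "rip u w = 0"
      using xA_sub e.subgroup_yB u w by (intro rip_eq_zero_if_invariant[of xA yB]) auto
    moreover have "0 \<le> (hnorm H u)\<^sup>2 + (hnorm H w)\<^sup>2" by simp
    ultimately show False using uw(1) unfolding bad_def by (simp add: not_sum_power2_lt_zero)
  next
    case False
    have K_ract: "ract a r \<in> K" if "a \<in> K" "r \<in> carrier R" for a r
      using KF that trivial_at_ract by (auto simp: \<F>_def T_def)
    obtain a where a: "\<And>k. k < n \<Longrightarrow> a k \<in> carrier A"
      "\<And>k l. k < n \<Longrightarrow> l < n \<Longrightarrow> k \<noteq> l \<Longrightarrow> a k \<otimes>\<^bsub>A\<^esub> inv\<^bsub>A\<^esub> a l \<notin> K"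
      using e.many_cosets[OF sgK K_ract False n(2)] by blast
    define D where "D = (\<lambda>(k, l). a k \<otimes>\<^bsub>A\<^esub> inv\<^bsub>A\<^esub> a l) ` {(k, l). k < n \<and> l < n \<and> k \<noteq> l}"
    have "finite {(k, l). k < n \<and> l < n \<and> k \<noteq> l}"
      by (rule finite_subset[of _ "{..<n} \<times> {..<n}"]) auto
    then have "finite D" by (simp add: D_def)
    moreover have "D \<subseteq> carrier A - K" using a by (auto simp: D_def)
    ultimately obtain u w where uw: "bad n u w" "\<forall>a\<in>D. w \<in> orth_fixed (e.Z a)"
      using orth[of D] by auto
    then have u: "u \<in> fixed xA" and w: "w \<in> fixed yB"
      and c: "u \<in> carrier H" "w \<in> carrier H"
      using bad_carrier by (auto simp: bad_def)
    have "rip (\<rho> (x (a k)) w) (\<rho> (x (a l)) w) = 0" if kl: "k < n" "l < n" "k \<noteq> l" for k l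
    proof -
      define b where "b = a k \<otimes>\<^bsub>A\<^esub> inv\<^bsub>A\<^esub> a l"
      have b: "b \<in> carrier A" "b \<in> D" using a kl by (auto simp: b_def D_def)
      have "a k = a l \<otimes>\<^bsub>A\<^esub> b"
        using a(1)[OF kl(1)] a(1)[OF kl(2)] by (simp add: b_def e.M.m_ac e.M.m_lcomm)
      then have "\<rho> (x (a k)) w = \<rho> (x (a l)) (\<rho> (x b) w)"
        using a kl b c hom_mult[OF e.x_hom, of "a l" b] by (simp add: composition_rule)
      then have "rip (\<rho> (x (a k)) w) (\<rho> (x (a l)) w) = rip (\<rho> (x b) w) w"
        using a kl b c by (simp add: rip_rep)
      also have "\<dots> = 0" using rip_translate_eq_zero[OF b(1) w] uw(2) b(2) by simp
      finally show ?thesis .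
    qed
    then have "sqrt (real n) * rip u w \<le> hnorm H u * hnorm H w"
      using a c u by (intro rip_le_orthogonal_translates[of n u w "\<lambda>k. x (a k)"] n)
        (auto simp: fixed_def)
    also have "\<dots> \<le> ((hnorm H u)\<^sup>2 + (hnorm H w)\<^sup>2) / 2"
      using sum_squares_bound[of "hnorm H u" "hnorm H w"] by simp
    finally show False using uw(1) by (simp add: bad_def)
  qed
qed

lemma friedrichs_edge:
  assumes fg: "fin_gen_group A" and n: "n > 0" "enat n \<le> min_right_ideal_index R"
  shows "friedrichs (1 / sqrt (real n)) xA yB"
  unfolding friedrichs_def
proof (intro ballI)
  fix u w assume u: "u \<in> fixed xA \<inter> orth_fixed (xA \<union> yB)" and w: "w \<in> fixed yB \<inter> orth_fixed (xA \<union> yB)"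
  have c: "u \<in> carrier H" "w \<in> carrier H" using u w fixed_carrier by auto
  show "rip u w \<le> 1 / sqrt (real n) * hnorm H u * hnorm H w"
  proof (cases "u = \<zero> \<or> w = \<zero>")
    case True
    then show ?thesis using c by auto
  next
    case False
    \<comment> \<open>Scaling \<open>u\<close> to the norm of \<open>w\<close> turns the arithmetic mean into the geometric one.\<close>
    define t where "t = hnorm H w / hnorm H u"
    have pos: "hnorm H u > 0" "hnorm H w > 0"
      using False c hnorm_eq_0[of u] hnorm_eq_0[of w] hnorm_nonneg[of u] hnorm_nonneg[of w]
      by linarith+
    have "complex_of_real t \<odot> u \<in> fixed xA \<inter> orth_fixed (xA \<union> yB)"
      using u xA_sub by (auto intro: fixed_scale orth_fixed_scale)
    then have "\<not> (hnorm H (complex_of_real t \<odot> u))\<^sup>2 + (hnorm H w)\<^sup>2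
        < 2 * sqrt (real n) * rip (complex_of_real t \<odot> u) w"
      using not_bad[OF assms, of "complex_of_real t \<odot> u" w] w by (simp add: bad_def)
    moreover have "hnorm H (complex_of_real t \<odot> u) = hnorm H w"
      using pos c by (simp add: hnorm_smult t_def norm_divide)
    ultimately have "sqrt (real n) * (t * rip u w) \<le> (hnorm H w)\<^sup>2"
      using c by (simp add: rip_scale_left)
    then have "sqrt (real n) * rip u w \<le> hnorm H u * hnorm H w"
      using pos by (simp add: t_def field_simps power2_eq_square)
    then show ?thesis using n by (simp add: field_simps)
  qed
qed

end

section \<open>Arrangements of fixed spaces\<close>

text \<open>
  With \<open>d = card I\<close>, this is \<open>t\<^sup>T A\<^sup>-\<^sup>1 t\<close> for the \<open>d \<times> d\<close> matrix \<open>A\<close> with \<open>1\<close> on the diagonal and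
  \<open>-c\<close> elsewhere, which is positive definite when \<open>(d - 1) c < 1\<close>.
\<close>

definition potential :: "real \<Rightarrow> 'i set \<Rightarrow> ('i \<Rightarrow> real) \<Rightarrow> real" where
  "potential c I t =
     ((\<Sum>i\<in>I. (t i)\<^sup>2) + c / (1 - (real (card I) - 1) * c) * (\<Sum>i\<in>I. t i)\<^sup>2) / (1 + c)"

lemma potential_nonneg:
  assumes "c \<ge> 0" "(real (card I) - 1) * c < 1"
  shows "0 \<le> potential c I t"
  using assms unfolding potential_def by (simp add: sum_nonneg)

text \<open>
  In terms of the matrix \<open>A\<close>, the hypotheses say \<open>t' \<le> t - t\<^sub>i A e\<^sub>i\<close>. The inverse of \<open>A\<close> has
  nonnegative entries, so the form is monotone on nonnegative vectors, and at
  \<open>t - t\<^sub>i A e\<^sub>i\<close> its value is smaller than at \<open>t\<close> by exactly \<open>t\<^sub>i\<^sup>2\<close>.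
\<close>

lemma potential_step:
  assumes I: "finite I" "i \<in> I" and c: "c \<ge> 0" "(real (card I) - 1) * c < 1"
    and t: "\<And>j. j \<in> I \<Longrightarrow> 0 \<le> t' j"
    and i: "t' i = 0" and le: "\<And>j. j \<in> I \<Longrightarrow> j \<noteq> i \<Longrightarrow> t' j \<le> t j + c * t i"
  shows "potential c I t' \<le> potential c I t - (t i)\<^sup>2"
proof -
  define \<delta> where "\<delta> = 1 - (real (card I) - 1) * c"
  have \<delta>: "\<delta> > 0" using c by (simp add: \<delta>_def)
  have card: "real (card (I - {i})) = real (card I) - 1"
  proof -
    have "card I > 0" using I by (auto simp: card_gt_0_iff)
    then show ?thesis using I by (simp add: card_Diff_singleton of_nat_diff)
  qed
  \<comment> \<open>The extremal vector \<open>t - t\<^sub>i A e\<^sub>i\<close>.\<close>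
  define y where "y j = (if j = i then 0 else t j + c * t i)" for j
  have ty: "0 \<le> t' j" "t' j \<le> y j" if "j \<in> I" for j
    using that t i le by (auto simp: y_def)
  have "(\<Sum>j\<in>I. (t' j)\<^sup>2) \<le> (\<Sum>j\<in>I. (y j)\<^sup>2)"
    using ty by (intro sum_mono power_mono) auto
  moreover have "(\<Sum>j\<in>I. t' j)\<^sup>2 \<le> (\<Sum>j\<in>I. y j)\<^sup>2"
    using ty by (intro power_mono sum_mono sum_nonneg) auto
  ultimately have "potential c I t' \<le> potential c I y"
    unfolding potential_def \<delta>_def[symmetric] using c \<delta>
    by (intro divide_right_mono add_mono mult_left_mono) auto
  also have "potential c I y = potential c I t - (t i)\<^sup>2"
  proof -
    define \<sigma> q where "\<sigma> = (\<Sum>j\<in>I. t j)" and "q = (\<Sum>j\<in>I. (t j)\<^sup>2)"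
    have s1: "(\<Sum>j\<in>I - {i}. t j) = \<sigma> - t i" and s2: "(\<Sum>j\<in>I - {i}. (t j)\<^sup>2) = q - (t i)\<^sup>2"
      using I by (simp_all add: \<sigma>_def q_def sum_diff1)
    have "(\<Sum>j\<in>I. y j) = (\<Sum>j\<in>I - {i}. t j + c * t i)"
      using I by (simp add: sum.remove[of I i] y_def)
    then have y1: "(\<Sum>j\<in>I. y j) = \<sigma> - \<delta> * t i"
      by (simp add: sum.distrib s1 card \<delta>_def algebra_simps)
    have "(\<Sum>j\<in>I. (y j)\<^sup>2) = (\<Sum>j\<in>I - {i}. (t j)\<^sup>2 + (2 * c * t i * t j + (c * t i)\<^sup>2))"
      using I by (simp add: sum.remove[of I i] y_def power2_sum algebra_simps)
    also have "\<dots> = (q - (t i)\<^sup>2) + (2 * c * t i * (\<sigma> - t i) + (real (card I) - 1) * (c * t i)\<^sup>2)"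
      by (simp only: sum.distrib s1 s2 card sum_distrib_left[symmetric] sum_constant)
    finally have y2: "(\<Sum>j\<in>I. (y j)\<^sup>2)
        = q - (t i)\<^sup>2 + 2 * c * t i * (\<sigma> - t i) + (1 - \<delta>) * c * (t i)\<^sup>2"
      by (simp add: \<delta>_def power2_eq_square algebra_simps)
    have "(\<Sum>j\<in>I. (y j)\<^sup>2) + c / \<delta> * (\<Sum>j\<in>I. y j)\<^sup>2
        = (q + c / \<delta> * \<sigma>\<^sup>2) - (1 + c) * (t i)\<^sup>2"
      unfolding y1 y2 using \<delta> by (simp add: field_simps power2_eq_square)
    then show ?thesis
      unfolding potential_def \<delta>_def[symmetric] \<sigma>_def[symmetric] q_def[symmetric]
      using c by (simp add: diff_divide_distrib)
  qed
  finally show ?thesis .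
qed

lemma potential_le:
  assumes I: "finite I" and c: "c \<ge> 0" "(real (card I) - 1) * c < 1"
  shows "(1 - (real (card I) - 1) * c) * potential c I t \<le> (\<Sum>i\<in>I. (t i)\<^sup>2)"
proof -
  define \<delta> where "\<delta> = 1 - (real (card I) - 1) * c"
  have \<delta>: "\<delta> > 0" using c by (simp add: \<delta>_def)
  have "(\<Sum>i\<in>I. t i)\<^sup>2 \<le> real (card I) * (\<Sum>i\<in>I. (t i)\<^sup>2)"
    using sum_squared_le_sum_of_squares[of t I] by (simp add: mult.commute)
  then have "c * (\<Sum>i\<in>I. t i)\<^sup>2 \<le> c * (real (card I) * (\<Sum>i\<in>I. (t i)\<^sup>2))"
    using c by (intro mult_left_mono)
  then have "\<delta> * (\<Sum>i\<in>I. (t i)\<^sup>2) + c * (\<Sum>i\<in>I. t i)\<^sup>2 \<le> (1 + c) * (\<Sum>i\<in>I. (t i)\<^sup>2)"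
    by (simp add: \<delta>_def algebra_simps)
  moreover have "\<delta> * potential c I t = (\<delta> * (\<Sum>i\<in>I. (t i)\<^sup>2) + c * (\<Sum>i\<in>I. t i)\<^sup>2) / (1 + c)"
    unfolding potential_def \<delta>_def[symmetric] using \<delta> by (simp add: distrib_left)
  ultimately show ?thesis
    unfolding \<delta>_def[symmetric] using c by (simp add: pos_divide_le_eq mult.commute)
qed

context unitary_rep
begin

text \<open>
  The angle bound, transferred to the orthogonal complements of the two spaces. Let \<open>q\<close> be the
  projection of \<open>p\<close> onto \<open>fixed T\<close> and \<open>r\<close> that of \<open>q\<close> onto \<open>fixed S\<close>. The inner product of
  \<open>p\<close> with \<open>q\<close>, and also with \<open>r\<close>, is \<open>\<parallel>q\<parallel>\<^sup>2\<close>. The former gives \<open>\<parallel>q\<parallel> \<le> c \<parallel>p\<parallel>\<close> and the latter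
  \<open>\<parallel>q\<parallel>\<^sup>2 \<le> \<parallel>r\<parallel> \<parallel>p\<parallel>\<close>; the claim compares \<open>\<parallel>q\<parallel>\<^sup>2 - \<parallel>r\<parallel>\<^sup>2\<close> with \<open>\<parallel>p\<parallel>\<^sup>2 - \<parallel>q\<parallel>\<^sup>2\<close>.
\<close>

lemma friedrichs_dual:
  assumes S: "subgroup S G" and T: "subgroup T G" and c: "c \<ge> 0" and f: "friedrichs c S T"
    and p: "p \<in> fixed S" "p \<in> orth_fixed (S \<union> T)"
  shows "hnorm H (proj T p \<ominus> proj S (proj T p)) \<le> c * hnorm H (p \<ominus> proj T p)"
proof -
  let ?q = "proj T p"
  let ?r = "proj S ?q"
  have pc: "p \<in> carrier H" using p(1) by (rule fixed_carrier)
  have qc: "?q \<in> carrier H" and rc: "?r \<in> carrier H" using S T pc by auto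
  have "?q \<in> orth_fixed (S \<union> T)"
    using p(2) T by (intro orth_fixed_proj) (auto simp: proj_id fixed_def)
  then have "rip p ?q \<le> c * hnorm H p * hnorm H ?q"
    using f p proj_fixed[OF T pc] by (simp add: friedrichs_def)
  then have 1: "(hnorm H ?q)\<^sup>2 \<le> c * hnorm H p * hnorm H ?q"
    using rip_proj_proj(2)[OF T pc pc] qc by (simp add: rip_self)
  have "rip ?r p = rip ?q p" by (rule rip_proj[OF S qc p(1)])
  then have "(hnorm H ?q)\<^sup>2 = rip ?r p"
    using rip_proj_proj(1)[OF T pc pc] qc by (simp add: rip_self)
  then have 2: "(hnorm H ?q)\<^sup>2 \<le> hnorm H ?r * hnorm H p"
    using rip_le[OF rc pc] by simp
  define a b k where "a = hnorm H p" and "b = hnorm H ?q" and "k = hnorm H ?r"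
  have nn: "a \<ge> 0" "b \<ge> 0" "k \<ge> 0" using pc qc rc by (auto simp: a_def b_def k_def)
  have ab: "b\<^sup>2 \<le> a\<^sup>2"
  proof -
    have "0 \<le> (hnorm H (p \<ominus> ?q))\<^sup>2" by simp
    then show ?thesis using hnorm_proj_sq[OF T pc] by (simp add: a_def b_def)
  qed
  have "b\<^sup>2 - k\<^sup>2 \<le> c\<^sup>2 * (a\<^sup>2 - b\<^sup>2)"
  proof (cases "b = 0")
    case True
    then have "b\<^sup>2 - k\<^sup>2 \<le> 0" by simp
    also have "\<dots> \<le> c\<^sup>2 * (a\<^sup>2 - b\<^sup>2)" using True by simp
    finally show ?thesis .
  next
    case False
    then have b: "b > 0" using nn by simp
    have a: "a > 0" using ab b nn by (cases "a = 0") auto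
    have "b \<le> c * a" using 1 b by (simp add: a_def b_def power2_eq_square)
    then have "b\<^sup>2 \<le> (c * a)\<^sup>2" using nn by (intro power_mono) auto
    then have "b\<^sup>2 * (a\<^sup>2 - b\<^sup>2) \<le> c\<^sup>2 * a\<^sup>2 * (a\<^sup>2 - b\<^sup>2)"
      using ab by (intro mult_right_mono) (auto simp: power_mult_distrib)
    moreover have "(b\<^sup>2)\<^sup>2 \<le> (k * a)\<^sup>2"
      using 2 nn by (intro power_mono) (auto simp: a_def b_def k_def)
    ultimately have "a\<^sup>2 * (b\<^sup>2 - k\<^sup>2) \<le> a\<^sup>2 * (c\<^sup>2 * (a\<^sup>2 - b\<^sup>2))"
      by (simp add: power_mult_distrib power2_eq_square algebra_simps)
    then show ?thesis using a by simp
  qed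
  then have "(hnorm H (?q \<ominus> ?r))\<^sup>2 \<le> (c * hnorm H (p \<ominus> ?q))\<^sup>2"
    using hnorm_proj_sq[OF S qc] hnorm_proj_sq[OF T pc]
    by (simp add: a_def b_def k_def power_mult_distrib)
  then show ?thesis by (rule power2_le_imp_le) (use c pc qc in simp)
qed

text \<open>
  Let \<open>p\<close> be the projection of \<open>v\<close> onto \<open>fixed S\<close>, and put \<open>n = v - p\<close>. The vector \<open>m\<close> from the projection of
  \<open>p\<close> onto \<open>fixed T\<close> to \<open>p\<close> is orthogonal to \<open>fixed T\<close>, so \<open>\<parallel>m\<parallel>\<^sup>2\<close> is the inner product of \<open>m\<close>
  with \<open>p = v - n\<close>. The part of \<open>v\<close> in \<open>fixed T\<close> does not contribute, and the inner product of \<open>m\<close> with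
  \<open>n\<close> is small since both lie in orthogonal complements to which \<open>friedrichs_dual\<close> applies.
\<close>

lemma hnorm_sub_proj_after_proj:
  assumes S: "subgroup S G" and T: "subgroup T G" and c: "c \<ge> 0" and f: "friedrichs c S T"
    and v: "v \<in> carrier H"
  shows "hnorm H (proj S v \<ominus> proj T (proj S v))
    \<le> hnorm H (v \<ominus> proj T v) + c * hnorm H (v \<ominus> proj S v)"
proof -
  have sub: "S \<union> T \<subseteq> carrier G" using subgroup.subset[OF S] subgroup.subset[OF T] by auto
  define U where "U = generate G (S \<union> T)"
  have U: "subgroup U G" unfolding U_def by (rule group.generate_is_subgroup[OF group_G sub])
  have fU: "fixed U = fixed (S \<union> T)" unfolding U_def by (rule fixed_generate[OF sub])
  define p where "p = proj S v"
  define h where "h = proj U p"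
  \<comment> \<open>As \<open>h\<close> lies in both spaces, \<open>p0\<close> differs from its projections by the same vectors as \<open>p\<close>.\<close>
  define p0 where "p0 = p \<ominus> h"
  have pc: "p \<in> carrier H" unfolding p_def using S v by simp
  have "h \<in> fixed (S \<union> T)" unfolding h_def using proj_fixed[OF U pc] fU by simp
  then have h: "h \<in> fixed S" "h \<in> fixed T" by (auto simp: fixed_def)
  have hc: "h \<in> carrier H" using h(1) by (rule fixed_carrier)
  have p0: "p0 \<in> fixed S" unfolding p0_def p_def
    using h sub proj_fixed[OF S v] by (intro fixed_diff) auto
  have "p0 \<in> orth_fixed (S \<union> T)"
    unfolding p0_def h_def using sub_proj_orth[OF U pc] fU by (simp add: orth_fixed_def)
  note dual = friedrichs_dual[OF S T c f p0 this]
  have p0c: "p0 \<in> carrier H" using p0 by (rule fixed_carrier)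
  define q r m n where "q = proj T p0" and "r = proj S q" and "m = p0 \<ominus> q" and "n = v \<ominus> p"
  have cc: "q \<in> carrier H" "r \<in> carrier H" "m \<in> carrier H" "n \<in> carrier H"
    unfolding q_def r_def m_def n_def using S T p0c v pc by auto
  have mT: "rip m g = 0" if "g \<in> fixed T" for g
    unfolding m_def q_def by (rule proj_orth[OF T p0c that])
  have nS: "rip n g = 0" if "g \<in> fixed S" for g
    unfolding n_def p_def by (rule proj_orth[OF S v that])
  have qT: "q \<in> fixed T" unfolding q_def by (rule proj_fixed[OF T p0c])
  have rS: "r \<in> fixed S" unfolding r_def by (rule proj_fixed[OF S cc(1)])
  have m_eq: "p \<ominus> proj T p = m"
  proof (rule eq_if_rip_eq)
    have "q = proj T p \<ominus> h" unfolding q_def p0_def using T pc h by (simp add: proj_diff hc proj_id)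
    then show "rip (p \<ominus> proj T p) z = rip m z" if "z \<in> carrier H" for z
      using that T pc hc by (simp add: m_def p0_def rip_diff_left)
  qed (use T pc cc in auto)
  have "(hnorm H m)\<^sup>2 = rip m p0"
    using mT[OF qT] cc p0c by (simp add: rip_self[symmetric] m_def rip_diff_right)
  also have "\<dots> = rip m p" unfolding p0_def using mT[OF h(2)] cc pc hc by (simp add: rip_diff_right)
  also have "\<dots> = rip m (v \<ominus> proj T v) - rip m n"
    unfolding n_def using mT[OF proj_fixed[OF T v]] T cc v pc by (simp add: rip_diff_right)
  also have "- rip m n = rip (q \<ominus> r) n"
    using nS[OF p0] nS[OF rS] cc p0c rip_sym[of n p0] rip_sym[of n r]
    by (simp add: m_def rip_diff_left)
  then have "rip m (v \<ominus> proj T v) - rip m n = rip m (v \<ominus> proj T v) + rip (q \<ominus> r) n" by simp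
  also have "\<dots> \<le> hnorm H m * hnorm H (v \<ominus> proj T v) + hnorm H (q \<ominus> r) * hnorm H n"
    using T v cc by (intro add_mono rip_le) auto
  also have "\<dots> \<le> hnorm H m * hnorm H (v \<ominus> proj T v) + c * hnorm H m * hnorm H n"
    using dual cc unfolding q_def[symmetric] r_def[symmetric] m_def[symmetric]
    by (intro add_left_mono mult_right_mono) auto
  finally have "hnorm H m * hnorm H m \<le> hnorm H m * (hnorm H (v \<ominus> proj T v) + c * hnorm H n)"
    by (simp add: power2_eq_square algebra_simps)
  then have "hnorm H m \<le> hnorm H (v \<ominus> proj T v) + c * hnorm H n"
  proof (cases "hnorm H m = 0")
    case True
    then show ?thesis using T v cc c by simp
  next
    case False
    then have "hnorm H m > 0" using hnorm_nonneg[OF cc(3)] by linarith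
    then show ?thesis
      using \<open>hnorm H m * hnorm H m \<le> hnorm H m * (hnorm H (v \<ominus> proj T v) + c * hnorm H n)\<close> by simp
  qed
  then show ?thesis unfolding m_eq[symmetric] n_def p_def .
qed

lemma geometric_tends:
  assumes xs: "range xs \<subseteq> carrier H" and r: "0 \<le> r" "r < 1"
    and step: "\<And>n. hnorm H (xs (Suc n) \<ominus> xs n) \<le> K * r ^ n"
  obtains x where "tends xs x"
proof (rule cauchy_tends[OF xs])
  have c: "xs n \<in> carrier H" for n using xs by auto
  have K: "K \<ge> 0" using order_trans[OF hnorm_nonneg step[of 0]] c by simp
  have tri: "hnorm H (a \<ominus> b) \<le> hnorm H (a \<ominus> d) + hnorm H (d \<ominus> b)"
    if "a \<in> carrier H" "b \<in> carrier H" "d \<in> carrier H" for a b d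
    using Metric_space.triangle[OF metric, of a d b] that by (simp add: hdist_def)
  have sym: "hnorm H (a \<ominus> b) = hnorm H (b \<ominus> a)" if "a \<in> carrier H" "b \<in> carrier H" for a b
    using Metric_space.commute[OF metric, of a b] that by (simp add: hdist_def)
  have dist: "hnorm H (xs (n + k) \<ominus> xs n) \<le> (K / (1 - r)) * r ^ n - (K / (1 - r)) * r ^ (n + k)" for n k
  proof (induction k)
    case 0
    have "xs n \<ominus> xs n = \<zero>" using c by (simp add: M.minus_eq M.r_neg)
    then show ?case by (simp add: hnorm_eq_0)
  next
    case (Suc k)
    have "K * r ^ (n + k) = (K / (1 - r)) * r ^ (n + k) - (K / (1 - r)) * r ^ (n + Suc k)"
    proof -
      have "K = K / (1 - r) * (1 - r)" using r by simp
      then have "K * r ^ (n + k) = K / (1 - r) * (1 - r) * r ^ (n + k)" by simp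
      then show ?thesis by (simp add: right_diff_distrib left_diff_distrib diff_divide_distrib mult_ac)
    qed
    then show ?case
      using Suc step[of "n + k"] tri[OF c[of "n + Suc k"] c[of n] c[of "n + k"]] by simp
  qed
  fix e :: real assume e: "e > 0"
  have "(\<lambda>n. (K / (1 - r)) * r ^ n) \<longlonglongrightarrow> (K / (1 - r)) * 0"
    using r by (intro tendsto_mult_left LIMSEQ_realpow_zero) auto
  then have "\<forall>\<^sub>F n in sequentially. (K / (1 - r)) * r ^ n < e / 2"
    using e by (intro order_tendstoD) auto
  then obtain N where N: "(K / (1 - r)) * r ^ N < e / 2" by (auto simp: eventually_sequentially)
  have near: "hnorm H (xs m \<ominus> xs N) < e / 2" if "m \<ge> N" for m
  proof -
    have "0 \<le> (K / (1 - r)) * r ^ m" using K r by simp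
    moreover have "hnorm H (xs m \<ominus> xs N) \<le> (K / (1 - r)) * r ^ N - (K / (1 - r)) * r ^ m"
      using dist[of N "m - N"] that by simp
    ultimately show ?thesis using N by linarith
  qed
  have "hnorm H (xs m \<ominus> xs n) < e" if "m \<ge> N" "n \<ge> N" for m n
    using near[OF that(1)] near[OF that(2)] tri[OF c[of m] c[of n] c[of N]] sym[OF c[of n] c[of N]]
    by simp
  then show "\<exists>N. \<forall>m\<ge>N. \<forall>n\<ge>N. hnorm H (xs m \<ominus> xs n) < e" by blast
qed (rule that)

text \<open>
  Iterated projection onto the farthest fixed space. The potential \<open>\<Phi>\<close> of the distances is
  comparable to the square of the largest one, and drops by at least that in each step; hence it decays
  geometrically and the iterates converge, to a vector in all fixed spaces. The squared norm drops
  by exactly the square of the step, so \<open>\<Phi> v - \<parallel>v\<parallel>\<^sup>2\<close> decreases along the iteration. Its limit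
  is \<open>0\<close>.
\<close>

lemma hnorm_le_sum_distances:
  assumes I: "finite I" "I \<noteq> {}" and S: "\<And>i. i \<in> I \<Longrightarrow> subgroup (S i) G"
    and c: "c \<ge> 0" "(real (card I) - 1) * c < 1"
    and angle: "\<And>i j. i \<in> I \<Longrightarrow> j \<in> I \<Longrightarrow> i \<noteq> j \<Longrightarrow> friedrichs c (S i) (S j)"
    and trivial: "\<And>v. v \<in> carrier H \<Longrightarrow> (\<And>i. i \<in> I \<Longrightarrow> v \<in> fixed (S i)) \<Longrightarrow> v = \<zero>"
    and v: "v \<in> carrier H"
  shows "(1 - (real (card I) - 1) * c) * (hnorm H v)\<^sup>2
    \<le> (\<Sum>i\<in>I. (hnorm H (v \<ominus> proj (S i) v))\<^sup>2)"
proof -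
  define \<delta> where "\<delta> = 1 - (real (card I) - 1) * c"
  have \<delta>: "\<delta> > 0" using c by (simp add: \<delta>_def)
  have card: "real (card I) \<ge> 1"
    using I by (simp add: Suc_leI card_gt_0_iff)
  define D where "D v i = hnorm H (v \<ominus> proj (S i) v)" for v i
  define \<Phi> where "\<Phi> v = potential c I (D v)" for v
  have \<Phi>_nonneg: "0 \<le> \<Phi> v" for v unfolding \<Phi>_def by (rule potential_nonneg[OF c])
  have D_nonneg: "0 \<le> D v i" if "v \<in> carrier H" "i \<in> I" for v i
    unfolding D_def using that S by simp
  define far where "far v = (SOME i. i \<in> I \<and> (\<forall>j\<in>I. D v j \<le> D v i))" for v
  have far: "far v \<in> I" "j \<in> I \<Longrightarrow> D v j \<le> D v (far v)" for v j
  proof -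
    have "Max (D v ` I) \<in> D v ` I" using I by (intro Max_in) auto
    then obtain i where "i \<in> I" "D v i = Max (D v ` I)" by auto
    then have "i \<in> I \<and> (\<forall>j\<in>I. D v j \<le> D v i)" using I by auto
    then have "far v \<in> I \<and> (\<forall>j\<in>I. D v j \<le> D v (far v))" unfolding far_def by (rule someI)
    then show "far v \<in> I" "j \<in> I \<Longrightarrow> D v j \<le> D v (far v)" by auto
  qed
  define nxt where "nxt v = proj (S (far v)) v" for v
  have nxt_carrier: "nxt v \<in> carrier H" if "v \<in> carrier H" for v
    unfolding nxt_def using S far(1) that by simp
  have nxt_dist: "hnorm H (v \<ominus> nxt v) = D v (far v)" for v by (simp add: nxt_def D_def)
  have nxt_\<Phi>: "\<Phi> (nxt v) \<le> \<Phi> v - (D v (far v))\<^sup>2" if v: "v \<in> carrier H" for v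
    unfolding \<Phi>_def
  proof (rule potential_step[OF I(1) far(1) c])
    show "0 \<le> D (nxt v) j" if "j \<in> I" for j using D_nonneg nxt_carrier v that by blast
    have "proj (S (far v)) (nxt v) = nxt v"
      unfolding nxt_def using S far(1) v by (intro proj_id proj_fixed) auto
    then show "D (nxt v) (far v) = 0"
      using nxt_carrier[OF v] by (simp add: D_def M.minus_eq M.r_neg hnorm_eq_0)
    show "D (nxt v) j \<le> D v j + c * D v (far v)" if "j \<in> I" "j \<noteq> far v" for j
      unfolding D_def nxt_def
      using S far(1) that v c angle by (intro hnorm_sub_proj_after_proj) auto
  qed
  have \<Phi>_le: "\<delta> * \<Phi> v \<le> real (card I) * (D v (far v))\<^sup>2" if v: "v \<in> carrier H" for v
  proof -
    have "\<delta> * \<Phi> v \<le> (\<Sum>i\<in>I. (D v i)\<^sup>2)"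
      unfolding \<Phi>_def \<delta>_def by (rule potential_le[OF I(1) c])
    also have "\<dots> \<le> (\<Sum>i\<in>I. (D v (far v))\<^sup>2)"
      using far(2) D_nonneg v by (intro sum_mono power_mono) auto
    finally show ?thesis by simp
  qed
  \<comment> \<open>The decay rate: the largest squared distance is at least the fraction \<open>\<delta> / d\<close> of the potential.\<close>
  define \<theta> where "\<theta> = 1 - \<delta> / real (card I)"
  have "\<delta> \<le> real (card I)"
  proof -
    have "0 \<le> (real (card I) - 1) * c" using card c by simp
    then show ?thesis using card by (simp add: \<delta>_def)
  qed
  then have \<theta>: "0 \<le> \<theta>" "\<theta> < 1" using \<delta> card by (auto simp: \<theta>_def)
  have nxt_\<theta>: "\<Phi> (nxt v) \<le> \<theta> * \<Phi> v" if v: "v \<in> carrier H" for v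
  proof -
    have "\<delta> / real (card I) * \<Phi> v \<le> (D v (far v))\<^sup>2"
      using \<Phi>_le[OF v] card by (simp add: field_simps)
    then show ?thesis using nxt_\<Phi>[OF v] by (simp add: \<theta>_def algebra_simps)
  qed
  define xs where "xs n = (nxt ^^ n) v" for n
  have xs_Suc: "xs (Suc n) = nxt (xs n)" and xs_0: "xs 0 = v" for n by (simp_all add: xs_def)
  have xs: "xs n \<in> carrier H" for n
    by (induction n) (auto simp: xs_Suc xs_0 v nxt_carrier)
  have \<Phi>_xs: "\<Phi> (xs n) \<le> \<Phi> v * \<theta> ^ n" for n
  proof (induction n)
    case (Suc n)
    have "\<Phi> (xs (Suc n)) \<le> \<theta> * \<Phi> (xs n)" unfolding xs_Suc by (rule nxt_\<theta>[OF xs])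
    also have "\<dots> \<le> \<theta> * (\<Phi> v * \<theta> ^ n)" using Suc \<theta> by (intro mult_left_mono)
    finally show ?case by (simp add: mult_ac)
  qed (simp add: xs_0)
  have far_xs: "D (xs n) (far (xs n)) \<le> sqrt (\<Phi> v) * sqrt \<theta> ^ n" for n
  proof -
    have "(D (xs n) (far (xs n)))\<^sup>2 \<le> \<Phi> v * \<theta> ^ n"
      using nxt_\<Phi>[OF xs, of n] \<Phi>_nonneg[of "nxt (xs n)"] \<Phi>_xs[of n] by linarith
    then have "D (xs n) (far (xs n)) \<le> sqrt (\<Phi> v * \<theta> ^ n)" by (rule real_le_rsqrt)
    then show ?thesis by (simp add: real_sqrt_mult real_sqrt_power)
  qed
  have sqrt\<theta>: "0 \<le> sqrt \<theta>" "sqrt \<theta> < 1" using \<theta> by auto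
  obtain u where u: "tends xs u"
  proof (rule geometric_tends[OF _ sqrt\<theta>])
    show "range xs \<subseteq> carrier H" using xs by auto
    show "hnorm H (xs (Suc n) \<ominus> xs n) \<le> sqrt (\<Phi> v) * sqrt \<theta> ^ n" for n
      using far_xs[of n] nxt_dist[of "xs n"] Metric_space.commute[OF metric, of "xs n" "xs (Suc n)"]
        xs[of n] xs[of "Suc n"]
      by (simp add: hdist_def xs_Suc)
  qed (rule that)
  have "u \<in> fixed (S i)" if i: "i \<in> I" for i
  proof -
    have lim: "(\<lambda>n. sqrt (\<Phi> v) * sqrt \<theta> ^ n) \<longlonglongrightarrow> 0"
      using sqrt\<theta> by (intro tendsto_mult_right_zero LIMSEQ_realpow_zero)
    have "(\<lambda>n. hnorm H (xs n \<ominus> proj (S i) (xs n))) \<longlonglongrightarrow> 0"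
    proof (rule tendsto_sandwich[OF _ _ tendsto_const lim])
      show "\<forall>\<^sub>F n in sequentially. hnorm H (xs n \<ominus> proj (S i) (xs n)) \<le> sqrt (\<Phi> v) * sqrt \<theta> ^ n"
        using far(2)[OF i] far_xs order_trans unfolding D_def by (intro always_eventually) blast
    qed (use xs S i in auto)
    then have "tends (\<lambda>n. proj (S i) (xs n)) u"
      using xs S i by (intro tends_if_close[OF u]) auto
    then show ?thesis
      using S[OF i] xs by (intro fixed_lim[OF subgroup.subset[OF S[OF i]], of "\<lambda>n. proj (S i) (xs n)"])
        (auto intro: proj_fixed)
  qed
  then have "u = \<zero>" using trivial tends_carrier(2)[OF u] by blast
  with u have "tends xs \<zero>" by simp
  then have lim: "(\<lambda>n. - (hnorm H (xs n))\<^sup>2) \<longlonglongrightarrow> 0"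
    using tendsto_minus[OF tendsto_power[OF tends_hnorm, of xs \<zero> 2]] by simp
  have "- (hnorm H (xs n))\<^sup>2 \<le> \<Phi> v - (hnorm H v)\<^sup>2" for n
  proof -
    have "\<Phi> (xs n) - (hnorm H (xs n))\<^sup>2 \<le> \<Phi> v - (hnorm H v)\<^sup>2"
    proof (induction n)
      case (Suc n)
      have "(D (xs n) (far (xs n)))\<^sup>2 = (hnorm H (xs n))\<^sup>2 - (hnorm H (nxt (xs n)))\<^sup>2"
        unfolding nxt_def D_def by (rule hnorm_proj_sq[OF S[OF far(1)] xs])
      then show ?case using Suc nxt_\<Phi>[OF xs, of n] by (simp add: xs_Suc)
    qed (simp add: xs_0)
    then show ?thesis using \<Phi>_nonneg[of "xs n"] by linarith
  qed
  then have "0 \<le> \<Phi> v - (hnorm H v)\<^sup>2"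
    by (intro LIMSEQ_le_const2[OF lim]) auto
  then have "\<delta> * (hnorm H v)\<^sup>2 \<le> \<delta> * \<Phi> v" using \<delta> by simp
  also have "\<dots> \<le> (\<Sum>i\<in>I. (D v i)\<^sup>2)"
    unfolding \<Phi>_def \<delta>_def by (rule potential_le[OF I(1) c])
  finally show ?thesis by (simp add: \<delta>_def D_def)
qed

end

section \<open>The vertex groups of a mixed Kac-Moody-Steinberg group\<close>

lemma pres_class_closed: "w \<in> words Gen \<Longrightarrow> pres_class Gen Rel w \<in> carrier (presented_group Gen Rel)"
  by (simp add: presented_group_def)

lemma pres_class_Nil: "pres_class Gen Rel [] = \<one>\<^bsub>presented_group Gen Rel\<^esub>"
  by (simp add: presented_group_def)

lemma pres_class_inv:
  assumes "w \<in> words Gen"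
  shows "pres_class Gen Rel (word_inv w) = inv\<^bsub>presented_group Gen Rel\<^esub> pres_class Gen Rel w"
proof -
  have "pres_class Gen Rel (word_inv w @ w) = pres_class Gen Rel []"
    using pres_eq_left_inv[OF assms] assms by (simp add: pres_class_eq_iff)
  then have "pres_class Gen Rel (word_inv w) \<otimes>\<^bsub>presented_group Gen Rel\<^esub> pres_class Gen Rel w
      = \<one>\<^bsub>presented_group Gen Rel\<^esub>"
    using assms by (simp add: pres_class_mult pres_class_Nil)
  then show ?thesis
    using assms by (intro group.inv_equality[OF group_presented_group, symmetric])
      (auto simp: pres_class_closed)
qed

lemma word_commutator_words:
  "u \<in> words Gen \<Longrightarrow> v \<in> words Gen \<Longrightarrow> word_commutator u v \<in> words Gen"
  by (simp add: word_commutator_def)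

lemma pres_class_commutator:
  fixes Gen :: "'a set" and Rel
  defines "P \<equiv> presented_group Gen Rel"
  assumes "u \<in> words Gen" "v \<in> words Gen"
  shows "pres_class Gen Rel (word_commutator u v) =
    pres_class Gen Rel u \<otimes>\<^bsub>P\<^esub> pres_class Gen Rel v \<otimes>\<^bsub>P\<^esub> inv\<^bsub>P\<^esub> pres_class Gen Rel u
      \<otimes>\<^bsub>P\<^esub> inv\<^bsub>P\<^esub> pres_class Gen Rel v"
  using assms by (simp add: word_commutator_def pres_class_mult pres_class_inv[symmetric])

lemma pres_class_rel:
  assumes "(u, v) \<in> Rel" "u \<in> words Gen" shows "pres_class Gen Rel u = pres_class Gen Rel v"
  using assms by (simp add: pres_class_eq_iff pres_eq.rel)

lemma (in group) commute_if_commutator_trivial: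
  assumes "g \<in> carrier G" "h \<in> carrier G" "g \<otimes> h \<otimes> inv g \<otimes> inv h = \<one>"
  shows "g \<otimes> h = h \<otimes> g"
proof -
  have "g \<otimes> h \<otimes> inv g = h" using assms by (metis inv_equality inv_inv m_closed inv_closed)
  then show ?thesis using assms by (metis inv_solve_right m_closed)
qed

context kms_data
begin

abbreviation "K \<equiv> kms_group d E M R ract lact"

definition vertex_elt :: "nat \<Rightarrow> 'm \<Rightarrow> (nat \<times> 'm) word set" where
  "vertex_elt i a = pres_class (kms_gens d M) (kms_rels d E M R ract lact) (kms_letter i a)"

abbreviation "V \<equiv> kms_vertex_subgroup d E M R ract lact"

lemma V_eq: "V i = vertex_elt i ` carrier (M i)"
  by (simp add: kms_vertex_subgroup_def vertex_elt_def)

lemma group_K: "group K"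
  unfolding kms_group_def by (rule group_presented_group)

lemma letter_words: "i \<in> {1..d} \<Longrightarrow> a \<in> carrier (M i) \<Longrightarrow> kms_letter i a \<in> words (kms_gens d M)"
  by (simp add: kms_letter_def kms_gens_def)

lemma vertex_elt_closed: "i \<in> {1..d} \<Longrightarrow> a \<in> carrier (M i) \<Longrightarrow> vertex_elt i a \<in> carrier K"
  unfolding vertex_elt_def kms_group_def by (intro pres_class_closed letter_words)

lemma vertex_elt_hom: assumes i: "i \<in> {1..d}" shows "vertex_elt i \<in> hom (M i) K"
proof (rule homI)
  fix a b assume ab: "a \<in> carrier (M i)" "b \<in> carrier (M i)"
  have "(kms_letter i a @ kms_letter i b, kms_letter i (a \<otimes>\<^bsub>M i\<^esub> b)) \<in> kms_rels d E M R ract lact"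
    unfolding kms_rels_def using i ab by blast
  then show "vertex_elt i (a \<otimes>\<^bsub>M i\<^esub> b) = vertex_elt i a \<otimes>\<^bsub>K\<^esub> vertex_elt i b"
    using ab i letter_words pres_class_rel[of "kms_letter i a @ kms_letter i b"]
    by (simp add: vertex_elt_def kms_group_def pres_class_mult)
qed (use vertex_elt_closed i in auto)

lemma subgroup_V: assumes i: "i \<in> {1..d}" shows "subgroup (V i) K"
  using group_hom.img_is_subgroup[of "M i" K "vertex_elt i"] vertex_elt_hom[OF i] vertex_groups[OF i] group_K
  by (simp add: V_eq group_hom_def group_hom_axioms_def comm_group_def)

lemma edge_vertices: "{i, j} \<in> E \<Longrightarrow> i \<in> {1..d} \<and> j \<in> {1..d}"
  using edges by (fastforce simp: doubleton_eq_iff)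

lemma V_commute:
  assumes ij: "i \<in> {1..d}" "j \<in> {1..d}" "i \<noteq> j" "{i, j} \<notin> E" and s: "s \<in> V i" and t: "t \<in> V j"
  shows "s \<otimes>\<^bsub>K\<^esub> t = t \<otimes>\<^bsub>K\<^esub> s"
proof -
  obtain a b where a: "a \<in> carrier (M i)" "s = vertex_elt i a" and b: "b \<in> carrier (M j)" "t = vertex_elt j b"
    using s t by (auto simp: V_eq)
  have "(word_commutator (kms_letter i a) (kms_letter j b), []) \<in> kms_rels d E M R ract lact"
    unfolding kms_rels_def using ij a b by blast
  then have "pres_class (kms_gens d M) (kms_rels d E M R ract lact)
      (word_commutator (kms_letter i a) (kms_letter j b)) = \<one>\<^bsub>K\<^esub>"
    using ij a b by (subst pres_class_rel)
      (auto intro!: word_commutator_words letter_words simp: kms_group_def pres_class_Nil)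
  then have "s \<otimes>\<^bsub>K\<^esub> t \<otimes>\<^bsub>K\<^esub> inv\<^bsub>K\<^esub> s \<otimes>\<^bsub>K\<^esub> inv\<^bsub>K\<^esub> t = \<one>\<^bsub>K\<^esub>"
    using ij a b letter_words by (simp add: pres_class_commutator vertex_elt_def kms_group_def)
  then show ?thesis
    using ij a b vertex_elt_closed by (intro group.commute_if_commutator_trivial[OF group_K]) auto
qed

lemma kms_edge_vertices:
  assumes ij: "i < j" "{i, j} \<in> E"
  shows "kms_edge (R i j) (M i) (ract i j) (M j) K (lact i j) (vertex_elt i) (vertex_elt j)"
proof -
  have i: "i \<in> {1..d}" and j: "j \<in> {1..d}" using edge_vertices[OF ij(2)] by auto
  interpret left_module "R i j" "M j" "lact i j" by (rule left_modules[OF ij(2,1)])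
  let ?c = "\<lambda>a b. vertex_elt i a \<otimes>\<^bsub>K\<^esub> vertex_elt j b \<otimes>\<^bsub>K\<^esub> inv\<^bsub>K\<^esub> vertex_elt i a \<otimes>\<^bsub>K\<^esub> inv\<^bsub>K\<^esub> vertex_elt j b"
  let ?w = "\<lambda>a b. word_commutator (kms_letter i a) (kms_letter j b)"
  have w: "?w a b \<in> words (kms_gens d M)" "pres_class (kms_gens d M) (kms_rels d E M R ract lact) (?w a b) = ?c a b"
    if "a \<in> carrier (M i)" "b \<in> carrier (M j)" for a b
    using letter_words[OF i that(1)] letter_words[OF j that(2)]
    by (simp_all add: word_commutator_words pres_class_commutator vertex_elt_def kms_group_def)
  have c: "?c a b \<in> carrier K" if "a \<in> carrier (M i)" "b \<in> carrier (M j)" for a b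
    using w[OF that] pres_class_closed by (metis kms_group_def)
  have central: "?c a b \<otimes>\<^bsub>K\<^esub> vertex_elt k c = vertex_elt k c \<otimes>\<^bsub>K\<^esub> ?c a b"
    if "a \<in> carrier (M i)" "b \<in> carrier (M j)" "k \<in> {i, j}" "c \<in> carrier (M k)" for a b k c
  proof (rule group.commute_if_commutator_trivial[OF group_K])
    have k: "k \<in> {1..d}" using that i j by auto
    have "(word_commutator (?w a b) (kms_letter k c), []) \<in> kms_rels d E M R ract lact"
      unfolding kms_rels_def using ij that by blast
    from pres_class_rel[OF this word_commutator_words[OF w(1)[OF that(1,2)] letter_words[OF k that(4)]]]
    have "pres_class (kms_gens d M) (kms_rels d E M R ract lact)
        (word_commutator (?w a b) (kms_letter k c)) = \<one>\<^bsub>K\<^esub>"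
      by (simp add: kms_group_def pres_class_Nil)
    then show "?c a b \<otimes>\<^bsub>K\<^esub> vertex_elt k c \<otimes>\<^bsub>K\<^esub> inv\<^bsub>K\<^esub> ?c a b \<otimes>\<^bsub>K\<^esub> inv\<^bsub>K\<^esub> vertex_elt k c = \<one>\<^bsub>K\<^esub>"
      using w[OF that(1,2)] letter_words[OF k that(4)]
      by (simp add: pres_class_commutator vertex_elt_def kms_group_def)
    show "vertex_elt k c \<in> carrier K" by (rule vertex_elt_closed[OF k that(4)])
  qed (rule c[OF that(1,2)])
  have bal: "?c (ract i j a r) b = ?c a (lact i j r b)"
    if "a \<in> carrier (M i)" "b \<in> carrier (M j)" "r \<in> carrier (R i j)" for a b r
  proof -
    have "(?w (ract i j a r) b, ?w a (lact i j r b)) \<in> kms_rels d E M R ract lact"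
      unfolding kms_rels_def using ij that by blast
    moreover have "ract i j a r \<in> carrier (M i)" "lact i j r b \<in> carrier (M j)"
      using right_module.act_closed[OF right_modules[OF ij(2,1)]] act_closed that by auto
    ultimately show ?thesis using w that pres_class_rel by metis
  qed
  show ?thesis
  proof (intro kms_edge.intro kms_edge_axioms.intro)
    show "right_module (R i j) (M i) (ract i j)" by (rule right_modules[OF ij(2,1)])
    show "comm_group (M j)" by (rule vertex_groups[OF j])
    show "group K" by (rule group_K)
    show "vertex_elt i \<in> hom (M i) K" "vertex_elt j \<in> hom (M j) K" using vertex_elt_hom i j by auto
    show "lact i j r b \<in> carrier (M j)" if "r \<in> carrier (R i j)" "b \<in> carrier (M j)" for r b
      using that by (rule act_closed)
  qed (use central bal in auto)
qed

lemma generate_V: "generate K (\<Union>i\<in>{1..d}. V i) = carrier K"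
proof (intro equalityI subsetI)
  have sub: "(\<Union>i\<in>{1..d}. V i) \<subseteq> carrier K" using subgroup.subset[OF subgroup_V] by blast
  show "g \<in> carrier K" if "g \<in> generate K (\<Union>i\<in>{1..d}. V i)" for g
    using group.generate_in_carrier[OF group_K sub that] .
  fix g assume "g \<in> carrier K"
  then obtain w where w: "w \<in> words (kms_gens d M)"
    "g = pres_class (kms_gens d M) (kms_rels d E M R ract lact) w"
    by (auto simp: kms_group_def presented_group_def)
  have "pres_class (kms_gens d M) (kms_rels d E M R ract lact) w \<in> generate K (\<Union>i\<in>{1..d}. V i)"
    using w(1)
  proof (induction w)
    case Nil
    then show ?case using generate.one[of K] by (simp add: pres_class_Nil kms_group_def)
  next
    case (Cons l w)
    obtain i a e where l: "l = ((i, a), e)" by (metis prod.collapse)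
    have i: "i \<in> {1..d}" and a: "a \<in> carrier (M i)" and w: "w \<in> words (kms_gens d M)"
      using Cons.prems l by (auto simp: kms_gens_def)
    have v: "vertex_elt i a \<in> (\<Union>i\<in>{1..d}. V i)" using i a by (auto simp: V_eq)
    have "pres_class (kms_gens d M) (kms_rels d E M R ract lact) [((i, a), False)] = inv\<^bsub>K\<^esub> vertex_elt i a"
      using pres_class_inv[OF letter_words[OF i a], of "kms_rels d E M R ract lact"]
      by (simp add: vertex_elt_def kms_group_def) (simp add: kms_letter_def)
    then have "pres_class (kms_gens d M) (kms_rels d E M R ract lact) [l] \<in> {vertex_elt i a, inv\<^bsub>K\<^esub> vertex_elt i a}"
      by (cases e) (auto simp: l vertex_elt_def kms_letter_def)
    then have "pres_class (kms_gens d M) (kms_rels d E M R ract lact) [l]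
        \<in> generate K (\<Union>i\<in>{1..d}. V i)"
      using generate.incl[OF v] generate.inv[OF v] by auto
    moreover have "pres_class (kms_gens d M) (kms_rels d E M R ract lact) (l # w)
      = pres_class (kms_gens d M) (kms_rels d E M R ract lact) [l]
        \<otimes>\<^bsub>K\<^esub> pres_class (kms_gens d M) (kms_rels d E M R ract lact) w"
      using pres_class_mult[of "[l]" "kms_gens d M" w] i a w l
      by (simp add: kms_group_def kms_gens_def)
    ultimately show ?case using Cons.IH[OF w] by (simp add: generate.eng)
  qed
  then show "g \<in> generate K (\<Union>i\<in>{1..d}. V i)" using w by simp
qed

end

section \<open>The Kazhdan constant\<close>

lemma mult_inv_sqrt_less_one:
  assumes d: "d > 0" and m: "enat ((d - 1)\<^sup>2) < m"
  shows "(real d - 1) * inv_sqrt m < 1"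
proof (cases m)
  case (enat n)
  then have n: "(d - 1)\<^sup>2 < n" using m by simp
  have "(real d - 1)\<^sup>2 = real ((d - 1)\<^sup>2)" using d by (simp add: of_nat_diff)
  also have "\<dots> < real n" using n by (simp only: of_nat_less_iff)
  finally have "real d - 1 < sqrt (real n)" by (rule real_less_rsqrt)
  moreover have "0 < sqrt (real n)" using n by simp
  ultimately show ?thesis using enat by (simp add: inv_sqrt_def)
next
  case infinity
  then show ?thesis by (simp add: inv_sqrt_def)
qed

context kms_data
begin

text \<open>
  The bound \<open>hnorm_le_sum_distances\<close> with \<open>hnorm_sub_proj_le\<close> inserted for the distances. For \<open>d = 0\<close>
  every vector is invariant, so the hypotheses exclude that case.
\<close>

lemma displacement_bound:
  fixes H :: "'h inner_module"
  assumes fg: "\<forall>i\<in>{1..d}. fin_gen_group (M i)" and m: "enat ((d - 1)\<^sup>2) < kms_min_index E R"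
    and rep: "unitary_rep K H \<rho>" and no_inv: "no_invariant_vectors K H \<rho>"
    and v: "v \<in> carrier H" "v \<noteq> \<zero>\<^bsub>H\<^esub>" and e: "e > 0"
    and le: "\<forall>s\<in>(\<Union>i\<in>{1..d}. V i). hnorm H (\<rho> s v \<ominus>\<^bsub>H\<^esub> v) \<le> e * hnorm H v"
  shows "d > 0 \<and> sqrt (2 / real d * (1 - (real d - 1) * inv_sqrt (kms_min_index E R))) \<le> e"
proof -
  interpret unitary_rep K H \<rho> by (rule rep)
  define c where "c = inv_sqrt (kms_min_index E R)"
  have sub: "(\<Union>i\<in>{1..d}. V i) \<subseteq> carrier K" using subgroup.subset[OF subgroup_V] by blast
  have trivial: "u = \<zero>\<^bsub>H\<^esub>" if "u \<in> carrier H" "\<And>i. i \<in> {1..d} \<Longrightarrow> u \<in> fixed (V i)" for u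
  proof -
    have "u \<in> fixed (\<Union>i\<in>{1..d}. V i)" using that by (auto simp: fixed_def)
    then have "u \<in> fixed (carrier K)" using fixed_generate[OF sub] generate_V by simp
    then show ?thesis using no_inv that(1) by (simp add: no_invariant_vectors_def fixed_def)
  qed
  have d: "d > 0" using trivial[OF v(1)] v(2) by (cases "d = 0") auto
  have c0: "c \<ge> 0" unfolding c_def inv_sqrt_def by (auto split: enat.split)
  have c1: "(real d - 1) * c < 1" unfolding c_def by (rule mult_inv_sqrt_less_one[OF d m])
  have edge: "friedrichs c (V i) (V j)" if ij: "i < j" "{i, j} \<in> E" for i j
  proof -
    note fried = kms_edge_rep.friedrichs_edge[OF kms_edge_rep.intro[OF kms_edge_vertices[OF ij] rep]]
    have fgi: "fin_gen_group (M i)" using fg edge_vertices[OF ij(2)] by auto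
    have le: "kms_min_index E R \<le> min_right_ideal_index (R i j)"
      unfolding kms_min_index_def using ij by (intro INF_lower2[of "(i, j)"]) auto
    have *: "friedrichs (1 / sqrt (real n)) (V i) (V j)" if "n > 0" "enat n \<le> kms_min_index E R" for n
      unfolding V_eq using that le by (intro fried[OF fgi]) (auto intro: order_trans)
    show ?thesis
    proof (cases "kms_min_index E R")
      case (enat n)
      then have "n > 0" using m by (cases n) auto
      then show ?thesis using *[of n] enat by (simp add: c_def inv_sqrt_def)
    next
      case infinity
      then show ?thesis using friedrichs_zero * by (simp add: c_def inv_sqrt_def)
    qed
  qed
  have angle: "friedrichs c (V i) (V j)" if ij: "i \<in> {1..d}" "j \<in> {1..d}" "i \<noteq> j" for i j
  proof (cases "{i, j} \<in> E")
    case True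
    then show ?thesis
      using edge[of i j] edge[of j i] friedrichs_sym that(3) by (metis insert_commute nat_neq_iff)
  next
    case False
    show ?thesis
      using subgroup.subset[OF subgroup_V[OF ij(1)]] subgroup_V[OF ij(2)] V_commute[OF ij False] c0
      by (rule friedrichs_commuting)
  qed
  have "(1 - (real d - 1) * c) * (hnorm H v)\<^sup>2 \<le> (\<Sum>i\<in>{1..d}. (hnorm H (v \<ominus>\<^bsub>H\<^esub> proj (V i) v))\<^sup>2)"
    using hnorm_le_sum_distances[of "{1..d}" V c v] d subgroup_V c0 c1 angle trivial v(1) by simp
  also have "\<dots> \<le> (\<Sum>i\<in>{1..d}. (e * hnorm H v)\<^sup>2 / 2)"
  proof (intro sum_mono hnorm_sub_proj_le)
    show "hnorm H (\<rho> s v \<ominus>\<^bsub>H\<^esub> v) \<le> e * hnorm H v" if "i \<in> {1..d}" "s \<in> V i" for i s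
      using that le by blast
  qed (use subgroup_V v(1) in auto)
  finally have "(1 - (real d - 1) * c) * (hnorm H v)\<^sup>2 \<le> (real d * e\<^sup>2 / 2) * (hnorm H v)\<^sup>2"
    by (simp add: power_mult_distrib)
  moreover have "0 < (hnorm H v)\<^sup>2" using v by (simp add: hnorm_eq_0)
  ultimately have "1 - (real d - 1) * c \<le> real d * e\<^sup>2 / 2" by (rule mult_right_le_imp_le)
  then have "2 / real d * (1 - (real d - 1) * c) \<le> e\<^sup>2"
    using d by (simp add: field_simps)
  then have "sqrt (2 / real d * (1 - (real d - 1) * c)) \<le> sqrt (e\<^sup>2)" by (rule real_sqrt_le_mono)
  then show ?thesis using d e by (simp add: c_def)
qed

lemma le_kazhdan_constantI:
  fixes b :: real
  assumes "\<And>(H :: (nat \<times> 'm) word set rep_universe inner_module) \<rho> e v.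
    unitary_rep K H \<rho> \<Longrightarrow> no_invariant_vectors K H \<rho> \<Longrightarrow> v \<in> carrier H \<Longrightarrow> v \<noteq> \<zero>\<^bsub>H\<^esub> \<Longrightarrow> e > 0 \<Longrightarrow>
    (\<forall>s\<in>S. hnorm H (\<rho> s v \<ominus>\<^bsub>H\<^esub> v) \<le> e * hnorm H v) \<Longrightarrow> b \<le> e"
  shows "ereal b \<le> kazhdan_constant K S"
  unfolding kazhdan_constant_def kazhdan_constant_in_def
proof (rule INF_greatest, clarify)
  fix H :: "(nat \<times> 'm) word set rep_universe inner_module" and \<rho>
  assume rep: "unitary_rep K H \<rho>" "no_invariant_vectors K H \<rho>"
  show "ereal b \<le> rep_kazhdan S H \<rho>"
    unfolding rep_kazhdan_def
  proof (rule Inf_greatest, clarify)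
    fix e :: real and v
    assume "e > 0" "v \<in> carrier H" "v \<noteq> \<zero>\<^bsub>H\<^esub>"
      "\<forall>s\<in>S. hnorm H (\<rho> s v \<ominus>\<^bsub>H\<^esub> v) \<le> e * hnorm H v"
    then show "ereal b \<le> ereal e" using assms[OF rep] by simp
  qed
qed

end

theorem corollary7p2:
  fixes d :: nat and E :: "nat set set" and M :: "nat \<Rightarrow> 'm monoid"
    and R :: "nat \<Rightarrow> nat \<Rightarrow> 'r ring"
    and ract :: "nat \<Rightarrow> nat \<Rightarrow> 'm \<Rightarrow> 'r \<Rightarrow> 'm" and lact :: "nat \<Rightarrow> nat \<Rightarrow> 'r \<Rightarrow> 'm \<Rightarrow> 'm"
  assumes "kms_data d E M R ract lact"
    and "\<forall>i\<in>{1..d}. fin_gen_group (M i)"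
    and "enat ((d - 1)\<^sup>2) < kms_min_index E R"
  shows "ereal (sqrt (2 / real d * (1 - (real d - 1) * inv_sqrt (kms_min_index E R))))
           \<le> kazhdan_constant (kms_group d E M R ract lact)
               (\<Union>i\<in>{1..d}. kms_vertex_subgroup d E M R ract lact i)
       \<and> ((\<forall>i\<in>{1..d}. finite (carrier (M i))) \<longrightarrow> property_T (kms_group d E M R ract lact))"
proof -
  interpret kms_data d E M R ract lact by (rule assms(1))
  note bound = displacement_bound[OF assms(2,3)]
  define b where "b = sqrt (2 / real d * (1 - (real d - 1) * inv_sqrt (kms_min_index E R)))"
  have b: "ereal b \<le> kazhdan_constant K (\<Union>i\<in>{1..d}. V i)"
    unfolding b_def by (rule le_kazhdan_constantI) (rule conjunct2[OF bound]; assumption)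
  have "property_T K" if fin: "\<forall>i\<in>{1..d}. finite (carrier (M i))"
  proof -
    have "finite (\<Union>i\<in>{1..d}. V i)" using fin by (auto simp: V_eq)
    moreover have "(\<Union>i\<in>{1..d}. V i) \<subseteq> carrier K" using subgroup.subset[OF subgroup_V] by blast
    moreover have "0 < kazhdan_constant K (\<Union>i\<in>{1..d}. V i)"
    proof (cases "d = 0")
      case True
      \<comment> \<open>The trivial group has no nonzero representation without invariant vectors, while \<open>b = 0\<close>.\<close>
      have "ereal 1 \<le> kazhdan_constant K (\<Union>i\<in>{1..d}. V i)"
      proof (rule le_kazhdan_constantI)
        fix H :: "(nat \<times> 'm) word set rep_universe inner_module" and \<rho> e v
        assume "unitary_rep K H \<rho>" "no_invariant_vectors K H \<rho>" "v \<in> carrier H" "v \<noteq> \<zero>\<^bsub>H\<^esub>"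
          "e > 0" "\<forall>s\<in>(\<Union>i\<in>{1..d}. V i). hnorm H (\<rho> s v \<ominus>\<^bsub>H\<^esub> v) \<le> e * hnorm H v"
        from conjunct1[OF bound[OF this]] show "1 \<le> e" using True by simp
      qed
      then show ?thesis by (rule less_le_trans[rotated]) simp
    next
      case False
      have "0 < b" unfolding b_def using mult_inv_sqrt_less_one[OF _ assms(3)] False by simp
      then show ?thesis using b by (simp add: less_le_trans[of 0 "ereal b"])
    qed
    ultimately show ?thesis unfolding property_T_def by blast
  qed
  with b show ?thesis unfolding b_def by blast
qed

end
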